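(* Suppose that $\mathscr{A}$ is a unital $C^*$-algebra such that $\pi_\tau(\mathscr{A})''$ is diffuse for each trace $\tau\in\mathscr{T}(\mathscr{A})$. Similarly, suppose $\mathscr{B}$ is a unital $C^*$-algebra such that $\pi_\tau(\mathscr{B})''$ is diffuse for each trace $\tau\in\mathscr{T}(\mathscr{B})$. Then $$h(\mathscr{A}\otimes_{\min}\mathscr{B})\le0.$$
   Context: A trace is a tracial state; $\mathscr{T}(\mathscr{A})$ is the set of all traces on $\mathscr{A}$; $\pi_\tau$ is the GNS representation of $\tau$ on $L^2(\mathscr{A},\tau)$. A von Neumann algebra is diffuse if it has no minimal projections. $C^*$-algebras whose entropy is considered are assumed to admit traces. $1$-bounded entropy: for an index set $I$ let $\mathbb{C}^*\langle T_i\mid i\in I\rangle$ be the unital $*$-algebra of noncommutative complex polynomials in free variables $T_i$ and formal adjoints. For $R>0$, $\Sigma_{R,I}$ is the set of linear functionals $\ell$ on it with $\ell(P^*P)\ge 0$, $\ell(1)=1$, $\ell(PQ)=\ell(QP)$, and $\ell((T_j^*T_j)^k)\le R^{2k}$ for all $k\in\mathbb{N},j\in I$, with the weak-$*$ topology. For $A\in M_N(\mathbb{C})^I$ with $\|A_i\|\le R$ for all $i$, $\ell_A(P)=\frac1N\mathrm{Tr}(P(A))$; for $\mathcal{O}\subset\Sigma_{R,I}$ open, $\Gamma_R^{(N)}(\mathcal{O})=\{A\in M_N(\mathbb{C})^I:\|A_i\|\le R\ \forall i,\ \ell_A\in\mathcal{O}\}$. Let $\|A\|_2=(\frac1N\mathrm{Tr}(A^*A))^{1/2}$.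 For $\Omega\subset M_N(\mathbb{C})^I$, $F\subset I$ finite, $\epsilon>0$, $K^{\mathrm{orb}}_{F,\epsilon}(\Omega)$ is the minimal cardinality of $\Omega_0\subset\Omega$ such that for each $C\in\Omega$ there are $B\in\Omega_0$, $U\in U(N)$ with $\|C_i-UB_iU^*\|_2<\epsilon$ for all $i\in F$. For $K\subset\Sigma_{R,I}$ compact convex, $h(K)=\sup_{F,\epsilon}\inf_{\mathcal{O}\supset K}\limsup_{N\to\infty}\frac1{N^2}\log K^{\mathrm{orb}}_{F,\epsilon}(\Gamma_R^{(N)}(\mathcal{O}))$, with $\mathcal{O}$ ranging over weak-$*$ open neighborhoods of $K$ in $\Sigma_{R,I}$ and $\log0=-\infty$. For a unital $C^*$-algebra $\mathscr{D}$, $h(\mathscr{D})$ (the $1$-bounded entropy of its universal tracial completion) is $h(L_a)$, where $a=(a_i)_{i\in I}$ is any generating tuple with $\|a_i\|\le R$ for all $i$ and $L_a=\{P\mapsto\tau(P(a)):\tau\in\mathscr{T}(\mathscr{D})\}$; this does not depend on the choice of $R$ and $a$. *)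

theory Defs
  imports
    "HOL-Analysis.Analysis"
    "HOL-Library.Function_Algebras"
    "HOL-Library.Poly_Mapping"
    "Jordan_Normal_Form.Schur_Decomposition"
begin

section \<open>Complex vector spaces and unital C*-algebras\<close>

class complex_vector = ab_group_add +
  fixes scaleC :: "complex \<Rightarrow> 'a \<Rightarrow> 'a"  (infixr \<open>*\<^sub>C\<close> 75)
  assumes scaleC_add_right: "c *\<^sub>C (x + y) = c *\<^sub>C x + c *\<^sub>C y"
    and scaleC_add_left: "(c + d) *\<^sub>C x = c *\<^sub>C x + d *\<^sub>C x"
    and scaleC_scaleC: "c *\<^sub>C d *\<^sub>C x = (c * d) *\<^sub>C x"
    and scaleC_one: "1 *\<^sub>C x = x"

instantiation complex :: complex_vector
begin

definition scaleC_complex :: "complex \<Rightarrow> complex \<Rightarrow> complex"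
  where "scaleC_complex c x = c * x"

instance
  by standard (simp_all add: scaleC_complex_def algebra_simps)

end

instantiation "fun" :: (type, complex_vector) complex_vector
begin

definition scaleC_fun :: "complex \<Rightarrow> ('a \<Rightarrow> 'b) \<Rightarrow> 'a \<Rightarrow> 'b"
  where "scaleC_fun c f = (\<lambda>x. c *\<^sub>C f x)"

instance
  by standard
    (simp_all add: scaleC_fun_def plus_fun_def fun_eq_iff scaleC_add_right scaleC_add_left
      scaleC_scaleC scaleC_one)

end

lemma scaleC_zero_right [simp]: "c *\<^sub>C (0 :: 'a :: complex_vector) = 0"
  using scaleC_add_right [of c 0 "0 :: 'a"] by simp

instantiation poly_mapping :: (type, complex_vector) complex_vector
begin

definition scaleC_poly_mapping :: "complex \<Rightarrow> ('a \<Rightarrow>\<^sub>0 'b) \<Rightarrow> ('a \<Rightarrow>\<^sub>0 'b)"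
  where "scaleC_poly_mapping c p = Poly_Mapping.map (scaleC c) p"

lemma lookup_scaleC: "Poly_Mapping.lookup (c *\<^sub>C p) k = c *\<^sub>C Poly_Mapping.lookup p k"
  for p :: "'a \<Rightarrow>\<^sub>0 'b"
  by (simp add: scaleC_poly_mapping_def Poly_Mapping.map.rep_eq when_def)

instance
  by standard
    (auto intro!: poly_mapping_eqI
      simp: lookup_scaleC lookup_add scaleC_add_right scaleC_add_left scaleC_scaleC scaleC_one)

end

definition clinear :: "('a::complex_vector \<Rightarrow> 'b::complex_vector) \<Rightarrow> bool"
  where "clinear f \<longleftrightarrow> (\<forall>x y. f (x + y) = f x + f y) \<and> (\<forall>c x. f (c *\<^sub>C x) = c *\<^sub>C f x)"

text \<open>
  Since \<^class>\<open>real_normed_algebra_1\<close> contains \<open>norm 1 = 1\<close>, the zero algebra is excluded;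
  it has no tracial state.
\<close>

class cstar_algebra = complex_vector + real_normed_algebra_1 + banach +
  fixes star :: "'a \<Rightarrow> 'a"  (\<open>_\<^sup>\<star>\<close> [1000] 999)
  assumes scaleR_scaleC: "r *\<^sub>R x = complex_of_real r *\<^sub>C x"
    and mult_scaleC_left: "(c *\<^sub>C x) * y = c *\<^sub>C (x * y)"
    and mult_scaleC_right: "x * (c *\<^sub>C y) = c *\<^sub>C (x * y)"
    and norm_scaleC: "norm (c *\<^sub>C x) = cmod c * norm x"
    and star_add: "(x + y)\<^sup>\<star> = x\<^sup>\<star> + y\<^sup>\<star>"
    and star_scaleC: "(c *\<^sub>C x)\<^sup>\<star> = cnj c *\<^sub>C x\<^sup>\<star>"
    and star_mult: "(x * y)\<^sup>\<star> = y\<^sup>\<star> * x\<^sup>\<star>"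
    and star_star: "(x\<^sup>\<star>)\<^sup>\<star> = x"
    and cstar_identity: "norm (x\<^sup>\<star> * x) = (norm x)\<^sup>2"

instantiation complex :: cstar_algebra
begin

definition star_complex :: "complex \<Rightarrow> complex"
  where "star_complex = cnj"

instance
  by standard
    (simp_all add: star_complex_def scaleC_complex_def norm_mult scaleR_conv_of_real
      power2_eq_square)

end

definition states :: "('a::cstar_algebra \<Rightarrow> complex) set"
  where "states = {\<phi>. clinear \<phi> \<and> (\<forall>a. \<phi> (a\<^sup>\<star> * a) \<in> \<real>\<^sub>\<ge>\<^sub>0) \<and> \<phi> 1 = 1}"

definition traces :: "('a::cstar_algebra \<Rightarrow> complex) set"
  where "traces = {\<tau> \<in> states. \<forall>a b. \<tau> (a * b) = \<tau> (b * a)}"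


section \<open>Hilbert spaces and their operators\<close>

text \<open>
  A Hilbert space is a subset of an ambient complex vector space, with an inner product that is
  linear in the second variable and only relevant on that subset.
\<close>

record 'h hspace =
  hcarrier :: "'h set"
  hinner :: "'h \<Rightarrow> 'h \<Rightarrow> complex"

definition hnorm :: "'h hspace \<Rightarrow> 'h \<Rightarrow> real"
  where "hnorm H x = sqrt (Re (hinner H x x))"

definition hilbert_space :: "'h::complex_vector hspace \<Rightarrow> bool"
  where "hilbert_space H \<longleftrightarrow>
    0 \<in> hcarrier H \<and>
    (\<forall>x\<in>hcarrier H. \<forall>y\<in>hcarrier H. x + y \<in> hcarrier H) \<and>
    (\<forall>c. \<forall>x\<in>hcarrier H. c *\<^sub>C x \<in> hcarrier H) \<and>
    (\<forall>x\<in>hcarrier H. \<forall>y\<in>hcarrier H. hinner H y x = cnj (hinner H x y)) \<and>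
    (\<forall>x\<in>hcarrier H. \<forall>y\<in>hcarrier H. \<forall>z\<in>hcarrier H.
      hinner H x (y + z) = hinner H x y + hinner H x z) \<and>
    (\<forall>c. \<forall>x\<in>hcarrier H. \<forall>y\<in>hcarrier H. hinner H x (c *\<^sub>C y) = c * hinner H x y) \<and>
    (\<forall>x\<in>hcarrier H. hinner H x x \<in> \<real>\<^sub>\<ge>\<^sub>0) \<and>
    (\<forall>x\<in>hcarrier H. hinner H x x = 0 \<longrightarrow> x = 0) \<and>
    (\<forall>X. range X \<subseteq> hcarrier H \<and>
      (\<forall>e>0. \<exists>M. \<forall>m\<ge>M. \<forall>n\<ge>M. hnorm H (X m - X n) < e) \<longrightarrow>
      (\<exists>x\<in>hcarrier H. (\<lambda>n. hnorm H (X n - x)) \<longlonglongrightarrow> 0))"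

text \<open>Operators are extensional functions, so that equality of operators is equality in HOL.\<close>

definition bounded_operators :: "'h::complex_vector hspace \<Rightarrow> ('h \<Rightarrow> 'h) set"
  where "bounded_operators H = {T \<in> hcarrier H \<rightarrow>\<^sub>E hcarrier H.
    (\<forall>x\<in>hcarrier H. \<forall>y\<in>hcarrier H. T (x + y) = T x + T y) \<and>
    (\<forall>c. \<forall>x\<in>hcarrier H. T (c *\<^sub>C x) = c *\<^sub>C T x) \<and>
    (\<exists>C. \<forall>x\<in>hcarrier H. hnorm H (T x) \<le> C * hnorm H x)}"

definition commutant :: "'h::complex_vector hspace \<Rightarrow> ('h \<Rightarrow> 'h) set \<Rightarrow> ('h \<Rightarrow> 'h) set"
  where "commutant H S =
    {T \<in> bounded_operators H. \<forall>A\<in>S. \<forall>x\<in>hcarrier H. T (A x) = A (T x)}"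

definition projections :: "'h::complex_vector hspace \<Rightarrow> ('h \<Rightarrow> 'h) set"
  where "projections H = {p \<in> bounded_operators H.
    (\<forall>x\<in>hcarrier H. p (p x) = p x) \<and>
    (\<forall>x\<in>hcarrier H. \<forall>y\<in>hcarrier H. hinner H (p x) y = hinner H x (p y))}"

definition zero_operator :: "'h::complex_vector hspace \<Rightarrow> 'h \<Rightarrow> 'h"
  where "zero_operator H = (\<lambda>x\<in>hcarrier H. 0)"

text \<open>For projections, \<open>q \<le> p\<close> is expressed by \<open>p q = q\<close>.\<close>

definition minimal_projection ::
    "'h::complex_vector hspace \<Rightarrow> ('h \<Rightarrow> 'h) set \<Rightarrow> ('h \<Rightarrow> 'h) \<Rightarrow> bool"
  where "minimal_projection H M p \<longleftrightarrow>
    p \<in> M \<inter> projections H \<and> p \<noteq> zero_operator H \<and>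
    (\<forall>q \<in> M \<inter> projections H.
      (\<forall>x\<in>hcarrier H. p (q x) = q x) \<longrightarrow> q = zero_operator H \<or> q = p)"

definition diffuse :: "'h::complex_vector hspace \<Rightarrow> ('h \<Rightarrow> 'h) set \<Rightarrow> bool"
  where "diffuse H M \<longleftrightarrow> \<not> (\<exists>p. minimal_projection H M p)"

definition representation ::
    "'h::complex_vector hspace \<Rightarrow> ('a::cstar_algebra \<Rightarrow> 'h \<Rightarrow> 'h) \<Rightarrow> bool"
  where "representation H \<pi> \<longleftrightarrow>
    hilbert_space H \<and>
    (\<forall>a. \<pi> a \<in> bounded_operators H) \<and>
    (\<forall>x\<in>hcarrier H.
      (\<forall>a b. \<pi> (a + b) x = \<pi> a x + \<pi> b x) \<and>
      (\<forall>c a. \<pi> (c *\<^sub>C a) x = c *\<^sub>C \<pi> a x) \<and>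
      (\<forall>a b. \<pi> (a * b) x = \<pi> a (\<pi> b x)) \<and>
      \<pi> 1 x = x \<and>
      (\<forall>a. \<forall>y\<in>hcarrier H. hinner H (\<pi> a x) y = hinner H x (\<pi> (a\<^sup>\<star>) y)))"

definition faithful_representation ::
    "'h::complex_vector hspace \<Rightarrow> ('a::cstar_algebra \<Rightarrow> 'h \<Rightarrow> 'h) \<Rightarrow> bool"
  where "faithful_representation H \<pi> \<longleftrightarrow> representation H \<pi> \<and> inj \<pi>"


section \<open>The GNS representation\<close>

text \<open>
  The Hilbert space \<open>L\<^sup>2(A, \<tau>)\<close> is the completion of \<open>A\<close> (modulo null vectors) for the inner
  product \<open>\<langle>a, b\<rangle> = \<tau> (a\<^sup>\<star> b)\<close>. It is realised inside \<open>A \<Rightarrow> complex\<close>: a vector \<open>\<eta>\<close> of the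
  completion is identified with the function \<open>a \<mapsto> \<langle>a, \<eta>\<rangle>\<close>, which determines it because \<open>A\<close> is
  dense. Thus the limit of a Cauchy sequence \<open>x\<close> is the function \<open>a \<mapsto> lim \<tau> (a\<^sup>\<star> x\<^sub>n)\<close>, and as
  \<open>\<langle>b, a \<eta>\<rangle> = \<langle>a\<^sup>\<star> b, \<eta>\<rangle>\<close>, left multiplication by \<open>a\<close> sends \<open>\<eta>\<close> to \<open>b \<mapsto> \<eta> (a\<^sup>\<star> b)\<close>.
\<close>

definition gns_seminorm :: "('a::cstar_algebra \<Rightarrow> complex) \<Rightarrow> 'a \<Rightarrow> real"
  where "gns_seminorm \<tau> a = sqrt (Re (\<tau> (a\<^sup>\<star> * a)))"

definition gns_limit ::
    "('a::cstar_algebra \<Rightarrow> complex) \<Rightarrow> (nat \<Rightarrow> 'a) \<Rightarrow> ('a \<Rightarrow> complex) \<Rightarrow> bool"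
  where "gns_limit \<tau> x \<eta> \<longleftrightarrow>
    (\<forall>e>0. \<exists>M. \<forall>m\<ge>M. \<forall>n\<ge>M. gns_seminorm \<tau> (x m - x n) < e) \<and>
    (\<forall>a. (\<lambda>n. \<tau> (a\<^sup>\<star> * x n)) \<longlonglongrightarrow> \<eta> a)"

definition gns_space :: "('a::cstar_algebra \<Rightarrow> complex) \<Rightarrow> ('a \<Rightarrow> complex) hspace"
  where "gns_space \<tau> =
    \<lparr>hcarrier = {\<eta>. \<exists>x. gns_limit \<tau> x \<eta>},
     hinner = (\<lambda>\<eta> \<zeta>. THE c. \<exists>x y. gns_limit \<tau> x \<eta> \<and> gns_limit \<tau> y \<zeta> \<and>
       (\<lambda>n. \<tau> ((x n)\<^sup>\<star> * y n)) \<longlonglongrightarrow> c)\<rparr>"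

definition gns_rep ::
    "('a::cstar_algebra \<Rightarrow> complex) \<Rightarrow> 'a \<Rightarrow> ('a \<Rightarrow> complex) \<Rightarrow> ('a \<Rightarrow> complex)"
  where "gns_rep \<tau> a = (\<lambda>\<eta>\<in>hcarrier (gns_space \<tau>). \<lambda>b. \<eta> (a\<^sup>\<star> * b))"

definition gns_von_neumann ::
    "('a::cstar_algebra \<Rightarrow> complex) \<Rightarrow> (('a \<Rightarrow> complex) \<Rightarrow> ('a \<Rightarrow> complex)) set"
  where "gns_von_neumann \<tau> =
    commutant (gns_space \<tau>) (commutant (gns_space \<tau>) (range (gns_rep \<tau>)))"


section \<open>The minimal tensor product\<close>

text \<open>
  A list of pairs \<open>(x\<^sub>k, y\<^sub>k)\<close> stands for the element \<open>\<Sum>\<^sub>k x\<^sub>k \<otimes> y\<^sub>k\<close> of an algebraic tensor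
  product. \<open>tensor_hnorm\<close> is the Hilbert space norm on the algebraic tensor product of \<open>H\<close> and
  \<open>K\<close>, and \<open>tensor_opnorm\<close> is the norm of \<open>\<Sum> \<pi> a \<otimes> \<sigma> b\<close> as an operator on \<open>H \<otimes> K\<close>, computed
  on the unit ball of this dense subspace.
\<close>

definition tensor_hnorm :: "'h hspace \<Rightarrow> 'k hspace \<Rightarrow> ('h \<times> 'k) list \<Rightarrow> real"
  where "tensor_hnorm H K zs =
    sqrt (Re (\<Sum>(x, y)\<leftarrow>zs. \<Sum>(x', y')\<leftarrow>zs. hinner H x x' * hinner K y y'))"

definition tensor_apply ::
    "('a \<Rightarrow> 'h \<Rightarrow> 'h) \<Rightarrow> ('b \<Rightarrow> 'k \<Rightarrow> 'k) \<Rightarrow> ('a \<times> 'b) list \<Rightarrow> ('h \<times> 'k) list \<Rightarrow> ('h \<times> 'k) list"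
  where "tensor_apply \<pi> \<sigma> us zs = [(\<pi> a x, \<sigma> b y). (a, b) \<leftarrow> us, (x, y) \<leftarrow> zs]"

definition tensor_opnorm ::
    "'h hspace \<Rightarrow> ('a \<Rightarrow> 'h \<Rightarrow> 'h) \<Rightarrow> 'k hspace \<Rightarrow> ('b \<Rightarrow> 'k \<Rightarrow> 'k) \<Rightarrow> ('a \<times> 'b) list \<Rightarrow> real"
  where "tensor_opnorm H \<pi> K \<sigma> us =
    Sup {tensor_hnorm H K (tensor_apply \<pi> \<sigma> us zs) | zs.
      set zs \<subseteq> hcarrier H \<times> hcarrier K \<and> tensor_hnorm H K zs \<le> 1}"

text \<open>
  The C*-algebra \<open>'c\<close> with the bilinear map \<open>t\<close>, written \<open>a \<otimes> b = t a b\<close>, is the completion of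
  the algebraic tensor product of the *-algebras \<open>'a\<close> and \<open>'b\<close> in the spatial norm given by the
  faithful representations \<open>\<pi>\<close> and \<open>\<sigma>\<close>. Up to isomorphism it does not depend on \<open>\<pi>\<close> and \<open>\<sigma>\<close>.
\<close>

definition min_tensor_product ::
    "'h::complex_vector hspace \<Rightarrow> ('a::cstar_algebra \<Rightarrow> 'h \<Rightarrow> 'h) \<Rightarrow>
     'k::complex_vector hspace \<Rightarrow> ('b::cstar_algebra \<Rightarrow> 'k \<Rightarrow> 'k) \<Rightarrow>
     ('a \<Rightarrow> 'b \<Rightarrow> 'c::cstar_algebra) \<Rightarrow> bool"
  where "min_tensor_product H \<pi> K \<sigma> t \<longleftrightarrow>
    faithful_representation H \<pi> \<and> faithful_representation K \<sigma> \<and>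
    (\<forall>a. clinear (t a)) \<and> (\<forall>b. clinear (\<lambda>a. t a b)) \<and>
    (\<forall>a b a' b'. t a b * t a' b' = t (a * a') (b * b')) \<and>
    (\<forall>a b. (t a b)\<^sup>\<star> = t (a\<^sup>\<star>) (b\<^sup>\<star>)) \<and>
    t 1 1 = 1 \<and>
    (\<forall>us. norm (\<Sum>(a, b)\<leftarrow>us. t a b) = tensor_opnorm H \<pi> K \<sigma> us) \<and>
    closure (range (\<lambda>us. \<Sum>(a, b)\<leftarrow>us. t a b)) = UNIV"


section \<open>Noncommutative *-polynomials and tracial laws\<close>

datatype 'i letter = Var 'i | Adj 'i

datatype 'i word = Word (letters: "'i letter list")

instantiation word :: (type) monoid_add
begin

definition zero_word :: "'a word"
  where "0 = Word []"

definition plus_word :: "'a word \<Rightarrow> 'a word \<Rightarrow> 'a word"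
  where "v + w = Word (letters v @ letters w)"

instance
  by standard (simp_all add: zero_word_def plus_word_def)

end

text \<open>
  The algebra of *-polynomials in \<open>T\<^sub>i\<close>, for \<open>i\<close> in the type \<open>'i\<close>, is the monoid algebra of the
  free monoid of words; its product is the convolution product of \<^type>\<open>poly_mapping\<close>.
\<close>

type_synonym 'i ncpoly = "'i word \<Rightarrow>\<^sub>0 complex"

definition ncvar :: "'i \<Rightarrow> 'i ncpoly"
  where "ncvar i = Poly_Mapping.single (Word [Var i]) 1"

fun letter_star :: "'i letter \<Rightarrow> 'i letter"
  where
    "letter_star (Var i) = Adj i"
  | "letter_star (Adj i) = Var i"

definition word_star :: "'i word \<Rightarrow> 'i word"
  where "word_star w = Word (rev (map letter_star (letters w)))"

definition ncstar :: "'i ncpoly \<Rightarrow> 'i ncpoly"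
  where "ncstar P =
    (\<Sum>w\<in>Poly_Mapping.keys P. Poly_Mapping.single (word_star w) (cnj (Poly_Mapping.lookup P w)))"

text \<open>
  The set \<open>\<Sigma>\<^bsub>R,I\<^esub>\<close>. Its weak-* topology is the subspace topology of the product topology, which
  is the topology of the type \<open>'i ncpoly \<Rightarrow> complex\<close>.
\<close>

definition tracial_laws :: "real \<Rightarrow> ('i ncpoly \<Rightarrow> complex) set"
  where "tracial_laws R = {l. clinear l \<and>
    (\<forall>P. l (ncstar P * P) \<in> \<real>\<^sub>\<ge>\<^sub>0) \<and> l 1 = 1 \<and> (\<forall>P Q. l (P * Q) = l (Q * P)) \<and>
    (\<forall>k j. Re (l ((ncstar (ncvar j) * ncvar j) ^ k)) \<le> R ^ (2 * k))}"

fun eval_letter :: "('i \<Rightarrow> 'a::cstar_algebra) \<Rightarrow> 'i letter \<Rightarrow> 'a"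
  where
    "eval_letter a (Var i) = a i"
  | "eval_letter a (Adj i) = (a i)\<^sup>\<star>"

definition nceval :: "('i \<Rightarrow> 'a::cstar_algebra) \<Rightarrow> 'i ncpoly \<Rightarrow> 'a"
  where "nceval a P =
    (\<Sum>w\<in>Poly_Mapping.keys P.
      Poly_Mapping.lookup P w *\<^sub>C prod_list (map (eval_letter a) (letters w)))"

definition generates :: "('i \<Rightarrow> 'a::cstar_algebra) \<Rightarrow> bool"
  where "generates a \<longleftrightarrow> closure (range (nceval a)) = UNIV"

definition trace_laws :: "('i \<Rightarrow> 'a::cstar_algebra) \<Rightarrow> ('i ncpoly \<Rightarrow> complex) set"
  where "trace_laws a = {\<lambda>P. \<tau> (nceval a P) | \<tau>. \<tau> \<in> traces}"


section \<open>Matrix microstates and 1-bounded entropy\<close>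

definition mat_trace :: "complex mat \<Rightarrow> complex"
  where "mat_trace A = (\<Sum>r<dim_row A. A $$ (r, r))"

definition cvec_norm :: "complex Matrix.vec \<Rightarrow> real"
  where "cvec_norm v = sqrt (Re (v \<bullet>c v))"

definition mat_opnorm :: "complex mat \<Rightarrow> real"
  where "mat_opnorm A =
    Sup {cvec_norm (A *\<^sub>v v) | v. v \<in> carrier_vec (dim_col A) \<and> cvec_norm v \<le> 1}"

definition mat_norm2 :: "complex mat \<Rightarrow> real"
  where "mat_norm2 A = sqrt (Re (mat_trace (mat_adjoint A * A)) / dim_row A)"

definition unitary_mats :: "nat \<Rightarrow> complex mat set"
  where "unitary_mats N =
    {U \<in> carrier_mat N N. mat_adjoint U * U = 1\<^sub>m N \<and> U * mat_adjoint U = 1\<^sub>m N}"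

fun mat_eval_letter :: "('i \<Rightarrow> complex mat) \<Rightarrow> 'i letter \<Rightarrow> complex mat"
  where
    "mat_eval_letter A (Var i) = A i"
  | "mat_eval_letter A (Adj i) = mat_adjoint (A i)"

definition mat_eval_word :: "nat \<Rightarrow> ('i \<Rightarrow> complex mat) \<Rightarrow> 'i word \<Rightarrow> complex mat"
  where "mat_eval_word N A w = foldr (\<lambda>l M. mat_eval_letter A l * M) (letters w) (1\<^sub>m N)"

definition mat_nceval :: "nat \<Rightarrow> ('i \<Rightarrow> complex mat) \<Rightarrow> 'i ncpoly \<Rightarrow> complex mat"
  where "mat_nceval N A P =
    Matrix.mat N N (\<lambda>rs. \<Sum>w\<in>Poly_Mapping.keys P.
      Poly_Mapping.lookup P w * mat_eval_word N A w $$ rs)"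

definition mat_law :: "nat \<Rightarrow> ('i \<Rightarrow> complex mat) \<Rightarrow> 'i ncpoly \<Rightarrow> complex"
  where "mat_law N A P = mat_trace (mat_nceval N A P) / of_nat N"

definition microstates ::
    "real \<Rightarrow> nat \<Rightarrow> ('i ncpoly \<Rightarrow> complex) set \<Rightarrow> ('i \<Rightarrow> complex mat) set"
  where "microstates R N \<O> =
    {A. (\<forall>i. A i \<in> carrier_mat N N \<and> mat_opnorm (A i) \<le> R) \<and> mat_law N A \<in> \<O>}"

definition orbital_net ::
    "nat \<Rightarrow> 'i set \<Rightarrow> real \<Rightarrow> ('i \<Rightarrow> complex mat) set \<Rightarrow> ('i \<Rightarrow> complex mat) set \<Rightarrow> bool"
  where "orbital_net N F \<epsilon> \<Omega> \<Omega>\<^sub>0 \<longleftrightarrow> \<Omega>\<^sub>0 \<subseteq> \<Omega> \<and>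
    (\<forall>C\<in>\<Omega>. \<exists>B\<in>\<Omega>\<^sub>0. \<exists>U\<in>unitary_mats N.
      \<forall>i\<in>F. mat_norm2 (C i - U * B i * mat_adjoint U) < \<epsilon>)"

definition orbital_covering_number ::
    "nat \<Rightarrow> 'i set \<Rightarrow> real \<Rightarrow> ('i \<Rightarrow> complex mat) set \<Rightarrow> enat"
  where "orbital_covering_number N F \<epsilon> \<Omega> =
    (INF \<Omega>\<^sub>0\<in>{\<Omega>\<^sub>0. orbital_net N F \<epsilon> \<Omega> \<Omega>\<^sub>0}. if finite \<Omega>\<^sub>0 then enat (card \<Omega>\<^sub>0) else \<infinity>)"

definition log_count :: "enat \<Rightarrow> ereal"
  where "log_count n =
    (case n of enat m \<Rightarrow> if m = 0 then -\<infinity> else ereal (ln (real m)) | \<infinity> \<Rightarrow> \<infinity>)"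

definition law_entropy :: "real \<Rightarrow> ('i ncpoly \<Rightarrow> complex) set \<Rightarrow> ereal"
  where "law_entropy R K =
    (SUP (F, \<epsilon>)\<in>{(F, \<epsilon>). finite F \<and> \<epsilon> > 0}.
      INF \<O>\<in>{\<O>. openin (top_of_set (tracial_laws R)) \<O> \<and> K \<subseteq> \<O>}.
        limsup (\<lambda>N. ereal (1 / (real N)\<^sup>2) *
          log_count (orbital_covering_number N F \<epsilon> (microstates R N \<O>))))"

text \<open>
  \<open>cstar_entropy R a\<close> is the 1-bounded entropy of the C*-algebra generated by the tuple \<open>a\<close>,
  whose members have norm at most \<open>R\<close>. As the value does not depend on \<open>R\<close> and \<open>a\<close>, statements
  about the entropy of an algebra are to be made for all generating tuples.
\<close>

definition cstar_entropy :: "real \<Rightarrow> ('i \<Rightarrow> 'a::cstar_algebra) \<Rightarrow> ereal"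
  where "cstar_entropy R a = law_entropy R (trace_laws a)"

end

theory Submission
  imports Defs "Jordan_Normal_Form.Spectral_Radius"
begin


typedef fmat = "{A :: nat \<Rightarrow> nat \<Rightarrow> complex. \<exists>n. \<forall>i j. n \<le> i \<or> n \<le> j \<longrightarrow> A i j = 0}"
  morphisms entry Fmat
  by (rule exI [of _ "\<lambda>i j. 0"]) simp

setup_lifting type_definition_fmat

definition corner :: "nat \<Rightarrow> fmat \<Rightarrow> bool"
  where "corner n A \<longleftrightarrow> (\<forall>i j. n \<le> i \<or> n \<le> j \<longrightarrow> entry A i j = 0)"

lemma fmat_eqI: "(\<And>i j. entry A i j = entry B i j) \<Longrightarrow> A = B"
  by (metis entry_inject ext)

lemma cornerD: "corner n A \<Longrightarrow> n \<le> i \<or> n \<le> j \<Longrightarrow> entry A i j = 0"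
  unfolding corner_def by blast

lemma corner_mono: "corner n A \<Longrightarrow> n \<le> m \<Longrightarrow> corner m A"
  by (auto simp: corner_def)

lemma ex_corner: "\<exists>n. corner n A"
  using entry [of A] by (auto simp: corner_def)

lemma obtain_corner2:
  obtains n where "corner n A" "corner n B"
  by (meson corner_mono ex_corner max.cobounded1 max.cobounded2)

lemma obtain_corner3:
  obtains n where "corner n A" "corner n B" "corner n C"
  by (meson corner_mono ex_corner max.cobounded1 max.cobounded2 order_trans)

lemma fmat_eq_cornerI:
  assumes "corner n A" "corner n B" "\<And>i j. i < n \<Longrightarrow> j < n \<Longrightarrow> entry A i j = entry B i j"
  shows "A = B"
  by (rule fmat_eqI) (use assms in \<open>metis cornerD not_le\<close>)

instantiation fmat :: "{ring, complex_vector, real_vector}"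
begin

lift_definition zero_fmat :: fmat is "\<lambda>i j. 0" by simp

lift_definition plus_fmat :: "fmat \<Rightarrow> fmat \<Rightarrow> fmat" is "\<lambda>A B i j. A i j + B i j"
  by (metis add.right_neutral nle_le order_trans)

lift_definition uminus_fmat :: "fmat \<Rightarrow> fmat" is "\<lambda>A i j. - A i j" by auto

definition minus_fmat :: "fmat \<Rightarrow> fmat \<Rightarrow> fmat" where "minus_fmat A B = A + - B"

lift_definition times_fmat :: "fmat \<Rightarrow> fmat \<Rightarrow> fmat"
  is "\<lambda>A B i j. \<Sum>k | A i k \<noteq> 0. A i k * B k j"
proof -
  fix A B :: "nat \<Rightarrow> nat \<Rightarrow> complex"
  assume "\<exists>n. \<forall>i j. n \<le> i \<or> n \<le> j \<longrightarrow> A i j = 0" "\<exists>n. \<forall>i j. n \<le> i \<or> n \<le> j \<longrightarrow> B i j = 0"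
  then obtain n m where "\<forall>i j. n \<le> i \<or> n \<le> j \<longrightarrow> A i j = 0" "\<forall>i j. m \<le> i \<or> m \<le> j \<longrightarrow> B i j = 0"
    by blast
  then show "\<exists>n. \<forall>i j. n \<le> i \<or> n \<le> j \<longrightarrow> (\<Sum>k | A i k \<noteq> 0. A i k * B k j) = 0"
    by (intro exI [of _ "max n m"]) (auto intro!: sum.neutral)
qed

lift_definition scaleC_fmat :: "complex \<Rightarrow> fmat \<Rightarrow> fmat" is "\<lambda>c A i j. c * A i j" by auto

definition scaleR_fmat :: "real \<Rightarrow> fmat \<Rightarrow> fmat" where "scaleR_fmat r A = complex_of_real r *\<^sub>C A"

lemma entry_times: "entry (A * B) i j = (\<Sum>k<n. entry A i k * entry B k j)" if "corner n A" for A B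
proof -
  have "{k. entry A i k \<noteq> 0} \<subseteq> {..<n}"
    using cornerD [OF that] by (auto simp: not_le [symmetric])
  then show ?thesis
    unfolding times_fmat.rep_eq by (intro sum.mono_neutral_left) auto
qed

lemma entry_times': "entry (A * B) i j = (\<Sum>k<n. entry A i k * entry B k j)" if "corner n B" for A B
proof -
  obtain m where "corner m A" using ex_corner by blast
  then have "corner (max n m) A" by (rule corner_mono) simp
  then have "entry (A * B) i j = (\<Sum>k<max n m. entry A i k * entry B k j)" by (rule entry_times)
  also have "\<dots> = (\<Sum>k<n. entry A i k * entry B k j)"
    by (intro sum.mono_neutral_right) (auto simp: cornerD [OF that])
  finally show ?thesis .
qed

lemma entry_minus_aux: "entry (A - B) i j = entry A i j - entry B i j" for A B
  by (simp add: minus_fmat_def plus_fmat.rep_eq uminus_fmat.rep_eq)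

instance
proof
  fix A B C :: fmat and c d :: complex and r s :: real
  show "A + B + C = A + (B + C)" "A + B = B + A" "0 + A = A" "- A + A = 0" "A - B = A + - B"
    "c *\<^sub>C (A + B) = c *\<^sub>C A + c *\<^sub>C B" "(c + d) *\<^sub>C A = c *\<^sub>C A + d *\<^sub>C A"
    "c *\<^sub>C d *\<^sub>C A = (c * d) *\<^sub>C A" "1 *\<^sub>C A = A"
    "r *\<^sub>R (A + B) = r *\<^sub>R A + r *\<^sub>R B" "(r + s) *\<^sub>R A = r *\<^sub>R A + s *\<^sub>R A"
    "r *\<^sub>R s *\<^sub>R A = (r * s) *\<^sub>R A" "1 *\<^sub>R A = A"
    by (auto intro!: fmat_eqI simp: plus_fmat.rep_eq zero_fmat.rep_eq uminus_fmat.rep_eq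
        minus_fmat_def scaleC_fmat.rep_eq scaleR_fmat_def algebra_simps)
  obtain n where n: "corner n A" "corner n B" "corner n C" by (rule obtain_corner3)
  show "A * B * C = A * (B * C)"
  proof (rule fmat_eqI)
    fix i j
    have "entry (A * B * C) i j = (\<Sum>l<n. (\<Sum>k<n. entry A i k * entry B k l) * entry C l j)"
      using n by (simp add: entry_times' [of n C] entry_times [of n A])
    also have "\<dots> = (\<Sum>k<n. entry A i k * (\<Sum>l<n. entry B k l * entry C l j))"
      by (simp add: sum_distrib_left sum_distrib_right mult.assoc) (rule sum.swap)
    also have "\<dots> = entry (A * (B * C)) i j"
      using n by (simp add: entry_times' [of n C] entry_times [of n A])
    finally show "entry (A * B * C) i j = entry (A * (B * C)) i j" .
  qed
  show "(A + B) * C = A * C + B * C"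
    using n by (auto intro!: fmat_eqI simp: entry_times' [of n C] plus_fmat.rep_eq algebra_simps sum.distrib)
  show "A * (B + C) = A * B + A * C"
    using n by (auto intro!: fmat_eqI simp: entry_times [of n A] plus_fmat.rep_eq algebra_simps sum.distrib)
qed

end

lemmas fmat_entry = plus_fmat.rep_eq zero_fmat.rep_eq uminus_fmat.rep_eq scaleC_fmat.rep_eq entry_minus_aux

lemma entry_scaleR: "entry (r *\<^sub>R A) i j = complex_of_real r * entry A i j"
  by (simp add: scaleR_fmat_def scaleC_fmat.rep_eq)

lemma fmat_scaleC_left: "(c *\<^sub>C A) * B = c *\<^sub>C (A * B)" for A B :: fmat
proof -
  obtain n where "corner n B" using ex_corner by blast
  then show ?thesis
    by (auto intro!: fmat_eqI simp: entry_times' [of n] fmat_entry sum_distrib_left mult.assoc)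
qed

lemma fmat_scaleC_right: "A * (c *\<^sub>C B) = c *\<^sub>C (A * B)" for A B :: fmat
proof -
  obtain n where "corner n A" using ex_corner by blast
  then show ?thesis
    by (auto intro!: fmat_eqI simp: entry_times [of n] fmat_entry sum_distrib_left algebra_simps)
qed

lift_definition adj :: "fmat \<Rightarrow> fmat" is "\<lambda>A i j. cnj (A j i)" by auto

lemmas entry_adj = adj.rep_eq

lemma corner_0 [simp]: "corner n 0" by (simp add: corner_def fmat_entry)
lemma corner_add [simp]: "corner n A \<Longrightarrow> corner n B \<Longrightarrow> corner n (A + B)" by (simp add: corner_def fmat_entry)
lemma corner_diff [simp]: "corner n A \<Longrightarrow> corner n B \<Longrightarrow> corner n (A - B)" by (simp add: corner_def fmat_entry)
lemma corner_scaleC [simp]: "corner n A \<Longrightarrow> corner n (c *\<^sub>C A)" by (simp add: corner_def fmat_entry)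
lemma corner_scaleR [simp]: "corner n A \<Longrightarrow> corner n (c *\<^sub>R A)" by (simp add: corner_def entry_scaleR)
lemma corner_adj [simp]: "corner n (adj A) \<longleftrightarrow> corner n A" by (auto simp: corner_def entry_adj)
lemma corner_times [simp]: "corner n A \<Longrightarrow> corner n B \<Longrightarrow> corner n (A * B)"
  using entry_times [of n A B] by (simp add: corner_def)

lemma adj_adj [simp]: "adj (adj A) = A" by (rule fmat_eqI) (simp add: entry_adj)
lemma adj_0 [simp]: "adj 0 = 0" by (rule fmat_eqI) (simp add: entry_adj fmat_entry)
lemma adj_add: "adj (A + B) = adj A + adj B" by (rule fmat_eqI) (simp add: entry_adj fmat_entry)
lemma adj_diff: "adj (A - B) = adj A - adj B" by (rule fmat_eqI) (simp add: entry_adj fmat_entry)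
lemma adj_scaleC: "adj (c *\<^sub>C A) = cnj c *\<^sub>C adj A" by (rule fmat_eqI) (simp add: entry_adj fmat_entry)
lemma adj_scaleR: "adj (c *\<^sub>R A) = c *\<^sub>R adj A" by (rule fmat_eqI) (simp add: entry_adj entry_scaleR)
lemma adj_mult: "adj (A * B) = adj B * adj A"
proof -
  obtain n where "corner n A" using ex_corner by blast
  then show ?thesis
    by (auto intro!: fmat_eqI simp: entry_times [of n] entry_times' [of n] entry_adj mult.commute)
qed

definition tr :: "fmat \<Rightarrow> complex"
  where "tr A = (\<Sum>i | entry A i i \<noteq> 0. entry A i i)"

lemma tr_corner: "corner n A \<Longrightarrow> tr A = (\<Sum>i<n. entry A i i)"
  unfolding tr_def by (intro sum.mono_neutral_left) (auto simp: corner_def intro: leI)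

lemma tr_add: "tr (A + B) = tr A + tr B"
proof -
  obtain n where "corner n A" "corner n B" by (rule obtain_corner2)
  then show ?thesis by (simp add: tr_corner [of n] fmat_entry sum.distrib)
qed

lemma tr_scaleC: "tr (c *\<^sub>C A) = c * tr A"
proof -
  obtain n where "corner n A" using ex_corner by blast
  then show ?thesis by (simp add: tr_corner [of n] fmat_entry sum_distrib_left)
qed

lemma tr_adj: "tr (adj A) = cnj (tr A)"
proof -
  obtain n where "corner n A" using ex_corner by blast
  then show ?thesis by (simp add: tr_corner [of n] entry_adj)
qed

lemma tr_mult: "tr (A * B) = (\<Sum>i<n. \<Sum>j<n. entry A i j * entry B j i)" if "corner n A" "corner n B"
  using that by (simp add: tr_corner [of n] entry_times [of n])

lemma tr_commute: "tr (A * B) = tr (B * A)"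
proof -
  obtain n where "corner n A" "corner n B" by (rule obtain_corner2)
  then show ?thesis
    by (simp add: tr_mult [of n] mult.commute) (rule sum.swap)
qed

text \<open>HS inner product\<close>

instantiation fmat :: real_inner
begin

definition inner_fmat :: "fmat \<Rightarrow> fmat \<Rightarrow> real" where "inner_fmat A B = Re (tr (adj A * B))"
definition norm_fmat :: "fmat \<Rightarrow> real" where "norm_fmat A = sqrt (inner A A)"
definition dist_fmat :: "fmat \<Rightarrow> fmat \<Rightarrow> real" where "dist_fmat A B = norm (A - B)"
definition sgn_fmat :: "fmat \<Rightarrow> fmat" where "sgn_fmat A = A /\<^sub>R norm A"
definition uniformity_fmat :: "(fmat \<times> fmat) filter"
  where "uniformity_fmat = (INF e\<in>{0<..}. principal {(x, y). dist x y < e})"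
definition open_fmat :: "fmat set \<Rightarrow> bool"
  where "open_fmat U = (\<forall>x\<in>U. eventually (\<lambda>(x', y). x' = x \<longrightarrow> y \<in> U) uniformity)"

lemma inner_self_sum: "inner A A = (\<Sum>i<n. \<Sum>j<n. (cmod (entry A i j))\<^sup>2)" if "corner n A" for A
proof -
  have "tr (adj A * A) = (\<Sum>i<n. \<Sum>j<n. cnj (entry A j i) * entry A j i)"
    using that by (simp add: tr_mult [of n] entry_adj)
  also have "\<dots> = (\<Sum>j<n. \<Sum>i<n. complex_of_real ((cmod (entry A j i))\<^sup>2))"
    unfolding complex_norm_square by (subst sum.swap) (simp add: mult.commute)
  finally show ?thesis by (simp add: inner_fmat_def flip: of_real_sum)
qed

instance
proof
  fix A B C :: fmat and r :: real
  show "dist A B = norm (A - B)" by (fact dist_fmat_def)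
  show "sgn A = A /\<^sub>R norm A" by (fact sgn_fmat_def)
  show "uniformity = (INF e\<in>{0<..}. principal {(x, y :: fmat). dist x y < e})" by (fact uniformity_fmat_def)
  show "open U = (\<forall>x\<in>U. eventually (\<lambda>(x', y). x' = x \<longrightarrow> y \<in> U) uniformity)" for U :: "fmat set"
    by (fact open_fmat_def)
  show "norm A = sqrt (inner A A)" by (fact norm_fmat_def)
  show "inner A B = inner B A"
    using tr_adj [of "adj A * B"] by (simp add: inner_fmat_def adj_mult)
  show "inner (A + B) C = inner A C + inner B C"
    by (simp add: inner_fmat_def adj_add distrib_right tr_add)
  show "inner (r *\<^sub>R A) B = r * inner A B"
    by (simp add: inner_fmat_def scaleR_fmat_def adj_scaleC fmat_scaleC_left tr_scaleC)
  obtain n where n: "corner n A" using ex_corner by blast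
  show "0 \<le> inner A A" unfolding inner_self_sum [OF n] by (intro sum_nonneg) auto
  show "(inner A A = 0) = (A = 0)"
  proof
    assume "inner A A = 0"
    then have "\<forall>i<n. \<forall>j<n. entry A i j = 0"
      unfolding inner_self_sum [OF n] by (subst (asm) sum_nonneg_eq_0_iff; auto intro!: sum_nonneg simp: sum_nonneg_eq_0_iff)
    then show "A = 0" by (intro fmat_eq_cornerI [OF n]) (auto simp: fmat_entry)
  next
    assume "A = 0"
    then show "inner A A = 0" by (simp add: inner_fmat_def tr_def fmat_entry times_fmat.rep_eq)
  qed
qed

end

lemma norm_sq_sum: "corner n A \<Longrightarrow> (norm A)\<^sup>2 = (\<Sum>i<n. \<Sum>j<n. (cmod (entry A i j))\<^sup>2)"
  using inner_self_sum [of n A] by (simp add: power2_norm_eq_inner)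

lemma norm_sq_tr: "(norm A)\<^sup>2 = Re (tr (adj A * A))" for A :: fmat
  by (simp add: power2_norm_eq_inner inner_fmat_def)

lemma norm_adj: "norm (adj A) = norm A"
proof -
  have "(norm (adj A))\<^sup>2 = (norm A)\<^sup>2" by (simp add: norm_sq_tr tr_commute)
  then show ?thesis by simp
qed

lemma Re_tr_le: "Re (tr (A * B)) \<le> norm A * norm B"
  using norm_cauchy_schwarz [of "adj A" B] by (simp add: inner_fmat_def norm_adj)

text \<open>Holder-free control of products.\<close>
lemma norm_mult_sq: "(norm (A * B))\<^sup>2 \<le> norm A * sqrt (norm (adj A * A) * norm (B * adj B * (B * adj B)))"
  for A B :: fmat
proof -
  have "(norm (A * B))\<^sup>2 = Re (tr (adj A * (A * (B * adj B))))"
    using tr_commute [of "adj B" "adj A * A * B"] by (simp add: norm_sq_tr adj_mult mult.assoc)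
  also have "\<dots> \<le> norm A * norm (A * (B * adj B))"
    using Re_tr_le [of "adj A"] by (simp add: norm_adj)
  also have "(norm (A * (B * adj B)))\<^sup>2 = Re (tr ((adj A * A) * (B * adj B * (B * adj B))))"
    using tr_commute [of "B * adj B" "adj A * (A * (B * adj B))"] by (simp add: norm_sq_tr adj_mult mult.assoc)
  then have "norm (A * (B * adj B)) \<le> sqrt (norm (adj A * A) * norm (B * adj B * (B * adj B)))"
    using Re_tr_le [of "adj A * A"] by (simp add: real_le_rsqrt)
  finally show ?thesis by (simp add: mult_left_mono)
qed


lift_definition fm :: "nat \<Rightarrow> (nat \<Rightarrow> nat \<Rightarrow> complex) \<Rightarrow> fmat"
  is "\<lambda>n f i j. if i < n \<and> j < n then f i j else 0"
  by (rule_tac x = nat in exI) auto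

lemma entry_fm: "entry (fm n f) i j = (if i < n \<and> j < n then f i j else 0)"
  by (simp add: fm.rep_eq)

lemma corner_fm [simp]: "corner n (fm n f)"
  by (auto simp: corner_def entry_fm)

definition one_fm :: "nat \<Rightarrow> fmat" where "one_fm n = fm n (\<lambda>i j. if i = j then 1 else 0)"

definition diag_fm :: "nat \<Rightarrow> (nat \<Rightarrow> real) \<Rightarrow> fmat"
  where "diag_fm n l = fm n (\<lambda>i j. if i = j then complex_of_real (l i) else 0)"

lemma corner_one_fm [simp]: "corner n (one_fm n)" by (simp add: one_fm_def)
lemma corner_diag_fm [simp]: "corner n (diag_fm n l)" by (simp add: diag_fm_def)
lemma adj_one_fm [simp]: "adj (one_fm n) = one_fm n"
  by (rule fmat_eqI) (auto simp: one_fm_def entry_fm entry_adj)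
lemma adj_diag_fm [simp]: "adj (diag_fm n l) = diag_fm n l"
  by (rule fmat_eqI) (auto simp: diag_fm_def entry_fm entry_adj)

lemma one_fm_left: "corner n A \<Longrightarrow> one_fm n * A = A"
  by (rule fmat_eq_cornerI [of n])
    (auto simp: entry_times [of n] one_fm_def entry_fm if_distrib if_distribR cong: if_cong)

lemma one_fm_right: "corner n A \<Longrightarrow> A * one_fm n = A"
  using one_fm_left [of n "adj A"] adj_mult [of "one_fm n" "adj A"] by simp

definition unitary :: "nat \<Rightarrow> fmat \<Rightarrow> bool"
  where "unitary n U \<longleftrightarrow> corner n U \<and> adj U * U = one_fm n \<and> U * adj U = one_fm n"

lemma unitaryD:
  assumes "unitary n U"
  shows "corner n U" "adj U * U = one_fm n" "U * adj U = one_fm n"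
    "corner n A \<Longrightarrow> adj U * (U * A) = A" "corner n A \<Longrightarrow> U * (adj U * A) = A"
  using assms by (auto simp: unitary_def one_fm_left simp flip: mult.assoc)

lemma unitary_one: "unitary n (one_fm n)"
  by (simp add: unitary_def one_fm_left)

lemma unitary_mult: "unitary n U \<Longrightarrow> unitary n V \<Longrightarrow> unitary n (U * V)"
  using unitaryD(4) [of n U V] unitaryD(5) [of n V "adj U"]
  by (simp add: unitary_def adj_mult mult.assoc)

lemma unitary_adj: "unitary n U \<Longrightarrow> unitary n (adj U)"
  by (simp add: unitary_def)

text \<open>vectors = matrices with one column\<close>
definition colv :: "nat \<Rightarrow> (nat \<Rightarrow> complex) \<Rightarrow> fmat"
  where "colv n f = fm n (\<lambda>i j. if j = 0 then f i else 0)"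

lemma corner_colv [simp]: "corner n (colv n f)" by (simp add: colv_def)

lemma colv_adj_colv: "adj (colv n f) * colv n g = (\<Sum>i<n. cnj (f i) * g i) *\<^sub>C fm n (\<lambda>i j. if i = 0 \<and> j = 0 then 1 else 0)"
  by (rule fmat_eq_cornerI [of n])
    (auto simp: entry_times [of n] colv_def entry_adj entry_fm fmat_entry)

lemma colv_unit: "colv n f * fm n (\<lambda>i j. if i = 0 \<and> j = 0 then 1 else 0) = colv n f"
  by (rule fmat_eq_cornerI [of n])
    (auto simp: entry_times [of n] colv_def entry_fm if_distrib if_distribR cong: if_cong)

lemma times_colv: "corner n A \<Longrightarrow> A * colv n f = colv n (\<lambda>i. \<Sum>j<n. entry A i j * f j)"
  by (rule fmat_eq_cornerI [of n])
    (auto simp: entry_times [of n] colv_def entry_fm)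

lemma householder:
  fixes u :: "nat \<Rightarrow> complex"
  assumes k: "k < n" and u: "(\<Sum>i<n. (cmod (u i))\<^sup>2) = 1" and "u k \<in> \<real>" and low: "\<And>i. i < k \<Longrightarrow> u i = 0"
  obtains H where "unitary n H" "adj H = H" "\<And>i j. i < k \<Longrightarrow> j < n \<Longrightarrow> entry H i j = (if i = j then 1 else 0)"
    "H * colv n (\<lambda>i. if i = k then 1 else 0) = colv n u"
proof (cases "u k = 1")
  case True
  have "(\<Sum>i<n. (cmod (u i))\<^sup>2) = (\<Sum>i\<in>{..<n}-{k}. (cmod (u i))\<^sup>2) + 1"
    using k by (subst sum.remove [of _ k]) (auto simp: True)
  then have "(\<Sum>i\<in>{..<n}-{k}. (cmod (u i))\<^sup>2) = 0" using u by simp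
  then have "\<forall>i\<in>{..<n}-{k}. u i = 0"
    by (subst (asm) sum_nonneg_eq_0_iff) auto
  then have "colv n (\<lambda>i. if i = k then 1 else 0) = colv n u"
    by (intro fmat_eq_cornerI [of n]) (auto simp: colv_def entry_fm True)
  then show thesis
    using k by (intro that [of "one_fm n"] unitary_one) (auto simp: one_fm_left, auto simp: one_fm_def entry_fm)
next
  case False
  obtain t where t: "u k = complex_of_real t" using \<open>u k \<in> \<real>\<close> by (auto elim: Reals_cases)
  define w where "w i = u i - (if i = k then 1 else 0)" for i
  define W where "W = colv n w"
  define c where "c = complex_of_real (1 / (1 - t))"
  define E where "E = fm n (\<lambda>i j. if i = 0 \<and> j = 0 then 1 else 0)"
  define e where "e = colv n (\<lambda>i. if i = k then 1 else 0)"
  have t1: "t \<noteq> 1" using False t by auto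
  have "(\<Sum>i<n. cnj (w i) * w i) = (\<Sum>i<n. complex_of_real ((cmod (u i))\<^sup>2) - (if i = k then cnj (u i) + u i - 1 else 0))"
    by (rule sum.cong) (auto simp: w_def complex_norm_square algebra_simps simp del: of_real_power)
  also have "\<dots> = 1 - (2 * complex_of_real t - 1)"
    using k u by (simp add: sum_subtractf t del: of_real_power flip: of_real_sum)
  finally have ww: "(\<Sum>i<n. cnj (w i) * w i) = 2 * (1 - complex_of_real t)" by simp
  have WW: "adj W * W = (2 * (1 - complex_of_real t)) *\<^sub>C E"
    by (simp add: W_def E_def colv_adj_colv ww)
  have WE: "W * E = W" by (simp add: W_def E_def colv_unit)
  have "(\<Sum>i<n. cnj (w i) * (if i = k then 1 else 0)) = cnj (w k)"
    using k by (simp add: if_distrib cong: if_cong)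
  then have We: "adj W * e = (complex_of_real (t - 1)) *\<^sub>C E"
    by (simp add: W_def E_def e_def colv_adj_colv) (simp add: w_def t)
  have c1: "c * (1 - complex_of_real t) = 1"
    using t1 by (simp add: c_def)
  define H where "H = one_fm n - c *\<^sub>C (W * adj W)"
  have cW: "corner n W" by (simp add: W_def)
  have aH: "adj H = H" by (simp add: H_def adj_diff adj_scaleC adj_mult c_def)
  have "c *\<^sub>C (W * adj W) * (c *\<^sub>C (W * adj W)) = (c * c) *\<^sub>C (W * (adj W * W) * adj W)"
    by (simp add: fmat_scaleC_left fmat_scaleC_right scaleC_scaleC mult.assoc)
  also have "\<dots> = (c * c * (2 * (1 - complex_of_real t))) *\<^sub>C (W * adj W)"
    by (simp add: WW fmat_scaleC_left fmat_scaleC_right scaleC_scaleC WE)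
  also have "c * c * (2 * (1 - complex_of_real t)) = c + c"
  proof -
    have "c * c * (2 * (1 - complex_of_real t)) = 2 * c * (c * (1 - complex_of_real t))" by (simp only: mult_ac)
    then show ?thesis by (simp add: c1)
  qed
  finally have cc: "c *\<^sub>C (W * adj W) * (c *\<^sub>C (W * adj W)) = c *\<^sub>C (W * adj W) + c *\<^sub>C (W * adj W)"
    by (simp only: scaleC_add_left)
  have HH: "H * H = one_fm n"
    using cW by (simp add: H_def left_diff_distrib right_diff_distrib cc one_fm_left one_fm_right)
  have "H * e = e - c *\<^sub>C (W * (adj W * e))"
    by (simp add: H_def left_diff_distrib one_fm_left e_def fmat_scaleC_left mult.assoc)
  also have "c *\<^sub>C (W * (adj W * e)) = (c * complex_of_real (t - 1)) *\<^sub>C W"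
    by (simp add: We fmat_scaleC_right scaleC_scaleC WE)
  also have "c * complex_of_real (t - 1) = - 1"
    using c1 by (simp add: algebra_simps)
  also have "e - (- 1) *\<^sub>C W = colv n u"
    by (rule fmat_eq_cornerI [of n]) (auto simp: e_def W_def, auto simp: colv_def entry_fm fmat_entry w_def)
  finally have He: "H * e = colv n u" .
  show thesis
  proof (rule that)
    show "unitary n H" using HH cW by (simp add: unitary_def aH) (simp add: H_def)
    show "adj H = H" by fact
    show "H * colv n (\<lambda>i. if i = k then 1 else 0) = colv n u" using He by (simp add: e_def)
    fix i j assume "i < k" "j < n"
    then show "entry H i j = (if i = j then 1 else 0)"
      using k low [of i] by (simp add: H_def fmat_entry entry_times [OF cW] one_fm_def entry_fm)
       (simp add: W_def colv_def entry_fm w_def)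
  qed
qed

lemma eigenvector_block:
  assumes X: "corner n X" and k: "k < n" and low: "\<And>i j. i < k \<Longrightarrow> j \<noteq> i \<Longrightarrow> entry X i j = 0"
  obtains u e where "(\<Sum>i<n. (cmod (u i))\<^sup>2) = 1" "u k \<in> \<real>" "\<And>i. i < k \<Longrightarrow> u i = 0" "X * colv n u = e *\<^sub>C colv n u"
proof -
  define B where "B = Matrix.mat (n - k) (n - k) (\<lambda>(i, j). entry X (i + k) (j + k))"
  have B: "B \<in> carrier_mat (n - k) (n - k)" by (simp add: B_def)
  from spectrum_non_empty [OF this] k obtain e where "eigenvalue B e"
    by (auto simp: spectrum_def)
  then obtain v where v: "v \<in> carrier_vec (n - k)" "v \<noteq> 0\<^sub>v (n - k)" "B *\<^sub>v v = e \<cdot>\<^sub>v v"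
    using B by (auto simp: eigenvalue_def eigenvector_def)
  define s where "s = (\<Sum>i<n-k. (cmod (v $ i))\<^sup>2)"
  have "s \<noteq> 0"
  proof
    assume "s = 0"
    then have "\<forall>i<n-k. v $ i = 0"
      unfolding s_def by (subst (asm) sum_nonneg_eq_0_iff) auto
    then show False using v by (auto intro!: eq_vecI)
  qed
  moreover have "s \<ge> 0" unfolding s_def by (intro sum_nonneg) auto
  ultimately have s: "s > 0" by simp
  define p where "p = (if v $ 0 = 0 then 1 else cnj (v $ 0) / complex_of_real (cmod (v $ 0)))"
  have p: "cmod p = 1" "p * v $ 0 \<in> \<real>"
    by (auto simp: p_def norm_divide mult.commute [of "cnj _"] complex_norm_square [symmetric] simp flip: of_real_power)
  define u where "u i = (if k \<le> i \<and> i < n then p * v $ (i - k) / complex_of_real (sqrt s) else 0)" for i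
  have shift: "(\<Sum>i<n. f i) = (\<Sum>i<k. f i) + (\<Sum>i<n-k. f (i + k))" for f :: "nat \<Rightarrow> 'x::comm_monoid_add"
  proof -
    have "(\<Sum>i<n. f i) = (\<Sum>i<k. f i) + (\<Sum>i=k..<n. f i)"
      using k by (simp add: sum.atLeastLessThan_concat lessThan_atLeast0)
    also have "(\<Sum>i=k..<n. f i) = (\<Sum>i<n-k. f (i + k))"
      using sum.shift_bounds_nat_ivl [of f 0 k "n - k"] k by (simp add: lessThan_atLeast0)
    finally show ?thesis .
  qed
  show thesis
  proof (rule that)
    have "(\<Sum>i<n. (cmod (u i))\<^sup>2) = (\<Sum>i<n-k. (cmod (v $ i))\<^sup>2 / s)"
      unfolding shift using s p by (auto simp: u_def norm_mult norm_divide power_divide intro!: sum.cong)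
    then show "(\<Sum>i<n. (cmod (u i))\<^sup>2) = 1"
      using s by (simp add: s_def flip: sum_divide_distrib)
    show "u k \<in> \<real>" using p k by (simp add: u_def)
    show "u i = 0" if "i < k" for i using that by (simp add: u_def)
    show "X * colv n u = e *\<^sub>C colv n u"
      unfolding times_colv [OF X]
    proof (rule fmat_eq_cornerI [of n])
      fix i j assume i: "i < n" "j < n"
      have "(\<Sum>j<n. entry X i j * u j) = e * u i"
      proof (cases "i < k")
        case True
        then show ?thesis using k low [OF True] unfolding shift
          by (auto simp: u_def intro!: sum.neutral)
      next
        case False
        have "(\<Sum>j<n. entry X i j * u j) = p / complex_of_real (sqrt s) * (\<Sum>j<n-k. entry X i (j + k) * v $ j)"
          unfolding shift sum_distrib_left by (auto simp: u_def mult_ac intro!: sum.cong)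
        also have "(\<Sum>j<n-k. entry X i (j + k) * v $ j) = (B *\<^sub>v v) $ (i - k)"
          using False i v(1) by (auto simp: B_def scalar_prod_def lessThan_atLeast0 intro!: sum.cong)
        also have "\<dots> = e * v $ (i - k)" using v False i by simp
        finally show ?thesis using False i by (simp add: u_def)
      qed
      then show "entry (colv n (\<lambda>i. \<Sum>j<n. entry X i j * u j)) i j = entry (e *\<^sub>C colv n u) i j"
        by (simp add: colv_def entry_fm fmat_entry)
    qed auto
  qed
qed

lemma spectral_step:
  assumes X: "corner n X" "adj X = X" and k: "k < n" and low: "\<And>i j. i < k \<Longrightarrow> j \<noteq> i \<Longrightarrow> entry X i j = 0"
  obtains U where "unitary n U" "\<And>i j. i \<le> k \<Longrightarrow> j \<noteq> i \<Longrightarrow> entry (adj U * X * U) i j = 0"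
proof -
  obtain u e where u: "(\<Sum>i<n. (cmod (u i))\<^sup>2) = 1" "u k \<in> \<real>" "\<And>i. i < k \<Longrightarrow> u i = 0"
    and e: "X * colv n u = e *\<^sub>C colv n u"
    using eigenvector_block [OF X(1) k low] by blast
  obtain H where H: "unitary n H" "adj H = H" "\<And>i j. i < k \<Longrightarrow> j < n \<Longrightarrow> entry H i j = (if i = j then 1 else 0)"
    "H * colv n (\<lambda>i. if i = k then 1 else 0) = colv n u"
    using householder [OF k u] by blast
  define Y where "Y = H * X * H"
  have cY: "corner n Y" using X unitaryD(1) [OF H(1)] by (simp add: Y_def)
  have HH: "H * H = one_fm n" using unitaryD(2) [OF H(1)] H(2) by simp
  have "Y * colv n (\<lambda>i. if i = k then 1 else 0) = H * (X * colv n u)"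
    by (simp add: Y_def mult.assoc H(4))
  also have "\<dots> = e *\<^sub>C (H * (H * colv n (\<lambda>i. if i = k then 1 else 0)))"
    by (simp add: e fmat_scaleC_right H(4))
  also have "\<dots> = e *\<^sub>C colv n (\<lambda>i. if i = k then 1 else 0)"
    by (simp add: mult.assoc [symmetric] HH one_fm_left)
  finally have *: "Y * colv n (\<lambda>i. if i = k then 1 else 0) = e *\<^sub>C colv n (\<lambda>i. if i = k then 1 else 0)" .
  have col: "entry Y j k = 0" if "j \<noteq> k" for j
  proof (cases "j < n")
    case True
    have "entry (Y * colv n (\<lambda>i. if i = k then 1 else 0)) j 0 = entry Y j k"
      using True k by (simp add: times_colv [OF cY]) (simp add: colv_def entry_fm if_distrib cong: if_cong)
    then have "entry Y j k = entry (e *\<^sub>C colv n (\<lambda>i. if i = k then 1 else 0)) j 0" by (simp add: *)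
    then show ?thesis using that by (simp add: colv_def entry_fm fmat_entry)
  qed (simp add: cornerD [OF cY])
  have aY: "adj Y = Y" using X H by (simp add: Y_def adj_mult mult.assoc)
  have row: "entry Y k j = 0" if "j \<noteq> k" for j
    using col [OF that] arg_cong [OF aY, of "\<lambda>Z. entry Z k j"] by (simp add: entry_adj)
  have rows: "entry Y i j = 0" if "i < k" "j \<noteq> i" for i j
  proof (cases "j < n")
    case True
    have r: "entry (H * X) i l = (if l = i then entry X i i else 0)" for l
    proof -
      have "entry (H * X) i l = (\<Sum>m<n. (if i = m then 1 else 0) * entry X m l)"
        using H(3) that(1) by (auto simp: entry_times [OF unitaryD(1) [OF H(1)]] intro!: sum.cong)
      also have "\<dots> = entry X i l" using that k by (simp add: if_distrib if_distribR cong: if_cong)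
      finally show ?thesis using low [OF that(1)] by auto
    qed
    have "entry Y i j = (\<Sum>l<n. entry (H * X) i l * entry H l j)"
      using X unitaryD(1) [OF H(1)] unfolding Y_def by (intro entry_times) simp
    also have "\<dots> = entry X i i * entry H i j"
      using that k by (simp add: r if_distrib if_distribR cong: if_cong)
    finally show ?thesis using H(3) [OF that(1) True] that by simp
  qed (simp add: cornerD [OF cY])
  show thesis
  proof (rule that [OF H(1)])
    fix i j assume "i \<le> k" "j \<noteq> i"
    then show "entry (adj H * X * H) i j = 0"
      using row rows unfolding H(2) Y_def [symmetric] by (cases "i = k") auto
  qed
qed

theorem spectral_theorem:
  assumes X: "corner n X" "adj X = X"
  obtains U l where "unitary n U" "adj U * X * U = diag_fm n l"
proof -
  have "k \<le> n \<Longrightarrow> \<exists>U. unitary n U \<and> (\<forall>i j. i < k \<longrightarrow> j \<noteq> i \<longrightarrow> entry (adj U * X * U) i j = 0)" for k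
  proof (induction k)
    case 0
    then show ?case using unitary_one by auto
  next
    case (Suc k)
    then obtain U where U: "unitary n U" "\<And>i j. i < k \<Longrightarrow> j \<noteq> i \<Longrightarrow> entry (adj U * X * U) i j = 0"
      by auto
    have c: "corner n (adj U * X * U)" "adj (adj U * X * U) = adj U * X * U"
      using X unitaryD(1) [OF U(1)] by (auto simp: adj_mult mult.assoc)
    obtain V where V: "unitary n V" "\<And>i j. i \<le> k \<Longrightarrow> j \<noteq> i \<Longrightarrow> entry (adj V * (adj U * X * U) * V) i j = 0"
      using spectral_step [OF c _ U(2)] Suc.prems by (metis Suc_le_lessD)
    then show ?case
      by (intro exI [of _ "U * V"]) (auto simp: unitary_mult [OF U(1)] adj_mult mult.assoc less_Suc_eq_le)
  qed
  from this [of n] obtain U where U: "unitary n U" "\<And>i j. i < n \<Longrightarrow> j \<noteq> i \<Longrightarrow> entry (adj U * X * U) i j = 0"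
    by auto
  let ?Y = "adj U * X * U"
  have c: "corner n ?Y" "adj ?Y = ?Y"
    using X unitaryD(1) [OF U(1)] by (auto simp: adj_mult mult.assoc)
  have "entry ?Y i i = complex_of_real (Re (entry ?Y i i))" for i
    using arg_cong [OF c(2), of "\<lambda>Z. entry Z i i"] by (simp add: entry_adj complex_eq_iff)
  then have "?Y = diag_fm n (\<lambda>i. Re (entry ?Y i i))"
    using U(2) by (intro fmat_eq_cornerI [OF c(1)]) (auto simp: diag_fm_def entry_fm)
  then show thesis using that U by blast
qed


definition splits :: "real \<Rightarrow> ('a set \<Rightarrow> bool) \<Rightarrow> 'a set \<Rightarrow> bool"
  where "splits c P \<Omega> \<longleftrightarrow>
    (\<exists>\<C>. finite \<C> \<and> real (card \<C>) \<le> c \<and> \<Omega> \<subseteq> \<Union>\<C> \<and> (\<forall>S\<in>\<C>. S \<subseteq> \<Omega> \<and> P S))"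

lemma splitsI:
  assumes "finite \<C>" "real (card \<C>) \<le> c" "\<Omega> \<subseteq> \<Union>\<C>" "\<And>S. S \<in> \<C> \<Longrightarrow> S \<subseteq> \<Omega>" "\<And>S. S \<in> \<C> \<Longrightarrow> P S"
  shows "splits c P \<Omega>"
  unfolding splits_def by (rule exI [of _ \<C>]) (simp add: assms)

lemma splitsE:
  assumes "splits c P \<Omega>"
  obtains \<C> where "finite \<C>" "real (card \<C>) \<le> c" "\<Omega> \<subseteq> \<Union>\<C>" "\<forall>S\<in>\<C>. S \<subseteq> \<Omega> \<and> P S"
proof -
  from assms obtain \<C> where "finite \<C> \<and> real (card \<C>) \<le> c \<and> \<Omega> \<subseteq> \<Union>\<C> \<and> (\<forall>S\<in>\<C>. S \<subseteq> \<Omega> \<and> P S)"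
    unfolding splits_def ..
  then show thesis by (intro that [of \<C>]) simp_all
qed

lemma splits_label:
  assumes "f ` \<Omega> \<subseteq> L" "finite L" "real (card L) \<le> c" "\<And>l. P {A\<in>\<Omega>. f A = l}"
  shows "splits c P \<Omega>"
proof (rule splitsI)
  let ?\<C> = "(\<lambda>l. {A\<in>\<Omega>. f A = l}) ` L"
  show "finite ?\<C>" using assms by simp
  show "real (card ?\<C>) \<le> c" 
    using card_image_le [OF assms(2), of "\<lambda>l. {A\<in>\<Omega>. f A = l}"] assms(3) by linarith
  show "\<Omega> \<subseteq> \<Union>?\<C>" using assms(1) by auto
  fix S assume "S \<in> ?\<C>"
  then show "S \<subseteq> \<Omega>" "P S" using assms(4) by auto
qed

lemma splits_trans:
  assumes "splits c P \<Omega>" "\<And>S. S \<subseteq> \<Omega> \<Longrightarrow> P S \<Longrightarrow> splits d Q S" "0 \<le> d"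
  shows "splits (c * d) Q \<Omega>"
proof -
  obtain \<C> where C: "finite \<C>" "real (card \<C>) \<le> c" "\<Omega> \<subseteq> \<Union>\<C>" "\<forall>S\<in>\<C>. S \<subseteq> \<Omega> \<and> P S"
    by (rule splitsE [OF assms(1)])
  have "\<forall>S\<in>\<C>. \<exists>\<D>. finite \<D> \<and> real (card \<D>) \<le> d \<and> S \<subseteq> \<Union>\<D> \<and> (\<forall>T\<in>\<D>. T \<subseteq> S \<and> Q T)"
  proof
    fix S assume "S \<in> \<C>"
    then have "splits d Q S" using C(4) assms(2) by simp
    then show "\<exists>\<D>. finite \<D> \<and> real (card \<D>) \<le> d \<and> S \<subseteq> \<Union>\<D> \<and> (\<forall>T\<in>\<D>. T \<subseteq> S \<and> Q T)"
      unfolding splits_def .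
  qed
  from bchoice [OF this] obtain \<D> where D: "\<forall>S\<in>\<C>. finite (\<D> S) \<and> real (card (\<D> S)) \<le> d \<and> S \<subseteq> \<Union>(\<D> S) \<and> (\<forall>T\<in>\<D> S. T \<subseteq> S \<and> Q T)"
    ..
  show ?thesis
  proof (rule splitsI)
    let ?\<E> = "\<Union>S\<in>\<C>. \<D> S"
    show "finite ?\<E>" using C(1) D by (intro finite_UN_I) simp_all
    have "real (card ?\<E>) \<le> (\<Sum>S\<in>\<C>. real (card (\<D> S)))"
      using card_UN_le [OF C(1), of \<D>] by (simp flip: of_nat_sum)
    also have "\<dots> \<le> real (card \<C>) * d"
      using D by (intro sum_bounded_above) simp
    also have "\<dots> \<le> c * d"
      using C(2) assms(3) by (rule mult_right_mono)
    finally show "real (card ?\<E>) \<le> c * d" .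
    show "\<Omega> \<subseteq> \<Union>?\<E>"
    proof
      fix A assume "A \<in> \<Omega>"
      then obtain S where S: "S \<in> \<C>" "A \<in> S" using C(3) by blast
      then have "A \<in> \<Union>(\<D> S)" using D by blast
      then show "A \<in> \<Union>?\<E>" using S by blast
    qed
    fix T assume "T \<in> ?\<E>"
    then obtain S where S: "S \<in> \<C>" "T \<in> \<D> S" by blast
    then have "T \<subseteq> S \<and> Q T" using D by simp
    then show "T \<subseteq> \<Omega>" "Q T" using C(4) S(1) by auto
  qed
qed

lemma splits_mono:
  assumes "splits c P \<Omega>" "c \<le> d" "\<And>S. S \<subseteq> \<Omega> \<Longrightarrow> P S \<Longrightarrow> Q S"
  shows "splits d Q \<Omega>"
proof -
  obtain \<C> where C: "finite \<C>" "real (card \<C>) \<le> c" "\<Omega> \<subseteq> \<Union>\<C>" "\<forall>S\<in>\<C>. S \<subseteq> \<Omega> \<and> P S"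
    by (rule splitsE [OF assms(1)])
  show ?thesis
    using C assms(2,3) by (intro splitsI [of \<C>]) simp_all
qed

lemma sum_third_powers_le: "(\<Sum>k\<in>{- int M..int M}. (1/3::real) ^ nat \<bar>k\<bar>) \<le> 2"
proof -
  have "(\<Sum>k\<in>{- int M..int M}. (1/3::real) ^ nat \<bar>k\<bar>) = 2 - (1/3) ^ M"
  proof (induction M)
    case (Suc M)
    have "{- int (Suc M)..int (Suc M)} = insert (int (Suc M)) (insert (- int (Suc M)) {- int M..int M})"
      by auto
    moreover have "nat \<bar>int (Suc M)\<bar> = Suc M" "nat \<bar>- int (Suc M)\<bar> = Suc M" by auto
    ultimately have "(\<Sum>k\<in>{- int (Suc M)..int (Suc M)}. (1/3::real) ^ nat \<bar>k\<bar>)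
      = (1/3) ^ Suc M + ((1/3) ^ Suc M + (\<Sum>k\<in>{- int M..int M}. (1/3::real) ^ nat \<bar>k\<bar>))"
      by (simp del: of_nat_Suc)
    then show ?case unfolding Suc by (simp add: field_simps)
  qed simp
  then show ?thesis by simp
qed

lemma card_lattice_points:
  fixes M :: nat
  assumes "finite J"
  defines "S \<equiv> {z \<in> J \<rightarrow>\<^sub>E (UNIV :: int set). (\<Sum>j\<in>J. nat \<bar>z j\<bar>) \<le> M}"
  shows "finite S" "real (card S) \<le> 3 ^ M * 2 ^ card J"
proof -
  let ?B = "J \<rightarrow>\<^sub>E {- int M..int M}"
  have sub: "S \<subseteq> ?B"
  proof
    fix z assume z: "z \<in> S"
    have "\<bar>z j\<bar> \<le> int M" if "j \<in> J" for j
      using member_le_sum [of j J "\<lambda>j. nat \<bar>z j\<bar>"] that z \<open>finite J\<close> by (auto simp: S_def)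
    then show "z \<in> ?B" using z by (force simp: S_def PiE_iff)
  qed
  have fin: "finite ?B" using assms(1) by (intro finite_PiE) auto
  then show "finite S" using sub by (rule rev_finite_subset)
  have "real (card S) * (1/3) ^ M \<le> (\<Sum>z\<in>S. \<Prod>j\<in>J. (1/3::real) ^ nat \<bar>z j\<bar>)"
  proof (rule sum_bounded_below)
    fix z assume "z \<in> S"
    then have "(\<Sum>j\<in>J. nat \<bar>z j\<bar>) \<le> M" by (simp add: S_def)
    then have "(1/3::real) ^ M \<le> (1/3) ^ (\<Sum>j\<in>J. nat \<bar>z j\<bar>)" by (rule power_decreasing) auto
    also have "\<dots> = (\<Prod>j\<in>J. (1/3::real) ^ nat \<bar>z j\<bar>)" by (rule power_sum)
    finally show "(1/3::real) ^ M \<le> (\<Prod>j\<in>J. (1/3::real) ^ nat \<bar>z j\<bar>)" .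
  qed
  also have "\<dots> \<le> (\<Sum>z\<in>?B. \<Prod>j\<in>J. (1/3::real) ^ nat \<bar>z j\<bar>)"
    using sub fin by (intro sum_mono2 prod_nonneg) auto
  also have "\<dots> = (\<Prod>j\<in>J. \<Sum>k\<in>{- int M..int M}. (1/3::real) ^ nat \<bar>k\<bar>)"
    using assms(1) by (subst prod_sum_PiE) auto
  also have "\<dots> \<le> (\<Prod>j\<in>J. 2)"
    by (intro prod_mono conjI sum_nonneg sum_third_powers_le) auto
  finally show "real (card S) \<le> 3 ^ M * 2 ^ card J"
    by (simp add: field_simps power_divide)
qed

lemma splits_rounding:
  fixes f :: "'a \<Rightarrow> 'j \<Rightarrow> real"
  assumes "finite J" and d: "real (card J) \<le> d" "0 < d" and s: "0 < s"
    and L: "\<And>A. A \<in> \<Omega> \<Longrightarrow> (\<Sum>j\<in>J. (f A j)\<^sup>2) \<le> L"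
  shows "splits (exp (d * (4 * L / s + 5))) (\<lambda>S. \<forall>A\<in>S. \<forall>B\<in>S. (\<Sum>j\<in>J. (f A j - f B j)\<^sup>2) \<le> s) \<Omega>"
proof (cases "\<Omega> = {}")
  case True
  then show ?thesis by (auto simp: splits_def intro!: exI [of _ "{}"])
next
  case False
  then obtain A0 where "A0 \<in> \<Omega>" by blast
  have "0 \<le> (\<Sum>j\<in>J. (f A0 j)\<^sup>2)" by (intro sum_nonneg) simp
  with L [OF \<open>A0 \<in> \<Omega>\<close>] have "L \<ge> 0" by linarith
  define h where "h = sqrt (s / d)"
  have h: "h > 0" "h\<^sup>2 = s / d" using d s by (auto simp: h_def)
  define z where "z A = (\<lambda>j\<in>J. \<lfloor>f A j / h\<rfloor>)" for A
  define M where "M = nat \<lfloor>d * (2 * L / s + 2)\<rfloor>"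
  have nn: "0 \<le> d * (2 * L / s + 2)" using d s \<open>L \<ge> 0\<close> by auto
  have M: "real M \<le> d * (2 * L / s + 2)" using nn by (simp add: M_def)
  let ?L = "{z \<in> J \<rightarrow>\<^sub>E (UNIV :: int set). (\<Sum>j\<in>J. nat \<bar>z j\<bar>) \<le> M}"
  show ?thesis
  proof (rule splits_label [of z _ ?L])
    have "z A \<in> ?L" if A: "A \<in> \<Omega>" for A
    proof -
      have 1: "real (nat \<bar>\<lfloor>u\<rfloor>\<bar>) \<le> 2 * u\<^sup>2 + 2" for u :: real
      proof -
        have "real_of_int \<bar>\<lfloor>u\<rfloor>\<bar> \<le> \<bar>u\<bar> + 1" by linarith
        moreover have "\<bar>u\<bar> \<le> u\<^sup>2 + 1"
        proof -
          have "0 \<le> (\<bar>u\<bar> - 1)\<^sup>2 + u\<^sup>2 + 1" by simp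
          then have "0 \<le> u\<^sup>2 + 1 - 2 * \<bar>u\<bar> + u\<^sup>2 + 1" by (simp add: power2_diff)
          then show ?thesis by linarith
        qed
        moreover have "real (nat \<bar>\<lfloor>u\<rfloor>\<bar>) = real_of_int \<bar>\<lfloor>u\<rfloor>\<bar>" by simp
        moreover have "0 \<le> u\<^sup>2" by simp
        ultimately show ?thesis by linarith
      qed
      have "real (\<Sum>j\<in>J. nat \<bar>z A j\<bar>) \<le> (\<Sum>j\<in>J. 2 * (f A j / h)\<^sup>2 + 2)"
        unfolding of_nat_sum using 1 by (intro sum_mono) (simp only: z_def restrict_apply' simp_thms)
      also have "\<dots> = 2 * (\<Sum>j\<in>J. (f A j)\<^sup>2) / h\<^sup>2 + 2 * real (card J)"
        by (simp add: sum.distrib power_divide sum_distrib_left sum_divide_distrib)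
      also have "\<dots> \<le> 2 * L / h\<^sup>2 + 2 * d"
        using L [OF A] d by (intro add_mono divide_right_mono) auto
      also have "\<dots> = d * (2 * L / s + 2)" using d s by (simp add: h field_simps)
      finally have "(\<Sum>j\<in>J. nat \<bar>z A j\<bar>) \<le> M" unfolding M_def by (simp only: le_nat_floor)
      then show ?thesis by (simp add: z_def)
    qed
    then show "z ` \<Omega> \<subseteq> ?L" by blast
    show "finite ?L" by (rule card_lattice_points) fact
    have "real (card ?L) \<le> 3 ^ M * 2 ^ card J" by (rule card_lattice_points) fact
    also have "\<dots> \<le> exp (2 * (d * (2 * L / s + 2))) * exp d"
    proof (rule mult_mono)
      have "(3::real) \<le> exp 2" using exp_ge_add_one_self [of 2] by simp
      then have "(3::real) ^ M \<le> exp 2 ^ M" by (rule power_mono) simp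
      also have "\<dots> \<le> exp (2 * (d * (2 * L / s + 2)))" using M by (simp flip: exp_of_nat_mult)
      finally show "(3::real) ^ M \<le> exp (2 * (d * (2 * L / s + 2)))" .
      have "(2::real) \<le> exp 1" using exp_ge_add_one_self [of 1] by simp
      then have "(2::real) ^ card J \<le> exp 1 ^ card J" by (rule power_mono) simp
      also have "\<dots> \<le> exp d" using d by (simp flip: exp_of_nat_mult)
      finally show "(2::real) ^ card J \<le> exp d" .
    qed auto
    also have "\<dots> = exp (d * (4 * L / s + 5))" by (simp flip: exp_add add: algebra_simps)
    finally show "real (card ?L) \<le> exp (d * (4 * L / s + 5))" .
    fix l
    show "\<forall>A\<in>{A \<in> \<Omega>. z A = l}. \<forall>B\<in>{A \<in> \<Omega>. z A = l}. (\<Sum>j\<in>J. (f A j - f B j)\<^sup>2) \<le> s"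
    proof (intro ballI)
      fix A B assume "A \<in> {A \<in> \<Omega>. z A = l}" "B \<in> {A \<in> \<Omega>. z A = l}"
      then have zz: "z A = z B" by simp
      have "(f A j - f B j)\<^sup>2 \<le> h\<^sup>2" if "j \<in> J" for j
      proof -
        have "\<lfloor>f A j / h\<rfloor> = \<lfloor>f B j / h\<rfloor>" using fun_cong [OF zz, of j] that by (simp add: z_def)
        then have "\<bar>f A j / h - f B j / h\<bar> \<le> 1" by linarith
        then have "\<bar>f A j - f B j\<bar> \<le> \<bar>h\<bar>" using h by (simp add: field_simps flip: diff_divide_distrib)
        then show ?thesis by (simp add: abs_le_square_iff)
      qed
      then have "(\<Sum>j\<in>J. (f A j - f B j)\<^sup>2) \<le> (\<Sum>j\<in>J. h\<^sup>2)" by (rule sum_mono)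
      also have "\<dots> = real (card J) * h\<^sup>2" by simp
      also have "\<dots> \<le> d * h\<^sup>2" using d by (intro mult_right_mono) auto
      also have "\<dots> = s" using d by (simp add: h)
      finally show "(\<Sum>j\<in>J. (f A j - f B j)\<^sup>2) \<le> s" .
    qed
  qed
qed


definition cj :: "fmat \<Rightarrow> fmat \<Rightarrow> fmat" where "cj U A = adj U * A * U"

lemma cj_simps: "cj U (A + B) = cj U A + cj U B" "cj U (A - B) = cj U A - cj U B" "adj (cj U A) = cj U (adj A)"
  by (simp_all add: cj_def algebra_simps adj_mult)

lemma cj_cj: "cj V (cj U A) = cj (U * V) A"
  by (simp add: cj_def adj_mult mult.assoc)

lemma corner_cj [simp]: "unitary n U \<Longrightarrow> corner n A \<Longrightarrow> corner n (cj U A)"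
  by (simp add: cj_def unitaryD)

lemma cj_mult: "unitary n U \<Longrightarrow> corner n B \<Longrightarrow> cj U (A * B) = cj U A * cj U B"
  by (simp add: cj_def mult.assoc unitaryD(5) [of n U "B * U"] unitaryD)

lemma cj_mult3: "unitary n U \<Longrightarrow> corner n B \<Longrightarrow> cj U (A * B) = cj U A * cj U B"
  by (simp add: cj_def mult.assoc unitaryD(5) unitaryD(1))

lemma norm_cj: "unitary n U \<Longrightarrow> corner n A \<Longrightarrow> norm (cj U A) = norm A"
proof -
  assume U: "unitary n U" and A: "corner n A"
  have "tr (adj (cj U A) * cj U A) = tr (cj U (adj A * A))"
    using A by (simp add: cj_simps cj_mult [OF U])
  also have "\<dots> = tr (adj U * (adj A * A * U))" by (simp add: cj_def mult.assoc)
  also have "\<dots> = tr (adj A * (A * (U * adj U)))"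
    by (subst tr_commute) (simp add: mult.assoc)
  also have "\<dots> = tr (adj A * A)" using A U by (simp add: unitaryD(3) one_fm_right)
  finally have "(norm (cj U A))\<^sup>2 = (norm A)\<^sup>2" by (simp add: norm_sq_tr)
  then show ?thesis by simp
qed

text \<open>tame\<close>
definition tame :: "real \<Rightarrow> nat \<Rightarrow> fmat \<Rightarrow> bool"
  where "tame K N Z \<longleftrightarrow> corner N Z \<and> norm Z \<le> K * sqrt N \<and>
    norm (adj Z * Z) \<le> K * sqrt N \<and> norm (Z * adj Z) \<le> K * sqrt N \<and>
    norm (Z * adj Z * (Z * adj Z)) \<le> K * sqrt N \<and> norm (adj Z * Z * (adj Z * Z)) \<le> K * sqrt N"

lemma tame_adj: "tame K N Z \<Longrightarrow> tame K N (adj Z)"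
  by (auto simp: tame_def norm_adj)

lemma tame_cj:
  assumes "unitary N U" "tame K N Z"
  shows "tame K N (cj U Z)"
proof -
  have c: "corner N Z" "corner N (adj Z * Z)" "corner N (Z * adj Z)" using assms by (auto simp: tame_def)
  have "adj (cj U Z) * cj U Z = cj U (adj Z * Z)" "cj U Z * adj (cj U Z) = cj U (Z * adj Z)"
    using assms c by (simp_all add: cj_simps cj_mult [OF assms(1)])
  moreover have "cj U A * cj U A = cj U (A * A)" if "corner N A" for A
    using cj_mult [OF assms(1) that] by simp
  moreover have "corner N (cj U Z)" using assms(1) c(1) by simp
  ultimately show ?thesis
    using assms(2) c by (simp only: tame_def norm_cj [OF assms(1)] corner_times)
qed

lemma norm_diff_mult_tame:
  assumes X: "tame K N X" "tame K N X'" and Y: "tame K N Y" and z: "norm (X - X') \<le> z * sqrt N" and K: "K \<ge> 0"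
  shows "norm ((X - X') * Y) \<le> sqrt (2 * K * z) * sqrt N"
proof -
  have 1: "norm (W * (Y * adj Y)) \<le> K * sqrt N" if "tame K N W" for W
  proof -
    have "(norm (W * (Y * adj Y)))\<^sup>2 = Re (tr ((adj W * W) * (Y * adj Y * (Y * adj Y))))"
      using tr_commute [of "Y * adj Y" "adj W * (W * (Y * adj Y))"] by (simp add: norm_sq_tr adj_mult mult.assoc)
    also have "\<dots> \<le> norm (adj W * W) * norm (Y * adj Y * (Y * adj Y))" by (rule Re_tr_le)
    also have "\<dots> \<le> (K * sqrt N) * (K * sqrt N)"
      using that Y K by (intro mult_mono) (auto simp: tame_def)
    also have "\<dots> = (K * sqrt N)\<^sup>2" by (simp add: power2_eq_square)
    finally show ?thesis by (rule power2_le_imp_le) (use K in simp)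
  qed
  let ?D = "X - X'"
  have "(norm (?D * Y))\<^sup>2 = Re (tr (adj ?D * (?D * (Y * adj Y))))"
    using tr_commute [of "adj Y" "adj ?D * ?D * Y"] by (simp add: norm_sq_tr adj_mult mult.assoc)
  also have "\<dots> \<le> norm ?D * norm (?D * (Y * adj Y))"
    using Re_tr_le [of "adj ?D"] by (simp add: norm_adj)
  also have "\<dots> \<le> norm ?D * (K * sqrt N + K * sqrt N)"
    using 1 [OF X(1)] 1 [OF X(2)] norm_triangle_ineq4 [of "X * (Y * adj Y)" "X' * (Y * adj Y)"]
    by (intro mult_left_mono) (auto simp: left_diff_distrib)
  also have "\<dots> \<le> (z * sqrt N) * (K * sqrt N + K * sqrt N)"
    using K z by (intro mult_right_mono) auto
  also have "\<dots> = 2 * K * z * N" by (simp add: algebra_simps)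
  finally have "norm (?D * Y) \<le> sqrt (2 * K * z * N)" by (rule real_le_rsqrt)
  then show ?thesis by (simp add: real_sqrt_mult)
qed

lemma norm_mult_diff_tame:
  assumes "tame K N X" "tame K N X'" "tame K N Y" "norm (X - X') \<le> z * sqrt N" "K \<ge> 0"
  shows "norm (Y * (X - X')) \<le> sqrt (2 * K * z) * sqrt N"
proof -
  have "norm (adj X - adj X') \<le> z * sqrt N" using assms(4) by (simp add: norm_adj flip: adj_diff)
  then have "norm ((adj X - adj X') * adj Y) \<le> sqrt (2 * K * z) * sqrt N"
    by (rule norm_diff_mult_tame [OF assms(1-3) [THEN tame_adj] _ assms(5)])
  moreover have "(adj X - adj X') * adj Y = adj (Y * (X - X'))"
    by (simp add: adj_mult adj_diff)
  ultimately show ?thesis by (simp add: norm_adj)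
qed

definition few_close_pairs :: "nat \<Rightarrow> real \<Rightarrow> real \<Rightarrow> (nat \<Rightarrow> real) \<Rightarrow> bool"
  where "few_close_pairs N \<eta> \<theta> l \<longleftrightarrow>
    real (card {(i, j). i < N \<and> j < N \<and> \<bar>l i - l j\<bar> < \<theta>}) \<le> \<eta> * (real N)\<^sup>2"

definition spread :: "nat \<Rightarrow> real \<Rightarrow> real \<Rightarrow> fmat \<Rightarrow> bool"
  where "spread N \<eta> \<theta> X \<longleftrightarrow>
    (\<forall>U l. unitary N U \<longrightarrow> cj U X = diag_fm N l \<longrightarrow> few_close_pairs N \<eta> \<theta> l)"

lemma norm_sq_pairs: "corner n A \<Longrightarrow> (norm A)\<^sup>2 = (\<Sum>(i,j)\<in>{..<n}\<times>{..<n}. (cmod (entry A i j))\<^sup>2)"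
  by (simp add: norm_sq_sum sum.cartesian_product)

lemma entry_diag_commutator:
  assumes "corner n Z" "i < n" "j < n"
  shows "entry (diag_fm n l * Z - Z * diag_fm n l) i j = complex_of_real (l i - l j) * entry Z i j"
proof -
  have "entry (diag_fm n l * Z) i j = complex_of_real (l i) * entry Z i j"
    using assms by (simp add: entry_times [of n] diag_fm_def entry_fm if_distrib if_distribR cong: if_cong)
  moreover have "entry (Z * diag_fm n l) i j = complex_of_real (l j) * entry Z i j"
    using assms by (simp add: entry_times [of n] diag_fm_def entry_fm if_distrib if_distribR cong: if_cong)
  ultimately show ?thesis by (simp add: entry_minus_aux algebra_simps)
qed

lemma near_commutant_splits:
  assumes N: "N > 0" and eta: "\<eta> > 0" and th: "\<theta> > 0" and zeta: "\<zeta> > 0" and kap: "\<kappa> \<le> \<theta> * \<zeta> / 2"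
    and l: "few_close_pairs N \<eta> \<theta> l"
    and Z: "\<And>A. A \<in> \<Omega> \<Longrightarrow> corner N (Z A)" "\<And>A. A \<in> \<Omega> \<Longrightarrow> norm (Z A) \<le> K * sqrt N"
    and com: "\<And>A. A \<in> \<Omega> \<Longrightarrow> norm (diag_fm N l * Z A - Z A * diag_fm N l) \<le> \<kappa> * sqrt N"
  shows "splits (exp (2 * \<eta> * (real N)\<^sup>2 * (4 * K\<^sup>2 / \<zeta>\<^sup>2 + 5)))
    (\<lambda>S. \<forall>A\<in>S. \<forall>B\<in>S. norm (Z A - Z B) \<le> 2 * \<zeta> * sqrt N) \<Omega>"
proof -
  define G where "G = {(i, j). i < N \<and> j < N \<and> \<bar>l i - l j\<bar> < \<theta>}"
  define J where "J = G \<times> (UNIV :: bool set)"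
  define F where "F W = (\<lambda>((i, j), b). if b then Re (entry W i j) else Im (entry W i j))" for W
  define f where "f A = F (Z A)" for A
  have sub: "G \<subseteq> {..<N} \<times> {..<N}" by (auto simp: G_def)
  then have finG: "finite G" by (rule finite_subset) simp
  have sumF: "(\<Sum>p\<in>J. (F W p)\<^sup>2) = (\<Sum>(i,j)\<in>G. (cmod (entry W i j))\<^sup>2)" for W
  proof -
    have "(\<Sum>p\<in>J. (F W p)\<^sup>2) = (\<Sum>q\<in>G. \<Sum>b\<in>UNIV. (F W (q, b))\<^sup>2)"
      unfolding J_def by (subst sum.cartesian_product) (simp add: case_prod_beta)
    also have "\<dots> = (\<Sum>(i,j)\<in>G. (cmod (entry W i j))\<^sup>2)"
      by (intro sum.cong refl) (auto simp: F_def UNIV_bool cmod_power2)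
    finally show ?thesis .
  qed
  have F_diff: "F W p - F W' p = F (W - W') p" for W W' p
    by (auto simp: F_def entry_minus_aux split: prod.splits)
  have fs: "(\<Sum>p\<in>J. (f A p)\<^sup>2) = (\<Sum>(i,j)\<in>G. (cmod (entry (Z A) i j))\<^sup>2)" for A
    by (simp add: f_def sumF)
  have fd: "(\<Sum>p\<in>J. (f A p - f B p)\<^sup>2) = (\<Sum>(i,j)\<in>G. (cmod (entry (Z A - Z B) i j))\<^sup>2)" for A B
    by (simp add: f_def sumF F_diff)
  have "splits (exp (2 * \<eta> * (real N)\<^sup>2 * (4 * (K\<^sup>2 * N) / (\<zeta>\<^sup>2 * N) + 5)))
    (\<lambda>S. \<forall>A\<in>S. \<forall>B\<in>S. (\<Sum>p\<in>J. (f A p - f B p)\<^sup>2) \<le> \<zeta>\<^sup>2 * N) \<Omega>"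
  proof (rule splits_rounding)
    show "finite J" using finG by (simp add: J_def)
    show "real (card J) \<le> 2 * \<eta> * (real N)\<^sup>2"
      using l by (simp add: J_def card_cartesian_product few_close_pairs_def G_def)
    show "0 < 2 * \<eta> * (real N)\<^sup>2" "0 < \<zeta>\<^sup>2 * real N" using eta N zeta by auto
    fix A assume A: "A \<in> \<Omega>"
    have "(\<Sum>p\<in>J. (f A p)\<^sup>2) \<le> (norm (Z A))\<^sup>2"
      unfolding fs norm_sq_pairs [OF Z(1) [OF A]] using sub by (intro sum_mono2) auto
    also have "\<dots> \<le> (K * sqrt N)\<^sup>2" using Z(2) [OF A] by (intro power_mono) auto
    finally show "(\<Sum>p\<in>J. (f A p)\<^sup>2) \<le> K\<^sup>2 * real N" by (simp add: power_mult_distrib)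
  qed
  then show ?thesis
  proof (rule splits_mono)
    show "exp (2 * \<eta> * (real N)\<^sup>2 * (4 * (K\<^sup>2 * N) / (\<zeta>\<^sup>2 * N) + 5)) \<le> exp (2 * \<eta> * (real N)\<^sup>2 * (4 * K\<^sup>2 / \<zeta>\<^sup>2 + 5))"
      using N by simp
    fix S assume S: "S \<subseteq> \<Omega>" and P: "\<forall>A\<in>S. \<forall>B\<in>S. (\<Sum>p\<in>J. (f A p - f B p)\<^sup>2) \<le> \<zeta>\<^sup>2 * N"
    show "\<forall>A\<in>S. \<forall>B\<in>S. norm (Z A - Z B) \<le> 2 * \<zeta> * sqrt N"
    proof (intro ballI)
      fix A B assume AB: "A \<in> S" "B \<in> S"
      then have AB': "A \<in> \<Omega>" "B \<in> \<Omega>" using S by auto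
      let ?W = "Z A - Z B" let ?D = "diag_fm N l" let ?Q = "{..<N} \<times> {..<N}"
      have cW: "corner N ?W" using Z AB' by simp
      have "norm (?D * ?W - ?W * ?D) \<le> norm (?D * Z A - Z A * ?D) + norm (?D * Z B - Z B * ?D)"
        using norm_triangle_ineq4 [of "?D * Z A - Z A * ?D" "?D * Z B - Z B * ?D"] by (simp add: algebra_simps)
      also have "\<dots> \<le> 2 * \<kappa> * sqrt N" using com [OF AB'(1)] com [OF AB'(2)] by linarith
      also have "\<dots> \<le> \<theta> * \<zeta> * sqrt N" using kap by (intro mult_right_mono) auto
      finally have "(norm (?D * ?W - ?W * ?D))\<^sup>2 \<le> (\<theta> * \<zeta> * sqrt N)\<^sup>2" by (intro power_mono) auto
      then have c: "(norm (?D * ?W - ?W * ?D))\<^sup>2 \<le> \<theta>\<^sup>2 * (\<zeta>\<^sup>2 * N)" by (simp add: power_mult_distrib)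
      have "\<theta>\<^sup>2 * (\<Sum>(i,j)\<in>?Q - G. (cmod (entry ?W i j))\<^sup>2)
        \<le> (\<Sum>(i,j)\<in>?Q - G. (cmod (entry (?D * ?W - ?W * ?D) i j))\<^sup>2)"
        unfolding sum_distrib_left
      proof (intro sum_mono, clarsimp simp: entry_diag_commutator [OF cW])
        fix i j assume ij: "i < N" "j < N" "(i, j) \<notin> G"
        then have "\<theta> \<le> \<bar>l i - l j\<bar>" by (auto simp: G_def)
        then have "\<theta>\<^sup>2 \<le> (l i - l j)\<^sup>2" using th power_mono [of \<theta> "\<bar>l i - l j\<bar>" 2] by simp
        then have "\<theta>\<^sup>2 * (cmod (entry ?W i j))\<^sup>2 \<le> (l i - l j)\<^sup>2 * (cmod (entry ?W i j))\<^sup>2"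
          by (rule mult_right_mono) simp
        also have "\<dots> = (cmod (complex_of_real (l i - l j) * entry ?W i j))\<^sup>2"
          unfolding norm_mult norm_of_real power_mult_distrib by simp
        finally show "\<theta>\<^sup>2 * (cmod (entry ?W i j))\<^sup>2 \<le> (cmod ((complex_of_real (l i) - complex_of_real (l j)) * entry ?W i j))\<^sup>2"
          by simp
      qed
      also have "\<dots> \<le> (norm (?D * ?W - ?W * ?D))\<^sup>2"
        using cW by (subst norm_sq_pairs [of N]) (auto intro!: sum_mono2)
      also note c
      finally have far: "(\<Sum>(i,j)\<in>?Q - G. (cmod (entry ?W i j))\<^sup>2) \<le> \<zeta>\<^sup>2 * N"
        using th by simp
      have "(norm ?W)\<^sup>2 = (\<Sum>(i,j)\<in>?Q - G. (cmod (entry ?W i j))\<^sup>2) + (\<Sum>(i,j)\<in>G. (cmod (entry ?W i j))\<^sup>2)"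
        unfolding norm_sq_pairs [OF cW] using sub by (intro sum.subset_diff) auto
      also have "\<dots> \<le> \<zeta>\<^sup>2 * N + \<zeta>\<^sup>2 * N"
        using far P AB by (intro add_mono) (auto simp: fd)
      also have "\<dots> \<le> (2 * \<zeta> * sqrt N)\<^sup>2" by (simp add: power_mult_distrib)
      finally show "norm ?W \<le> 2 * \<zeta> * sqrt N" by (rule power2_le_imp_le) (use zeta in simp)
    qed
  qed
qed

lemma near_commutant_splits_family:
  assumes "finite T" and N: "N > 0" and eta: "\<eta> > 0" and th: "\<theta> > 0" and zeta: "\<zeta> > 0" and kap: "\<kappa> \<le> \<theta> * \<zeta> / 2"
    and l: "few_close_pairs N \<eta> \<theta> l"
    and Z: "\<And>A t. A \<in> \<Omega> \<Longrightarrow> t \<in> T \<Longrightarrow> corner N (Z t A)" "\<And>A t. A \<in> \<Omega> \<Longrightarrow> t \<in> T \<Longrightarrow> norm (Z t A) \<le> K * sqrt N"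
    and com: "\<And>A t. A \<in> \<Omega> \<Longrightarrow> t \<in> T \<Longrightarrow> norm (diag_fm N l * Z t A - Z t A * diag_fm N l) \<le> \<kappa> * sqrt N"
  shows "splits (exp (2 * \<eta> * (real N)\<^sup>2 * (4 * K\<^sup>2 / \<zeta>\<^sup>2 + 5)) ^ card T)
    (\<lambda>S. \<forall>A\<in>S. \<forall>B\<in>S. \<forall>t\<in>T. norm (Z t A - Z t B) \<le> 2 * \<zeta> * sqrt N) \<Omega>"
  using assms(1) Z com
proof (induction T)
  case empty
  show ?case by (rule splitsI [of "{\<Omega>}"]) auto
next
  case (insert t T)
  let ?c = "exp (2 * \<eta> * (real N)\<^sup>2 * (4 * K\<^sup>2 / \<zeta>\<^sup>2 + 5))"
  have "splits (?c ^ card T * ?c)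
    (\<lambda>S. \<forall>A\<in>S. \<forall>B\<in>S. \<forall>t\<in>insert t T. norm (Z t A - Z t B) \<le> 2 * \<zeta> * sqrt N) \<Omega>"
  proof (rule splits_trans)
    show "splits (?c ^ card T) (\<lambda>S. \<forall>A\<in>S. \<forall>B\<in>S. \<forall>t\<in>T. norm (Z t A - Z t B) \<le> 2 * \<zeta> * sqrt N) \<Omega>"
      using insert.prems by (intro insert.IH) auto
    fix S assume S: "S \<subseteq> \<Omega>" "\<forall>A\<in>S. \<forall>B\<in>S. \<forall>t\<in>T. norm (Z t A - Z t B) \<le> 2 * \<zeta> * sqrt N"
    have "splits ?c (\<lambda>S. \<forall>A\<in>S. \<forall>B\<in>S. norm (Z t A - Z t B) \<le> 2 * \<zeta> * sqrt N) S"
      using insert.prems S(1) by (intro near_commutant_splits [OF N eta th zeta kap l]) auto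
    then show "splits ?c (\<lambda>S. \<forall>A\<in>S. \<forall>B\<in>S. \<forall>t\<in>insert t T. norm (Z t A - Z t B) \<le> 2 * \<zeta> * sqrt N) S"
    proof (rule splits_mono)
      fix S' assume "S' \<subseteq> S" "\<forall>A\<in>S'. \<forall>B\<in>S'. norm (Z t A - Z t B) \<le> 2 * \<zeta> * sqrt N"
      then show "\<forall>A\<in>S'. \<forall>B\<in>S'. \<forall>t\<in>insert t T. norm (Z t A - Z t B) \<le> 2 * \<zeta> * sqrt N"
        using S(2) by blast
    qed simp
  qed simp
  then show ?case using insert by (simp add: mult.commute)
qed

lemma tame_mono: "tame K N Z \<Longrightarrow> K \<le> K' \<Longrightarrow> tame K' N Z"
  unfolding tame_def by (meson mult_right_mono order_trans real_sqrt_ge_zero of_nat_0_le_iff)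

text \<open>Nearly equal hermitians\<close>
lemma near_commutant_splits_close:
  assumes "finite T" and N: "N > 0" and eta: "\<eta> > 0" and th: "\<theta> > 0" and zeta: "\<zeta> > 0" and K: "K \<ge> 0"
    and kap: "\<kappa> + 2 * sqrt (2 * K * z) \<le> \<theta> * \<zeta> / 2"
    and D: "\<And>A. A \<in> \<Omega> \<Longrightarrow> tame K N (D A)" "\<And>A. A \<in> \<Omega> \<Longrightarrow> adj (D A) = D A" "\<And>A. A \<in> \<Omega> \<Longrightarrow> spread N \<eta> \<theta> (D A)"
      "\<And>A B. A \<in> \<Omega> \<Longrightarrow> B \<in> \<Omega> \<Longrightarrow> norm (D A - D B) \<le> z * sqrt N"
    and Z: "\<And>A t. A \<in> \<Omega> \<Longrightarrow> t \<in> T \<Longrightarrow> tame K N (Z t A)" "\<And>A t. A \<in> \<Omega> \<Longrightarrow> t \<in> T \<Longrightarrow> norm (Z t A) \<le> K1 * sqrt N"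
    and com: "\<And>A t. A \<in> \<Omega> \<Longrightarrow> t \<in> T \<Longrightarrow> norm (D A * Z t A - Z t A * D A) \<le> \<kappa> * sqrt N"
  shows "splits (exp (2 * \<eta> * (real N)\<^sup>2 * (4 * K1\<^sup>2 / \<zeta>\<^sup>2 + 5)) ^ card T)
    (\<lambda>S. \<forall>A\<in>S. \<forall>B\<in>S. \<forall>t\<in>T. norm (Z t A - Z t B) \<le> 2 * \<zeta> * sqrt N) \<Omega>"
proof (cases "\<Omega> = {}")
  case True
  show ?thesis by (rule splitsI [of "{}"]) (auto simp: True)
next
  case False
  then obtain R where R: "R \<in> \<Omega>" by auto
  have cR: "corner N (D R)" using D(1) [OF R] by (simp add: tame_def)
  obtain W l where W: "unitary N W" "cj W (D R) = diag_fm N l"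
    using spectral_theorem [OF cR D(2) [OF R]] unfolding cj_def by metis
  have l: "few_close_pairs N \<eta> \<theta> l" using D(3) [OF R] W by (auto simp: spread_def)
  have "splits (exp (2 * \<eta> * (real N)\<^sup>2 * (4 * K1\<^sup>2 / \<zeta>\<^sup>2 + 5)) ^ card T)
    (\<lambda>S. \<forall>A\<in>S. \<forall>B\<in>S. \<forall>t\<in>T. norm (cj W (Z t A) - cj W (Z t B)) \<le> 2 * \<zeta> * sqrt N) \<Omega>"
  proof (rule near_commutant_splits_family [OF assms(1) N eta th zeta kap l])
    fix A t assume A: "A \<in> \<Omega>" "t \<in> T"
    have tZ: "tame K N (Z t A)" using Z(1) A by blast
    have cZ: "corner N (Z t A)" using tZ by (simp add: tame_def)
    show "corner N (cj W (Z t A))" "norm (cj W (Z t A)) \<le> K1 * sqrt N"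
      using Z(2) [OF A] cZ W(1) by (simp_all add: norm_cj [OF W(1)])
    have "norm (D R * Z t A - Z t A * D R) = norm ((D A * Z t A - Z t A * D A) + (D R - D A) * Z t A - Z t A * (D R - D A))"
      by (simp add: algebra_simps)
    also have "\<dots> \<le> norm (D A * Z t A - Z t A * D A) + norm ((D R - D A) * Z t A) + norm (Z t A * (D R - D A))"
      by (meson add_mono norm_triangle_ineq norm_triangle_ineq4 order_refl order_trans)
    also have "\<dots> \<le> \<kappa> * sqrt N + sqrt (2 * K * z) * sqrt N + sqrt (2 * K * z) * sqrt N"
      using com [OF A] norm_diff_mult_tame [OF D(1) [OF R] D(1) [OF A(1)] tZ D(4) [OF R A(1)] K]
        norm_mult_diff_tame [OF D(1) [OF R] D(1) [OF A(1)] tZ D(4) [OF R A(1)] K] by linarith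
    also have "\<dots> = (\<kappa> + 2 * sqrt (2 * K * z)) * sqrt N" by (simp add: algebra_simps)
    finally have *: "norm (D R * Z t A - Z t A * D R) \<le> (\<kappa> + 2 * sqrt (2 * K * z)) * sqrt N" .
    have "diag_fm N l * cj W (Z t A) - cj W (Z t A) * diag_fm N l = cj W (D R * Z t A - Z t A * D R)"
      using cR cZ by (simp add: cj_simps cj_mult [OF W(1)] W(2))
    then show "norm (diag_fm N l * cj W (Z t A) - cj W (Z t A) * diag_fm N l) \<le> (\<kappa> + 2 * sqrt (2 * K * z)) * sqrt N"
      using * cR cZ by (simp add: norm_cj [OF W(1)])
  qed
  then show ?thesis
  proof (rule splits_mono)
    fix S assume S: "S \<subseteq> \<Omega>" and P: "\<forall>A\<in>S. \<forall>B\<in>S. \<forall>t\<in>T. norm (cj W (Z t A) - cj W (Z t B)) \<le> 2 * \<zeta> * sqrt N"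
    show "\<forall>A\<in>S. \<forall>B\<in>S. \<forall>t\<in>T. norm (Z t A - Z t B) \<le> 2 * \<zeta> * sqrt N"
    proof (intro ballI)
      fix A B t assume *: "A \<in> S" "B \<in> S" "t \<in> T"
      then have "corner N (Z t A)" "corner N (Z t B)" using Z(1) S by (auto simp: tame_def)
      then have "norm (Z t A - Z t B) = norm (cj W (Z t A) - cj W (Z t B))"
        by (simp add: norm_cj [OF W(1)] flip: cj_simps)
      then show "norm (Z t A - Z t B) \<le> 2 * \<zeta> * sqrt N" using P * by simp
    qed
  qed simp
qed

lemma hermitian_orbit_splits:
  assumes N: "N > 0" and z: "z > 0"
    and X: "\<And>A. A \<in> \<Omega> \<Longrightarrow> corner N (X A)" "\<And>A. A \<in> \<Omega> \<Longrightarrow> adj (X A) = X A" "\<And>A. A \<in> \<Omega> \<Longrightarrow> norm (X A) \<le> K * sqrt N"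
  obtains V where "\<And>A. A \<in> \<Omega> \<Longrightarrow> unitary N (V A)"
    "splits (exp (real N * (4 * K\<^sup>2 / z\<^sup>2 + 5))) (\<lambda>S. \<forall>A\<in>S. \<forall>B\<in>S. norm (cj (V A) (X A) - cj (V B) (X B)) \<le> z * sqrt N) \<Omega>"
proof -
  have "\<forall>A\<in>\<Omega>. \<exists>p. unitary N (fst p) \<and> cj (fst p) (X A) = diag_fm N (snd p)"
  proof
    fix A assume A: "A \<in> \<Omega>"
    obtain U l where "unitary N U" "adj U * X A * U = diag_fm N l"
      by (rule spectral_theorem [OF X(1) [OF A] X(2) [OF A]])
    then show "\<exists>p. unitary N (fst p) \<and> cj (fst p) (X A) = diag_fm N (snd p)"
      unfolding cj_def by (intro exI [of _ "(U, l)"]) simp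
  qed
  from bchoice [OF this] obtain p where p: "\<And>A. A \<in> \<Omega> \<Longrightarrow> unitary N (fst (p A)) \<and> cj (fst (p A)) (X A) = diag_fm N (snd (p A))"
    by blast
  define V where "V A = fst (p A)" for A
  define l where "l A = snd (p A)" for A
  have V: "unitary N (V A)" "cj (V A) (X A) = diag_fm N (l A)" if "A \<in> \<Omega>" for A
    using p [OF that] by (auto simp: V_def l_def)
  have nd: "(norm (diag_fm N m))\<^sup>2 = (\<Sum>i<N. (m i)\<^sup>2)" for m
    unfolding norm_sq_sum [OF corner_diag_fm]
  proof (intro sum.cong refl)
    fix i assume "i \<in> {..<N}"
    have "(\<Sum>j<N. (cmod (entry (diag_fm N m) i j))\<^sup>2) = (\<Sum>j<N. if j = i then (m i)\<^sup>2 else 0)"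
      using \<open>i \<in> {..<N}\<close> by (intro sum.cong) (auto simp: diag_fm_def entry_fm)
    then show "(\<Sum>j<N. (cmod (entry (diag_fm N m) i j))\<^sup>2) = (m i)\<^sup>2"
      using \<open>i \<in> {..<N}\<close> by simp
  qed
  have "splits (exp (real N * (4 * (K\<^sup>2 * N) / (z\<^sup>2 * N) + 5))) (\<lambda>S. \<forall>A\<in>S. \<forall>B\<in>S. (\<Sum>i<N. (l A i - l B i)\<^sup>2) \<le> z\<^sup>2 * N) \<Omega>"
  proof (rule splits_rounding)
    fix A assume A: "A \<in> \<Omega>"
    have "(\<Sum>i<N. (l A i)\<^sup>2) = (norm (cj (V A) (X A)))\<^sup>2"
      using V(2) [OF A] nd by simp
    also have "\<dots> \<le> (K * sqrt N)\<^sup>2"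
      using X [OF A] norm_cj [OF V(1) [OF A]] by (intro power_mono) auto
    finally show "(\<Sum>i<N. (l A i)\<^sup>2) \<le> K\<^sup>2 * N" by (simp add: power_mult_distrib)
  qed (use N z in auto)
  then have "splits (exp (real N * (4 * K\<^sup>2 / z\<^sup>2 + 5))) (\<lambda>S. \<forall>A\<in>S. \<forall>B\<in>S. norm (cj (V A) (X A) - cj (V B) (X B)) \<le> z * sqrt N) \<Omega>"
  proof (rule splits_mono)
    fix S assume S: "S \<subseteq> \<Omega>" and P: "\<forall>A\<in>S. \<forall>B\<in>S. (\<Sum>i<N. (l A i - l B i)\<^sup>2) \<le> z\<^sup>2 * N"
    show "\<forall>A\<in>S. \<forall>B\<in>S. norm (cj (V A) (X A) - cj (V B) (X B)) \<le> z * sqrt N"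
    proof (intro ballI)
      fix A B assume AB: "A \<in> S" "B \<in> S"
      then have "cj (V A) (X A) - cj (V B) (X B) = diag_fm N (\<lambda>i. l A i - l B i)"
      proof -
        have "cj (V A) (X A) = diag_fm N (l A)" "cj (V B) (X B) = diag_fm N (l B)"
          using AB S V(2) by blast+
        then show ?thesis
          by (simp add: fmat_eqI diag_fm_def entry_minus_aux entry_fm)
      qed
      then have "(norm (cj (V A) (X A) - cj (V B) (X B)))\<^sup>2 \<le> (z * sqrt N)\<^sup>2"
        using P AB by (simp add: nd power_mult_distrib)
      then show "norm (cj (V A) (X A) - cj (V B) (X B)) \<le> z * sqrt N"
        by (rule power2_le_imp_le) (use z in simp)
    qed
  qed (use N in simp)
  with V(1) that show thesis by blast
qed

theorem two_stage_splits:
  assumes N: "N > 0" and S: "finite S" and T: "finite T" and y: "y \<in> T" and K: "K2 \<ge> 0" "K2 \<le> K"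
    and pos: "\<eta> > 0" "\<theta>x > 0" "\<theta>y > 0" "\<zeta>x > 0" "\<zeta>y > 0" "z > 0"
    and kap: "\<kappa> + 2 * sqrt (2 * K * z) \<le> \<theta>x * \<zeta>y / 2" "\<kappa> + 2 * sqrt (2 * K2 * (2 * \<zeta>y)) \<le> \<theta>y * \<zeta>x / 2"
    and X: "\<And>A. A \<in> \<Omega> \<Longrightarrow> tame K N (X A)" "\<And>A. A \<in> \<Omega> \<Longrightarrow> adj (X A) = X A" "\<And>A. A \<in> \<Omega> \<Longrightarrow> spread N \<eta> \<theta>x (X A)"
    and Y: "\<And>A. A \<in> \<Omega> \<Longrightarrow> adj (Ys y A) = Ys y A" "\<And>A. A \<in> \<Omega> \<Longrightarrow> spread N \<eta>' \<theta>y (Ys y A)" "\<eta>' > 0"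
    and Ys: "\<And>A t. A \<in> \<Omega> \<Longrightarrow> t \<in> T \<Longrightarrow> tame K2 N (Ys t A)"
      "\<And>A t. A \<in> \<Omega> \<Longrightarrow> t \<in> T \<Longrightarrow> norm (X A * Ys t A - Ys t A * X A) \<le> \<kappa> * sqrt N"
    and Xs: "\<And>A s. A \<in> \<Omega> \<Longrightarrow> s \<in> S \<Longrightarrow> tame K2 N (Xs s A)" "\<And>A s. A \<in> \<Omega> \<Longrightarrow> s \<in> S \<Longrightarrow> norm (Xs s A) \<le> K0 * sqrt N"
      "\<And>A s. A \<in> \<Omega> \<Longrightarrow> s \<in> S \<Longrightarrow> norm (Ys y A * Xs s A - Xs s A * Ys y A) \<le> \<kappa> * sqrt N"
  shows "splits (exp (real N * (4 * K\<^sup>2 / z\<^sup>2 + 5)) * (exp (2 * \<eta> * (real N)\<^sup>2 * (4 * K2\<^sup>2 / \<zeta>y\<^sup>2 + 5)) ^ card T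
      * exp (2 * \<eta>' * (real N)\<^sup>2 * (4 * K0\<^sup>2 / \<zeta>x\<^sup>2 + 5)) ^ card S))
    (\<lambda>P. \<forall>A\<in>P. \<forall>B\<in>P. \<exists>U. unitary N U \<and>
      (\<forall>t\<in>T. norm (Ys t A - U * Ys t B * adj U) \<le> 2 * \<zeta>y * sqrt N) \<and>
      (\<forall>s\<in>S. norm (Xs s A - U * Xs s B * adj U) \<le> 2 * \<zeta>x * sqrt N)) \<Omega>"
proof -
  obtain V where V: "\<And>A. A \<in> \<Omega> \<Longrightarrow> unitary N (V A)"
    and sp: "splits (exp (real N * (4 * K\<^sup>2 / z\<^sup>2 + 5))) (\<lambda>S. \<forall>A\<in>S. \<forall>B\<in>S. norm (cj (V A) (X A) - cj (V B) (X B)) \<le> z * sqrt N) \<Omega>"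
    by (rule hermitian_orbit_splits [OF N pos(6), of \<Omega> X K]) (use X in \<open>auto simp: tame_def\<close>)
  have spread_cj: "spread N h th (cj (V A) Q)" if "spread N h th Q" "A \<in> \<Omega>" for h th Q A
    using that unitary_mult [OF V [OF that(2)]] by (auto simp: spread_def cj_cj)
  have com_cj: "norm (cj (V A) P * cj (V A) Q - cj (V A) Q * cj (V A) P) = norm (P * Q - Q * P)"
    if "corner N P" "corner N Q" "A \<in> \<Omega>" for P Q A
    using that V [OF that(3)] by (simp add: norm_cj [of N] flip: cj_simps cj_mult [of N])
  have K0: "K \<ge> 0" using K by simp
  have YK: "tame K N (Ys t A)" if "A \<in> \<Omega>" "t \<in> T" for A t using tame_mono [OF Ys(1) [OF that] K(2)] .
  have Yn: "norm (Ys t A) \<le> K2 * sqrt N" if "A \<in> \<Omega>" "t \<in> T" for A t using Ys(1) [OF that] by (simp add: tame_def)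
  have ncj: "norm (cj (V A) Q) = norm Q" if "corner N Q" "A \<in> \<Omega>" for Q A using norm_cj [OF V] that by blast
  have cY: "corner N (Ys t A)" if "A \<in> \<Omega>" "t \<in> T" for A t using Ys(1) [OF that] by (simp add: tame_def)
  have cX: "corner N (Xs t A)" if "A \<in> \<Omega>" "t \<in> S" for A t using Xs(1) [OF that] by (simp add: tame_def)
  have cX0: "corner N (X A)" if "A \<in> \<Omega>" for A using X(1) [OF that] by (simp add: tame_def)
  show ?thesis
  proof (rule splits_trans [OF sp])
    fix \<Omega>1 assume O1: "\<Omega>1 \<subseteq> \<Omega>" and P1: "\<forall>A\<in>\<Omega>1. \<forall>B\<in>\<Omega>1. norm (cj (V A) (X A) - cj (V B) (X B)) \<le> z * sqrt N"
    have in1: "A \<in> \<Omega>" if "A \<in> \<Omega>1" for A using that O1 by blast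
    have "splits (exp (2 * \<eta> * (real N)\<^sup>2 * (4 * K2\<^sup>2 / \<zeta>y\<^sup>2 + 5)) ^ card T)
      (\<lambda>S. \<forall>A\<in>S. \<forall>B\<in>S. \<forall>t\<in>T. norm (cj (V A) (Ys t A) - cj (V B) (Ys t B)) \<le> 2 * \<zeta>y * sqrt N) \<Omega>1"
      by (rule near_commutant_splits_close [where D = "\<lambda>A. cj (V A) (X A)", OF T N pos(1,2,5) K0 kap(1)])
        (use P1 X Ys in1 V in \<open>simp_all add: tame_cj spread_cj cj_simps com_cj cX0 cY YK Yn ncj\<close>)
    then show "splits (exp (2 * \<eta> * (real N)\<^sup>2 * (4 * K2\<^sup>2 / \<zeta>y\<^sup>2 + 5)) ^ card T
      * exp (2 * \<eta>' * (real N)\<^sup>2 * (4 * K0\<^sup>2 / \<zeta>x\<^sup>2 + 5)) ^ card S)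
    (\<lambda>P. \<forall>A\<in>P. \<forall>B\<in>P. \<exists>U. unitary N U \<and>
      (\<forall>t\<in>T. norm (Ys t A - U * Ys t B * adj U) \<le> 2 * \<zeta>y * sqrt N) \<and>
      (\<forall>s\<in>S. norm (Xs s A - U * Xs s B * adj U) \<le> 2 * \<zeta>x * sqrt N)) \<Omega>1"
    proof (rule splits_trans)
      fix \<Omega>2 assume O2: "\<Omega>2 \<subseteq> \<Omega>1" and P2: "\<forall>A\<in>\<Omega>2. \<forall>B\<in>\<Omega>2. \<forall>t\<in>T. norm (cj (V A) (Ys t A) - cj (V B) (Ys t B)) \<le> 2 * \<zeta>y * sqrt N"
      have in2: "A \<in> \<Omega>" if "A \<in> \<Omega>2" for A using that O2 in1 by blast
      have "splits (exp (2 * \<eta>' * (real N)\<^sup>2 * (4 * K0\<^sup>2 / \<zeta>x\<^sup>2 + 5)) ^ card S)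
        (\<lambda>P. \<forall>A\<in>P. \<forall>B\<in>P. \<forall>s\<in>S. norm (cj (V A) (Xs s A) - cj (V B) (Xs s B)) \<le> 2 * \<zeta>x * sqrt N) \<Omega>2"
        by (rule near_commutant_splits_close [where D = "\<lambda>A. cj (V A) (Ys y A)", OF S N Y(3) pos(3,4) K(1) kap(2)])
          (use P2 Y Ys Xs in2 V y in \<open>simp_all add: tame_cj spread_cj cj_simps com_cj cX cY ncj\<close>)
      then show "splits (exp (2 * \<eta>' * (real N)\<^sup>2 * (4 * K0\<^sup>2 / \<zeta>x\<^sup>2 + 5)) ^ card S)
        (\<lambda>P. \<forall>A\<in>P. \<forall>B\<in>P. \<exists>U. unitary N U \<and>
          (\<forall>t\<in>T. norm (Ys t A - U * Ys t B * adj U) \<le> 2 * \<zeta>y * sqrt N) \<and>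
          (\<forall>s\<in>S. norm (Xs s A - U * Xs s B * adj U) \<le> 2 * \<zeta>x * sqrt N)) \<Omega>2"
      proof (rule splits_mono)
        fix P assume P: "P \<subseteq> \<Omega>2" and P3: "\<forall>A\<in>P. \<forall>B\<in>P. \<forall>s\<in>S. norm (cj (V A) (Xs s A) - cj (V B) (Xs s B)) \<le> 2 * \<zeta>x * sqrt N"
        show "\<forall>A\<in>P. \<forall>B\<in>P. \<exists>U. unitary N U \<and>
          (\<forall>t\<in>T. norm (Ys t A - U * Ys t B * adj U) \<le> 2 * \<zeta>y * sqrt N) \<and>
          (\<forall>s\<in>S. norm (Xs s A - U * Xs s B * adj U) \<le> 2 * \<zeta>x * sqrt N)"
        proof (intro ballI)
          fix A B assume AB: "A \<in> P" "B \<in> P"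
          then have A: "A \<in> \<Omega>2" "A \<in> \<Omega>" and B: "B \<in> \<Omega>2" "B \<in> \<Omega>" using P in2 by auto
          define U where "U = V A * adj (V B)"
          have U: "unitary N U" unfolding U_def by (intro unitary_mult unitary_adj V A B)
          have UV: "adj U * V A = V B"
            using unitaryD(2) [OF V [OF A(2)]] one_fm_right [OF unitaryD(1) [OF V [OF B(2)]]]
            by (simp add: U_def adj_mult mult.assoc)
          have *: "norm (P - U * Q * adj U) = norm (cj (V A) P - cj (V B) Q)"
            if "corner N P" "corner N Q" for P Q
          proof -
            have "cj (V A) (U * Q * adj U) = cj (adj U * V A) Q"
              by (simp add: cj_def adj_mult mult.assoc)
            then have "cj (V A) P - cj (V B) Q = cj (V A) (P - U * Q * adj U)"
              by (simp add: cj_simps UV)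
            then show ?thesis
              using that unitaryD(1) [OF U] norm_cj [OF V [OF A(2)]] by simp
          qed
          show "\<exists>U. unitary N U \<and>
            (\<forall>t\<in>T. norm (Ys t A - U * Ys t B * adj U) \<le> 2 * \<zeta>y * sqrt N) \<and>
            (\<forall>s\<in>S. norm (Xs s A - U * Xs s B * adj U) \<le> 2 * \<zeta>x * sqrt N)"
            using U A B AB P2 P3 by (intro exI [of _ U]) (simp add: * cX cY)
        qed
      qed simp
    qed simp
  qed simp
qed


locale word_eval =
  fixes h :: "'i word \<Rightarrow> 'r::{ring, complex_vector}"
  assumes h_add: "h (v + w) = h v * h w"
    and scaleC_mult_left: "(c *\<^sub>C (x::'r)) * y = c *\<^sub>C (x * y)"
    and scaleC_mult_right: "(x::'r) * (c *\<^sub>C y) = c *\<^sub>C (x * y)"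
begin

definition ev :: "'i ncpoly \<Rightarrow> 'r"
  where "ev P = (\<Sum>w\<in>Poly_Mapping.keys P. Poly_Mapping.lookup P w *\<^sub>C h w)"

lemma zero_scaleC: "0 *\<^sub>C (x::'r) = 0"
  using scaleC_add_left [of 0 0 x] by simp

lemma ev_superset: "finite S \<Longrightarrow> Poly_Mapping.keys P \<subseteq> S \<Longrightarrow> ev P = (\<Sum>w\<in>S. Poly_Mapping.lookup P w *\<^sub>C h w)"
  unfolding ev_def by (rule sum.mono_neutral_left) (auto simp: zero_scaleC in_keys_iff)

lemma ev_add: "ev (P + Q) = ev P + ev Q"
proof -
  let ?S = "Poly_Mapping.keys P \<union> Poly_Mapping.keys Q"
  have "ev (P + Q) = (\<Sum>w\<in>?S. Poly_Mapping.lookup (P + Q) w *\<^sub>C h w)"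
    using Poly_Mapping.keys_add [of P Q] by (intro ev_superset) auto
  also have "\<dots> = ev P + ev Q"
    by (simp add: lookup_add scaleC_add_left sum.distrib ev_superset [of ?S P] ev_superset [of ?S Q])
  finally show ?thesis .
qed

lemma ev_zero [simp]: "ev 0 = 0" by (simp add: ev_def)

lemma ev_sum: "ev (sum f S) = (\<Sum>x\<in>S. ev (f x))"
  by (induction S rule: infinite_finite_induct) (simp_all add: ev_add)

lemma ev_single: "ev (Poly_Mapping.single w c) = c *\<^sub>C h w"
  by (cases "c = 0") (simp_all add: ev_def zero_scaleC)

lemma ev_scaleC: "ev (c *\<^sub>C P) = c *\<^sub>C ev P"
proof -
  have "ev (c *\<^sub>C P) = (\<Sum>w\<in>Poly_Mapping.keys P. Poly_Mapping.lookup (c *\<^sub>C P) w *\<^sub>C h w)"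
    by (rule ev_superset) (auto simp: in_keys_iff lookup_scaleC)
  also have "\<dots> = c *\<^sub>C ev P"
  proof -
    have "c *\<^sub>C (\<Sum>w\<in>S. f w) = (\<Sum>w\<in>S. c *\<^sub>C f w)" for S and f :: "'i word \<Rightarrow> 'r"
      by (induction S rule: infinite_finite_induct) (simp_all add: scaleC_add_right)
    then show ?thesis by (simp add: ev_def lookup_scaleC scaleC_complex_def scaleC_scaleC)
  qed
  finally show ?thesis .
qed

lemma ev_minus: "ev (- P) = - ev P"
  using ev_add [of P "- P"] by (simp add: minus_unique)

lemma ev_diff: "ev (P - Q) = ev P - ev Q"
  using ev_add [of P "- Q"] by (simp add: ev_minus)

lemma poly_single_sum: "P = (\<Sum>w\<in>Poly_Mapping.keys P. Poly_Mapping.single w (Poly_Mapping.lookup P w))" for P :: "'i ncpoly"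
  by (rule poly_mapping_eqI) (simp add: lookup_sum lookup_single when_def in_keys_iff sum.delta)

lemma ev_mult: "ev (P * Q) = ev P * ev Q"
proof -
  let ?s = Poly_Mapping.single let ?l = Poly_Mapping.lookup
  have "P * Q = (\<Sum>v\<in>Poly_Mapping.keys P. \<Sum>w\<in>Poly_Mapping.keys Q. ?s v (?l P v) * ?s w (?l Q w))"
    by (subst poly_single_sum [of P], subst poly_single_sum [of Q]) (rule sum_product)
  then have "ev (P * Q) = (\<Sum>v\<in>Poly_Mapping.keys P. \<Sum>w\<in>Poly_Mapping.keys Q. (?l P v * ?l Q w) *\<^sub>C (h v * h w))"
    by (simp add: ev_sum mult_single ev_single h_add)
  also have "\<dots> = (\<Sum>v\<in>Poly_Mapping.keys P. \<Sum>w\<in>Poly_Mapping.keys Q. (?l P v *\<^sub>C h v) * (?l Q w *\<^sub>C h w))"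
    by (simp add: scaleC_mult_left scaleC_mult_right scaleC_scaleC mult.commute)
  also have "\<dots> = ev P * ev Q" by (simp add: ev_def sum_product)
  finally show ?thesis .
qed

lemma ev_star:
  assumes "\<And>w. h (word_star w) = st (h w)" "\<And>x y. st (x + y) = st x + st y" "\<And>c x. st (c *\<^sub>C x) = cnj c *\<^sub>C st x"
  shows "ev (ncstar P) = st (ev P)"
proof -
  have "st 0 = 0" using assms(2) [of 0 0] by simp
  then have "st (sum f S) = (\<Sum>x\<in>S. st (f x))" for f :: "'i word \<Rightarrow> 'r" and S
    by (induction S rule: infinite_finite_induct) (simp_all add: assms(2))
  then show ?thesis by (simp add: ncstar_def ev_sum ev_single assms ev_def [of P])
qed

lemma ev_one: "ev 1 = h 0"
  using ev_single [of 0 1] by (simp add: scaleC_one)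

end

text \<open>C*-algebra evaluation\<close>

lemma star_one [simp]: "(1 :: 'a::cstar_algebra)\<^sup>\<star> = 1"
  using star_mult [of "(1::'a)\<^sup>\<star>" 1] by (simp add: star_star)

lemma eval_letter_star: "eval_letter a (letter_star l) = (eval_letter a l)\<^sup>\<star>"
  by (cases l) (simp_all add: star_star)

lemma prod_list_star: "prod_list (rev (map (\<lambda>l. (f l)\<^sup>\<star>) xs)) = (prod_list (map f xs))\<^sup>\<star>"
  for f :: "'l \<Rightarrow> 'a::cstar_algebra"
  by (induction xs) (simp_all add: star_mult)

interpretation cstar_eval: word_eval "\<lambda>w. prod_list (map (eval_letter a) (letters w))"
  rewrites "word_eval.ev (\<lambda>w. prod_list (map (eval_letter a) (letters w))) = nceval a"
  for a :: "'i \<Rightarrow> 'a::cstar_algebra"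
proof -
  show *: "word_eval (\<lambda>w. prod_list (map (eval_letter a) (letters w)))"
    by standard (simp_all add: plus_word_def mult_scaleC_left mult_scaleC_right)
  show "word_eval.ev (\<lambda>w. prod_list (map (eval_letter a) (letters w))) = nceval a"
    by (rule ext) (simp add: word_eval.ev_def [OF *] nceval_def)
qed

lemma nceval_star: "nceval a (ncstar P) = (nceval a P)\<^sup>\<star>"
  by (rule cstar_eval.ev_star)
    (simp_all add: word_star_def rev_map eval_letter_star comp_def prod_list_star [symmetric] star_add star_scaleC)

lemma nceval_one: "nceval a 1 = 1"
  by (simp add: cstar_eval.ev_one zero_word_def)

lemma nceval_power: "nceval a (P ^ k) = nceval a P ^ k"
  by (induction k) (simp_all add: nceval_one cstar_eval.ev_mult)

text \<open>matrix evaluation\<close>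

definition of_mat :: "nat \<Rightarrow> complex mat \<Rightarrow> fmat"
  where "of_mat N M = fm N (\<lambda>i j. M $$ (i, j))"

lemma corner_of_mat [simp]: "corner N (of_mat N M)" by (simp add: of_mat_def)

lemma mat_adjoint_index: "A \<in> carrier_mat n m \<Longrightarrow> i < m \<Longrightarrow> j < n \<Longrightarrow> mat_adjoint A $$ (i, j) = cnj (A $$ (j, i))"
  by (simp add: mat_adjoint_def mat_of_rows_def)

lemma mat_adjoint_carrier [simp]: "A \<in> carrier_mat n m \<Longrightarrow> mat_adjoint A \<in> carrier_mat m n"
  by (auto simp: mat_adjoint_def)

lemma of_mat_adjoint: "A \<in> carrier_mat N N \<Longrightarrow> of_mat N (mat_adjoint A) = adj (of_mat N A)"
  by (rule fmat_eqI) (auto simp: of_mat_def entry_fm entry_adj mat_adjoint_index)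

lemma of_mat_mult:
  assumes "A \<in> carrier_mat N N" "B \<in> carrier_mat N N"
  shows "of_mat N (A * B) = of_mat N A * of_mat N B"
  by (rule fmat_eq_cornerI [of N])
    (use assms in \<open>auto simp: entry_times [of N] of_mat_def entry_fm scalar_prod_def lessThan_atLeast0\<close>)

lemma of_mat_minus:
  assumes "A \<in> carrier_mat N N" "B \<in> carrier_mat N N"
  shows "of_mat N (A - B) = of_mat N A - of_mat N B"
  by (rule fmat_eqI) (use assms in \<open>auto simp: of_mat_def entry_fm entry_minus_aux\<close>)

lemma of_mat_one: "of_mat N (1\<^sub>m N) = one_fm N"
  by (rule fmat_eqI) (auto simp: of_mat_def one_fm_def entry_fm)

lemma of_mat_inject:
  assumes "A \<in> carrier_mat N N" "B \<in> carrier_mat N N" "of_mat N A = of_mat N B"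
  shows "A = B"
proof (rule eq_matI)
  fix i j assume "i < dim_row B" "j < dim_col B"
  then show "A $$ (i, j) = B $$ (i, j)"
    using arg_cong [OF assms(3), of "\<lambda>Z. entry Z i j"] assms(2) by (simp add: of_mat_def entry_fm)
qed (use assms in auto)

lemma of_mat_surj:
  assumes "corner N A"
  shows "of_mat N (Matrix.mat N N (\<lambda>(i, j). entry A i j)) = A"
  by (rule fmat_eq_cornerI [OF _ assms]) (auto simp: of_mat_def entry_fm)

lemma unitary_of_mat:
  assumes "unitary N (of_mat N U)" "U \<in> carrier_mat N N"
  shows "U \<in> unitary_mats N"
proof -
  have "mat_adjoint U * U = 1\<^sub>m N" "U * mat_adjoint U = 1\<^sub>m N"
    using assms by (auto intro!: of_mat_inject [of _ N] mult_carrier_mat [of _ N N _ N] simp: of_mat_mult [of _ N] of_mat_adjoint of_mat_one unitary_def)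
  then show ?thesis using assms(2) by (simp add: unitary_mats_def)
qed

lemma mat_trace_of_mat: "A \<in> carrier_mat N N \<Longrightarrow> mat_trace A = tr (of_mat N A)"
  by (simp add: mat_trace_def tr_corner [of N] of_mat_def entry_fm)

lemma mat_norm2_of_mat:
  assumes "A \<in> carrier_mat N N"
  shows "mat_norm2 A = norm (of_mat N A) / sqrt N"
proof -
  have "Re (mat_trace (mat_adjoint A * A)) = (norm (of_mat N A))\<^sup>2"
    using assms by (simp add: mat_trace_of_mat [of _ N] mult_carrier_mat [of _ N N _ N] of_mat_mult of_mat_adjoint norm_sq_tr)
  then show ?thesis using assms by (simp add: mat_norm2_def real_sqrt_divide)
qed

definition mat_word :: "nat \<Rightarrow> ('i \<Rightarrow> complex mat) \<Rightarrow> 'i word \<Rightarrow> fmat"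
  where "mat_word N A w = foldr (\<lambda>l M. of_mat N (mat_eval_letter A l) * M) (letters w) (one_fm N)"

definition mat_ev :: "nat \<Rightarrow> ('i \<Rightarrow> complex mat) \<Rightarrow> 'i ncpoly \<Rightarrow> fmat"
  where "mat_ev N A P = (\<Sum>w\<in>Poly_Mapping.keys P. Poly_Mapping.lookup P w *\<^sub>C mat_word N A w)"

lemma foldr_corner:
  "corner N (foldr (\<lambda>l M. of_mat N (f l) * M) xs (one_fm N))"
  by (induction xs) simp_all

lemma foldr_one:
  assumes "corner N M"
  shows "foldr (\<lambda>l M. of_mat N (f l) * M) xs M = foldr (\<lambda>l M. of_mat N (f l) * M) xs (one_fm N) * M"
  by (induction xs) (simp_all add: assms one_fm_left mult.assoc)

lemma corner_mat_word [simp]: "corner N (mat_word N A w)"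
  by (simp add: mat_word_def foldr_corner)

interpretation mat_eval: word_eval "mat_word N A"
  rewrites "word_eval.ev (mat_word N A) = mat_ev N A"
  for N :: nat and A :: "'i \<Rightarrow> complex mat"
proof -
  have "mat_word N A (v + w) = mat_word N A v * mat_word N A w" for v w
    by (simp add: mat_word_def plus_word_def foldr_one [OF foldr_corner])
  note h = this
  show *: "word_eval (mat_word N A)"
    by standard (simp_all add: h fmat_scaleC_left fmat_scaleC_right)
  show "word_eval.ev (mat_word N A) = mat_ev N A"
    by (rule ext) (simp add: word_eval.ev_def [OF *] mat_ev_def)
qed

lemma corner_sum: "(\<And>x. x \<in> S \<Longrightarrow> corner N (f x)) \<Longrightarrow> corner N (sum f S)"
  by (induction S rule: infinite_finite_induct) simp_all

lemma corner_mat_ev [simp]: "corner N (mat_ev N A P)"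
  by (auto simp: mat_ev_def intro!: corner_sum)

lemma mat_ev_one: "mat_ev N A 1 = one_fm N"
  by (simp add: mat_eval.ev_one mat_word_def zero_word_def)

lemma mat_word_star:
  assumes "\<And>i. A i \<in> carrier_mat N N"
  shows "mat_word N A (word_star w) = adj (mat_word N A w)"
proof -
  have l: "of_mat N (mat_eval_letter A (letter_star l)) = adj (of_mat N (mat_eval_letter A l))" for l
    by (cases l) (simp_all add: of_mat_adjoint [OF assms])
  have "foldr (\<lambda>l M. of_mat N (mat_eval_letter A l) * M) (rev (map letter_star xs)) (one_fm N)
    = adj (foldr (\<lambda>l M. of_mat N (mat_eval_letter A l) * M) xs (one_fm N))" for xs
  proof (induction xs)
    case (Cons x xs)
    have "foldr (\<lambda>l M. of_mat N (mat_eval_letter A l) * M) (rev (map letter_star (x # xs))) (one_fm N)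
      = foldr (\<lambda>l M. of_mat N (mat_eval_letter A l) * M) (rev (map letter_star xs)) (of_mat N (mat_eval_letter A (letter_star x)))"
      by (simp add: one_fm_right)
    also have "\<dots> = adj (foldr (\<lambda>l M. of_mat N (mat_eval_letter A l) * M) xs (one_fm N)) * adj (of_mat N (mat_eval_letter A x))"
      unfolding Cons.IH [symmetric] l [symmetric] by (rule foldr_one) simp
    finally show ?case by (simp add: adj_mult)
  qed simp
  then show ?thesis by (simp add: mat_word_def word_star_def)
qed

lemma mat_ev_star: "(\<And>i. A i \<in> carrier_mat N N) \<Longrightarrow> mat_ev N A (ncstar P) = adj (mat_ev N A P)"
  by (rule mat_eval.ev_star) (simp_all add: mat_word_star adj_add adj_scaleC)

lemma mat_law_ev:
  assumes "\<And>i. A i \<in> carrier_mat N N"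
  shows "mat_law N A P = tr (mat_ev N A P) / of_nat N"
proof -
  have lc: "mat_eval_letter A l \<in> carrier_mat N N" for l by (cases l) (simp_all add: assms)
  have "foldr (\<lambda>l M. mat_eval_letter A l * M) xs (1\<^sub>m N) \<in> carrier_mat N N \<and>
    of_mat N (foldr (\<lambda>l M. mat_eval_letter A l * M) xs (1\<^sub>m N)) = foldr (\<lambda>l M. of_mat N (mat_eval_letter A l) * M) xs (one_fm N)" for xs
    by (induction xs) (auto simp: of_mat_one of_mat_mult lc intro!: mult_carrier_mat [OF lc])
  then have w: "of_mat N (mat_eval_word N A w) = mat_word N A w" for w
    by (simp add: mat_eval_word_def mat_word_def)
  have e: "entry (mat_word N A w) i j = mat_eval_word N A w $$ (i, j)" if "i < N" "j < N" for i j w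
    using that by (simp add: of_mat_def entry_fm flip: w)
  have sum_entry: "entry (sum f S) i j = (\<Sum>x\<in>S. entry (f x) i j)" for f :: "'i word \<Rightarrow> fmat" and S i j
    by (induction S rule: infinite_finite_induct) (simp_all add: fmat_entry)
  have "of_mat N (mat_nceval N A P) = mat_ev N A P"
    by (rule fmat_eq_cornerI [of N])
      (simp_all add: mat_nceval_def of_mat_def entry_fm mat_ev_def sum_entry fmat_entry e corner_sum)
  then have "mat_trace (mat_nceval N A P) = tr (mat_ev N A P)"
    by (subst mat_trace_of_mat [of _ N]) (simp_all add: mat_nceval_def)
  then show ?thesis by (simp add: mat_law_def)
qed

lemma mat_ev_var: 
  assumes "\<And>i. A i \<in> carrier_mat N N"
  shows "mat_ev N A (ncvar i) = of_mat N (A i)"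
  by (simp add: ncvar_def mat_eval.ev_single mat_word_def one_fm_right scaleC_one)

lemma nceval_var: "nceval a (ncvar i) = a i"
  by (simp add: ncvar_def cstar_eval.ev_single scaleC_one)


definition bump :: "real \<Rightarrow> real \<Rightarrow> nat \<Rightarrow> 'r::{ring_1, complex_vector} \<Rightarrow> 'r"
  where "bump c t m x = (1 - complex_of_real (1 / c) *\<^sub>C ((x - complex_of_real t *\<^sub>C 1) * (x - complex_of_real t *\<^sub>C 1))) ^ m"

lemma nceval_bump: "nceval a (bump c t m P) = bump c t m (nceval a P)"
  by (simp add: bump_def nceval_power cstar_eval.ev_diff cstar_eval.ev_scaleC cstar_eval.ev_mult nceval_one)

lemma diag_fm_arith:
  "diag_fm n f - diag_fm n g = diag_fm n (\<lambda>i. f i - g i)"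
  "complex_of_real c *\<^sub>C diag_fm n f = diag_fm n (\<lambda>i. c * f i)"
  "diag_fm n f * diag_fm n g = diag_fm n (\<lambda>i. f i * g i)"
  "one_fm n = diag_fm n (\<lambda>i. 1)"
proof -
  show "diag_fm n f - diag_fm n g = diag_fm n (\<lambda>i. f i - g i)"
    by (rule fmat_eqI) (simp add: diag_fm_def entry_fm fmat_entry)
  show "complex_of_real c *\<^sub>C diag_fm n f = diag_fm n (\<lambda>i. c * f i)"
    by (rule fmat_eqI) (simp add: diag_fm_def entry_fm fmat_entry)
  show "one_fm n = diag_fm n (\<lambda>i. 1)" 
    by (rule fmat_eqI) (simp add: one_fm_def diag_fm_def entry_fm)
  show "diag_fm n f * diag_fm n g = diag_fm n (\<lambda>i. f i * g i)"
  proof (rule fmat_eq_cornerI [of n])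
    fix i j assume ij: "i < n" "j < n"
    have "entry (diag_fm n f * diag_fm n g) i j
      = (\<Sum>k<n. if k = i then (if i = j then complex_of_real (f i * g i) else 0) else 0)"
      unfolding entry_times [OF corner_diag_fm]
      by (intro sum.cong refl) (use ij in \<open>auto simp: diag_fm_def entry_fm\<close>)
    then show "entry (diag_fm n f * diag_fm n g) i j = entry (diag_fm n (\<lambda>i. f i * g i)) i j"
      using ij by (simp add: diag_fm_def entry_fm)
  qed simp_all
qed

lemma tr_diag_fm: "tr (diag_fm n f) = complex_of_real (\<Sum>i<n. f i)"
  by (simp add: tr_corner [of n] diag_fm_def entry_fm)

lemma tr_cj: "unitary n U \<Longrightarrow> corner n A \<Longrightarrow> tr (cj U A) = tr A"
  using tr_commute [of "adj U" "A * U"] by (simp add: cj_def mult.assoc unitaryD(3) one_fm_right)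

lemma cj_mat_ev:
  assumes U: "unitary N U" and d: "cj U (mat_ev N A P) = diag_fm N l"
  shows "cj U (mat_ev N A (P ^ k)) = diag_fm N (\<lambda>i. l i ^ k)"
    "cj U (mat_ev N A (bump c t m P)) = diag_fm N (\<lambda>i. (1 - (l i - t)\<^sup>2 / c) ^ m)"
proof -
  have one: "cj U (mat_ev N A 1) = diag_fm N (\<lambda>i. 1)"
    using U by (simp add: mat_ev_one cj_def unitaryD one_fm_right flip: diag_fm_arith(4))
  have sc: "cj U (c *\<^sub>C Z) = c *\<^sub>C cj U Z" for c Z
    by (simp add: cj_def fmat_scaleC_left fmat_scaleC_right)
  have pow: "cj U (mat_ev N A (Q ^ k)) = diag_fm N (\<lambda>i. f i ^ k)" if "cj U (mat_ev N A Q) = diag_fm N f" for Q f k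
    by (induction k) (simp_all add: one mat_eval.ev_mult cj_mult [OF U] that diag_fm_arith(3))
  show "cj U (mat_ev N A (P ^ k)) = diag_fm N (\<lambda>i. l i ^ k)" by (rule pow) fact
  show "cj U (mat_ev N A (bump c t m P)) = diag_fm N (\<lambda>i. (1 - (l i - t)\<^sup>2 / c) ^ m)"
    unfolding bump_def
    by (rule pow)
      (simp add: mat_eval.ev_diff mat_eval.ev_scaleC mat_eval.ev_mult cj_simps sc cj_mult [OF U] one d
        diag_fm_arith(1-3) diag_fm_arith(2) [of "1 / c", simplified] power2_eq_square)
qed

lemma few_close_pairs_of_moments:
  fixes l :: "nat \<Rightarrow> real"
  assumes th: "\<theta> > 0" "8 * real m * \<theta>\<^sup>2 \<le> c" "c \<ge> 4 * \<theta>\<^sup>2" and c: "c > 0" and m: "even m" and R: "R > 0"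
    and T: "\<And>s. \<bar>s\<bar> \<le> R \<Longrightarrow> \<exists>t\<in>T. \<bar>s - t\<bar> \<le> \<theta>"
    and bump: "\<And>t. t \<in> T \<Longrightarrow> (\<Sum>i<N. (1 - (l i - t)\<^sup>2 / c) ^ m) \<le> \<eta> * N"
    and tail: "(\<Sum>i<N. l i ^ (2 * p)) \<le> \<eta> * R ^ (2 * p) * N"
  shows "few_close_pairs N (3 * \<eta>) \<theta> l"
proof -
  have row: "real (card {j. j < N \<and> \<bar>s - l j\<bar> < \<theta>}) \<le> 2 * \<eta> * N" if s: "\<bar>s\<bar> \<le> R" for s
  proof -
    obtain t where t: "t \<in> T" "\<bar>s - t\<bar> \<le> \<theta>" using T [OF s] by blast
    have half: "1 / 2 \<le> (1 - (l j - t)\<^sup>2 / c) ^ m" if "\<bar>s - l j\<bar> < \<theta>" for j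
    proof -
      have "\<bar>l j - t\<bar> \<le> 2 * \<theta>" using that t by linarith
      then have "(l j - t)\<^sup>2 \<le> 4 * \<theta>\<^sup>2" using power_mono [of "\<bar>l j - t\<bar>" "2 * \<theta>" 2] by (simp add: power_mult_distrib)
      then have le: "(l j - t)\<^sup>2 / c \<le> 4 * \<theta>\<^sup>2 / c" using c by (simp add: divide_right_mono)
      define u where "u = 4 * \<theta>\<^sup>2 / c"
      have u: "0 \<le> u" "u \<le> 1" "real m * u \<le> 1 / 2"
        using th(2,3) c by (auto simp: u_def divide_le_eq)
      have "1 / 2 \<le> 1 + real m * (- u)" using u(3) by simp
      also have "\<dots> \<le> (1 + (- u)) ^ m" using u(2) by (intro Bernoulli_inequality) simp
      also have "\<dots> \<le> (1 - (l j - t)\<^sup>2 / c) ^ m" using le u(2) unfolding u_def [symmetric] by (intro power_mono) linarith+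
      finally show ?thesis .
    qed
    have "real (card {j. j < N \<and> \<bar>s - l j\<bar> < \<theta>}) * (1 / 2) \<le> (\<Sum>j | j < N \<and> \<bar>s - l j\<bar> < \<theta>. (1 - (l j - t)\<^sup>2 / c) ^ m)"
      using half by (intro sum_bounded_below) auto
    also have "\<dots> \<le> (\<Sum>j<N. (1 - (l j - t)\<^sup>2 / c) ^ m)"
      using m by (intro sum_mono2) (auto simp: zero_le_even_power)
    also have "\<dots> \<le> \<eta> * N" by (rule bump) fact
    finally show ?thesis by simp
  qed
  define Bad where "Bad = {i. i < N \<and> R < \<bar>l i\<bar>}"
  have "real (card Bad) * R ^ (2 * p) \<le> (\<Sum>i\<in>Bad. l i ^ (2 * p))"
  proof (rule sum_bounded_below)
    fix i assume "i \<in> Bad"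
    then have "R ^ (2 * p) \<le> \<bar>l i\<bar> ^ (2 * p)" using R by (intro power_mono) (auto simp: Bad_def)
    then show "R ^ (2 * p) \<le> l i ^ (2 * p)" by (simp add: power_even_abs)
  qed
  also have "\<dots> \<le> (\<Sum>i<N. l i ^ (2 * p))"
    by (intro sum_mono2) (auto simp: Bad_def)
  also have "\<dots> \<le> (\<eta> * N) * R ^ (2 * p)" using tail by (simp add: mult_ac)
  finally have bad: "real (card Bad) \<le> \<eta> * N" using R by simp
  let ?row = "\<lambda>i. {j. j < N \<and> \<bar>l i - l j\<bar> < \<theta>}"
  have eq: "{(i, j). i < N \<and> j < N \<and> \<bar>l i - l j\<bar> < \<theta>} = Sigma {..<N} ?row" by auto
  have "card (Sigma {..<N} ?row) = (\<Sum>i<N. card (?row i))" by (rule card_SigmaI) auto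
  then have "real (card {(i, j). i < N \<and> j < N \<and> \<bar>l i - l j\<bar> < \<theta>}) = (\<Sum>i<N. real (card (?row i)))"
    unfolding eq by simp
  also have "\<dots> = (\<Sum>i\<in>{..<N}-Bad. real (card (?row i))) + (\<Sum>i\<in>Bad. real (card (?row i)))"
    by (rule sum.subset_diff) (auto simp: Bad_def)
  also have "\<dots> \<le> (\<Sum>i\<in>{..<N}-Bad. 2 * \<eta> * N) + (\<Sum>i\<in>Bad. real N)"
  proof (intro add_mono sum_mono)
    fix i assume "i \<in> {..<N}-Bad"
    then show "real (card (?row i)) \<le> 2 * \<eta> * N" by (intro row) (auto simp: Bad_def)
  next
    fix i
    have "card (?row i) \<le> card {..<N}" by (rule card_mono) auto
    then show "real (card (?row i)) \<le> real N" by simp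
  qed
  also have "\<dots> \<le> N * (2 * \<eta> * N) + (\<eta> * N) * N"
  proof -
    have "0 \<le> \<eta> * N" using bad by linarith
    moreover have "real (card ({..<N}-Bad)) \<le> real N" using card_mono [of "{..<N}" "{..<N}-Bad"] by auto
    ultimately have "real (card ({..<N}-Bad)) * (2 * (\<eta> * N)) \<le> N * (2 * (\<eta> * N))" by (intro mult_right_mono) auto
    moreover have "real (card Bad) * N \<le> (\<eta> * N) * N" using bad by (intro mult_right_mono) auto
    ultimately show ?thesis by (simp add: mult_ac)
  qed
  also have "\<dots> = 3 * \<eta> * (real N)\<^sup>2" by (simp add: power2_eq_square)
  finally show ?thesis by (simp add: few_close_pairs_def)
qed


lemma scaleC_simps: "0 *\<^sub>C x = (0 :: 'a::complex_vector)" "(- c) *\<^sub>C x = - (c *\<^sub>C x)" "(- 1) *\<^sub>C x = - x"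
  "c *\<^sub>C (- x) = - (c *\<^sub>C x)" "c *\<^sub>C (x - y) = c *\<^sub>C x - c *\<^sub>C y" "(c - d) *\<^sub>C x = c *\<^sub>C x - d *\<^sub>C x"
proof -
  show 0: "0 *\<^sub>C x = 0" using scaleC_add_left [of 0 0 x] by simp
  show m: "(- c) *\<^sub>C x = - (c *\<^sub>C x)" for c x
    using scaleC_add_left [of c "- c" x] scaleC_add_left [of 0 0 x] by (simp add: minus_unique)
  show "(- 1) *\<^sub>C x = - x" using m [of 1] by (simp add: scaleC_one)
  show m2: "c *\<^sub>C (- x) = - (c *\<^sub>C x)" for c x
    using scaleC_add_right [of c x "- x"] by (simp add: minus_unique)
  show "c *\<^sub>C (x - y) = c *\<^sub>C x - c *\<^sub>C y"
    using scaleC_add_right [of c x "- y"] m2 by simp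
  show "(c - d) *\<^sub>C x = c *\<^sub>C x - d *\<^sub>C x"
    using scaleC_add_left [of c "- d" x] m by simp
qed

locale semi_inner =
  fixes V :: "'v::complex_vector set" and ip :: "'v \<Rightarrow> 'v \<Rightarrow> complex"
  assumes zero_mem: "0 \<in> V"
    and add_mem: "x \<in> V \<Longrightarrow> y \<in> V \<Longrightarrow> x + y \<in> V"
    and scale_mem: "x \<in> V \<Longrightarrow> c *\<^sub>C x \<in> V"
    and herm: "x \<in> V \<Longrightarrow> y \<in> V \<Longrightarrow> ip y x = cnj (ip x y)"
    and add_right: "x \<in> V \<Longrightarrow> y \<in> V \<Longrightarrow> z \<in> V \<Longrightarrow> ip x (y + z) = ip x y + ip x z"
    and scale_right: "x \<in> V \<Longrightarrow> y \<in> V \<Longrightarrow> ip x (c *\<^sub>C y) = c * ip x y"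
    and pos: "x \<in> V \<Longrightarrow> ip x x \<in> \<real>\<^sub>\<ge>\<^sub>0"
begin

definition sn :: "'v \<Rightarrow> real" where "sn x = sqrt (Re (ip x x))"

lemma minus_mem: "x \<in> V \<Longrightarrow> - x \<in> V"
  using scale_mem [of x "- 1"] by (simp add: scaleC_simps scaleC_one)

lemma diff_mem: "x \<in> V \<Longrightarrow> y \<in> V \<Longrightarrow> x - y \<in> V"
  using add_mem [of x "- y"] minus_mem [of y] by simp

lemma minus_right: "x \<in> V \<Longrightarrow> y \<in> V \<Longrightarrow> ip x (- y) = - ip x y"
  using scale_right [of x y "- 1"] by (simp add: scaleC_simps scaleC_one)

lemma diff_right: "x \<in> V \<Longrightarrow> y \<in> V \<Longrightarrow> z \<in> V \<Longrightarrow> ip x (y - z) = ip x y - ip x z"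
  using add_right [of x y "- z"] minus_right [of x z] minus_mem [of z] by simp

lemma add_left: "x \<in> V \<Longrightarrow> y \<in> V \<Longrightarrow> z \<in> V \<Longrightarrow> ip (x + y) z = ip x z + ip y z"
  using herm [of z "x + y"] herm [of z x] herm [of z y] by (simp add: add_right add_mem)

lemma diff_left: "x \<in> V \<Longrightarrow> y \<in> V \<Longrightarrow> z \<in> V \<Longrightarrow> ip (x - y) z = ip x z - ip y z"
  using herm [of z "x - y"] herm [of z x] herm [of z y] by (simp add: diff_right diff_mem)

lemma scale_left: "x \<in> V \<Longrightarrow> y \<in> V \<Longrightarrow> ip (c *\<^sub>C x) y = cnj c * ip x y"
  using herm [of y "c *\<^sub>C x"] herm [of y x] by (simp add: scale_right scale_mem)

lemma zero_right: "x \<in> V \<Longrightarrow> ip x 0 = 0"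
  using add_right [of x 0 0] zero_mem by simp

lemma zero_left: "x \<in> V \<Longrightarrow> ip 0 x = 0"
  using add_left [of 0 0 x] zero_mem by simp

lemma ip_self: "x \<in> V \<Longrightarrow> ip x x = complex_of_real ((sn x)\<^sup>2)"
  using pos [of x] by (auto simp: sn_def complex_nonneg_Reals_iff complex_eq_iff)

lemma sn_nonneg: "x \<in> V \<Longrightarrow> 0 \<le> sn x"
  using pos [of x] by (simp add: sn_def complex_nonneg_Reals_iff)

lemma sn_sq: "x \<in> V \<Longrightarrow> (sn x)\<^sup>2 = Re (ip x x)"
  using pos [of x] by (simp add: sn_def complex_nonneg_Reals_iff)

lemma sn_zero [simp]: "sn 0 = 0"
  using zero_right [OF zero_mem] by (simp add: sn_def)

lemma sn_scale: "x \<in> V \<Longrightarrow> sn (c *\<^sub>C x) = cmod c * sn x"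
proof -
  assume x: "x \<in> V"
  have "ip (c *\<^sub>C x) (c *\<^sub>C x) = (c * cnj c) * ip x x"
    using x by (simp add: scale_left scale_right scale_mem)
  also have "\<dots> = complex_of_real ((cmod c)\<^sup>2 * (sn x)\<^sup>2)"
    using ip_self [OF x] by (simp add: complex_norm_square [symmetric] del: of_real_power)
  finally show ?thesis using sn_nonneg [OF x] by (simp add: sn_def [of "c *\<^sub>C x"] real_sqrt_mult)
qed

lemma sn_minus: "x \<in> V \<Longrightarrow> sn (- x) = sn x"
  using sn_scale [of x "- 1"] by (simp add: scaleC_simps scaleC_one)

lemma sn_diff_sq: "x \<in> V \<Longrightarrow> y \<in> V \<Longrightarrow> (sn (x - y))\<^sup>2 = (sn x)\<^sup>2 - 2 * Re (ip x y) + (sn y)\<^sup>2"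
  using herm [of x y] by (simp add: sn_sq diff_mem diff_left diff_right)

lemma sn_add_sq: "x \<in> V \<Longrightarrow> y \<in> V \<Longrightarrow> (sn (x + y))\<^sup>2 = (sn x)\<^sup>2 + 2 * Re (ip x y) + (sn y)\<^sup>2"
  using herm [of x y] by (simp add: sn_sq add_mem add_left add_right)

lemma Re_ip_le: "x \<in> V \<Longrightarrow> y \<in> V \<Longrightarrow> Re (ip x y) \<le> sn x * sn y"
proof -
  assume x: "x \<in> V" and y: "y \<in> V"
  define s where "s = complex_of_real (sn y)" define t where "t = complex_of_real (sn x)"
  have "0 \<le> (sn (s *\<^sub>C x - t *\<^sub>C y))\<^sup>2" by simp
  also have "\<dots> = (sn y * sn x)\<^sup>2 - 2 * (sn y * sn x * Re (ip x y)) + (sn x * sn y)\<^sup>2"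
    using x y sn_nonneg by (simp add: sn_diff_sq scale_mem sn_scale scale_left scale_right s_def t_def)
  finally have *: "(sn x * sn y) * Re (ip x y) \<le> (sn x * sn y) * (sn x * sn y)"
    by (simp add: power2_eq_square mult_ac)
  show ?thesis
  proof (cases "sn x * sn y = 0")
    case False
    then show ?thesis using * sn_nonneg [OF x] sn_nonneg [OF y] by (simp add: mult_le_cancel_left)
  next
    case True
    show ?thesis
    proof (rule ccontr)
      assume "\<not> Re (ip x y) \<le> sn x * sn y"
      then have r: "Re (ip x y) > 0" using True by simp
      have q: "0 \<le> (sn x)\<^sup>2 - 2 * k * Re (ip x y) + k\<^sup>2 * (sn y)\<^sup>2" for k :: real
      proof -
        have "0 \<le> (sn (x - complex_of_real k *\<^sub>C y))\<^sup>2" by simp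
        also have "\<dots> = (sn x)\<^sup>2 - 2 * k * Re (ip x y) + k\<^sup>2 * (sn y)\<^sup>2"
          using x y by (simp add: sn_diff_sq scale_mem sn_scale scale_right power_mult_distrib)
        finally show ?thesis .
      qed
      have q': "0 \<le> (sn y)\<^sup>2 - 2 * k * Re (ip x y) + k\<^sup>2 * (sn x)\<^sup>2" for k :: real
      proof -
        have "0 \<le> (sn (y - complex_of_real k *\<^sub>C x))\<^sup>2" by simp
        also have "\<dots> = (sn y)\<^sup>2 - 2 * k * Re (ip x y) + k\<^sup>2 * (sn x)\<^sup>2"
          using x y herm [of x y] by (simp add: sn_diff_sq scale_mem sn_scale scale_right power_mult_distrib)
        finally show ?thesis .
      qed
      from True consider "sn x = 0" | "sn y = 0" by auto
      then show False
      proof cases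
        case 1
          have "2 * (((sn y)\<^sup>2 + 1) / Re (ip x y)) * Re (ip x y) = 2 * ((sn y)\<^sup>2 + 1)" using r by simp
          with 1 show False using q' [of "((sn y)\<^sup>2 + 1) / Re (ip x y)"] zero_le_power2 [of "sn y"] by simp
      next
        case 2
          have "2 * (((sn x)\<^sup>2 + 1) / Re (ip x y)) * Re (ip x y) = 2 * ((sn x)\<^sup>2 + 1)" using r by simp
          with 2 show False using q [of "((sn x)\<^sup>2 + 1) / Re (ip x y)"] zero_le_power2 [of "sn x"] by simp
      qed
    qed
  qed
qed

lemma cauchy_schwarz: "x \<in> V \<Longrightarrow> y \<in> V \<Longrightarrow> cmod (ip x y) \<le> sn x * sn y"
proof (cases "ip x y = 0")
  case False
  assume x: "x \<in> V" and y: "y \<in> V"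
  define u where "u = cnj (ip x y) / complex_of_real (cmod (ip x y))"
  have u: "cmod u = 1" using False by (simp add: u_def norm_divide)
  have "ip x (u *\<^sub>C y) = complex_of_real (cmod (ip x y))"
    using x y False by (simp add: scale_right u_def mult.commute [of "cnj _"] complex_norm_square [symmetric] power2_eq_square)
  then show ?thesis using Re_ip_le [OF x scale_mem [OF y, of u]] u sn_scale [OF y, of u] by simp
qed (simp add: sn_nonneg)

lemma sn_triangle: "x \<in> V \<Longrightarrow> y \<in> V \<Longrightarrow> sn (x + y) \<le> sn x + sn y"
proof (rule power2_le_imp_le)
  assume x: "x \<in> V" and y: "y \<in> V"
  show "(sn (x + y))\<^sup>2 \<le> (sn x + sn y)\<^sup>2"
    using sn_add_sq [OF x y] Re_ip_le [OF x y] by (simp add: power2_sum)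
  show "0 \<le> sn x + sn y" using sn_nonneg x y by simp
qed

lemma sn_triangle_diff: "x \<in> V \<Longrightarrow> y \<in> V \<Longrightarrow> sn (x - y) \<le> sn x + sn y"
  using sn_triangle [of x "- y"] by (simp add: minus_mem sn_minus)

lemma sn_triangle3: "x \<in> V \<Longrightarrow> y \<in> V \<Longrightarrow> z \<in> V \<Longrightarrow> sn (x - z) \<le> sn (x - y) + sn (y - z)"
  using sn_triangle [of "x - y" "y - z"] by (simp add: diff_mem)

lemma sn_minus_commute: "x \<in> V \<Longrightarrow> y \<in> V \<Longrightarrow> sn (x - y) = sn (y - x)"
  using sn_minus [of "x - y"] by (simp add: diff_mem)

lemma sn_diff_abs: "x \<in> V \<Longrightarrow> y \<in> V \<Longrightarrow> \<bar>sn x - sn y\<bar> \<le> sn (x - y)"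
  using sn_triangle [of "x - y" y] sn_triangle [of "y - x" x] sn_minus_commute [of x y] by (simp add: diff_mem)

lemma sum_mem: "(\<And>i. i \<in> I \<Longrightarrow> f i \<in> V) \<Longrightarrow> sum f I \<in> V"
  by (induction I rule: infinite_finite_induct) (simp_all add: zero_mem add_mem)

lemma sum_list_mem: "set xs \<subseteq> V \<Longrightarrow> sum_list xs \<in> V"
  by (induction xs) (simp_all add: zero_mem add_mem)

lemma sn_sum_le: "(\<And>i. i \<in> I \<Longrightarrow> f i \<in> V) \<Longrightarrow> sn (sum f I) \<le> (\<Sum>i\<in>I. sn (f i))"
proof (induction I rule: infinite_finite_induct)
  case (insert i I)
  then show ?case using sn_triangle [of "f i" "sum f I"] sum_mem [of I f] by fastforce
qed simp_all

lemma ip_sum_right: "x \<in> V \<Longrightarrow> (\<And>i. i \<in> I \<Longrightarrow> f i \<in> V) \<Longrightarrow> ip x (sum f I) = (\<Sum>i\<in>I. ip x (f i))"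
  by (induction I rule: infinite_finite_induct) (simp_all add: zero_right add_right sum_mem)

lemma ip_sum_left: "x \<in> V \<Longrightarrow> (\<And>i. i \<in> I \<Longrightarrow> f i \<in> V) \<Longrightarrow> ip (sum f I) x = (\<Sum>i\<in>I. ip (f i) x)"
  by (induction I rule: infinite_finite_induct) (simp_all add: zero_left add_left sum_mem)

lemma pythagoras_sum:
  assumes "finite I" "\<And>i. i \<in> I \<Longrightarrow> f i \<in> V" "\<And>i j. i \<in> I \<Longrightarrow> j \<in> I \<Longrightarrow> i \<noteq> j \<Longrightarrow> ip (f i) (f j) = 0"
  shows "(sn (sum f I))\<^sup>2 = (\<Sum>i\<in>I. (sn (f i))\<^sup>2)"
proof -
  have "ip (sum f I) (sum f I) = (\<Sum>i\<in>I. \<Sum>j\<in>I. ip (f i) (f j))"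
    using assms by (simp add: ip_sum_left ip_sum_right sum_mem) (rule sum.swap)
  also have "\<dots> = (\<Sum>i\<in>I. \<Sum>j\<in>I. if j = i then ip (f i) (f i) else 0)"
    using assms(3) by (intro sum.cong refl) auto
  also have "\<dots> = (\<Sum>i\<in>I. ip (f i) (f i))" using assms(1) by (simp add: sum.delta)
  finally show ?thesis using assms by (simp add: sn_sq sum_mem)
qed

lemma ip_tendsto:
  assumes x: "\<And>n. x n \<in> V" and y: "\<And>n. y n \<in> V" and "a \<in> V" "b \<in> V"
    and "(\<lambda>n. sn (x n - a)) \<longlonglongrightarrow> 0" "(\<lambda>n. sn (y n - b)) \<longlonglongrightarrow> 0"
  shows "(\<lambda>n. ip (x n) (y n)) \<longlonglongrightarrow> ip a b"
proof (rule Lim_null [THEN iffD2], rule Lim_null_comparison)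
  show "\<forall>\<^sub>F n in sequentially. norm (ip (x n) (y n) - ip a b)
    \<le> sn (x n - a) * sn (y n - b) + sn (x n - a) * sn b + sn a * sn (y n - b)"
  proof (intro always_eventually allI)
    fix n
    have "ip (x n) (y n) - ip a b = ip (x n - a) (y n - b) + ip (x n - a) b + ip a (y n - b)"
      using assms(1-4) by (simp add: diff_left diff_right diff_mem)
    also have "cmod \<dots> \<le> cmod (ip (x n - a) (y n - b)) + cmod (ip (x n - a) b) + cmod (ip a (y n - b))"
      by (intro norm_triangle_mono norm_triangle_ineq order_refl)
    also have "\<dots> \<le> sn (x n - a) * sn (y n - b) + sn (x n - a) * sn b + sn a * sn (y n - b)"
      using assms(1-4) by (intro add_mono cauchy_schwarz diff_mem) auto
    finally show "norm (ip (x n) (y n) - ip a b) \<le> sn (x n - a) * sn (y n - b) + sn (x n - a) * sn b + sn a * sn (y n - b)" .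
  qed
  show "(\<lambda>n. sn (x n - a) * sn (y n - b) + sn (x n - a) * sn b + sn a * sn (y n - b)) \<longlonglongrightarrow> 0"
    using tendsto_add [OF tendsto_add [OF tendsto_mult [OF assms(5,6)] tendsto_mult_right [OF assms(5), of "sn b"]]
        tendsto_mult_left [OF assms(6), of "sn a"]]
    by (simp add: mult.commute)
qed

end


locale hilb =
  fixes H :: "'h::complex_vector hspace"
  assumes hilbert: "hilbert_space H"

sublocale hilb \<subseteq> semi_inner "hcarrier H" "hinner H"
proof -
  let ?V = "hcarrier H" and ?i = "hinner H"
  note h = hilbert [unfolded hilbert_space_def]
  have 1: "0 \<in> ?V" using h by (elim conjE)
  have 2: "\<forall>x\<in>?V. \<forall>y\<in>?V. x + y \<in> ?V" using h by (elim conjE)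
  have 3: "\<forall>c. \<forall>x\<in>?V. c *\<^sub>C x \<in> ?V" using h by (elim conjE)
  have 4: "\<forall>x\<in>?V. \<forall>y\<in>?V. ?i y x = cnj (?i x y)" using h by (elim conjE)
  have 5: "\<forall>x\<in>?V. \<forall>y\<in>?V. \<forall>z\<in>?V. ?i x (y + z) = ?i x y + ?i x z" using h by (elim conjE)
  have 6: "\<forall>c. \<forall>x\<in>?V. \<forall>y\<in>?V. ?i x (c *\<^sub>C y) = c * ?i x y" using h by (elim conjE)
  have 7: "\<forall>x\<in>?V. ?i x x \<in> \<real>\<^sub>\<ge>\<^sub>0" using h by (elim conjE)
  show "semi_inner ?V ?i"
    by unfold_locales (blast intro: 1 2 [rule_format] 3 [rule_format] 4 [rule_format] 5 [rule_format] 6 [rule_format] 7 [rule_format])+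
qed

context hilb
begin

lemma hnorm_sn: "hnorm H = sn"
  by (simp add: hnorm_def sn_def fun_eq_iff)

lemma definite: "x \<in> hcarrier H \<Longrightarrow> sn x = 0 \<Longrightarrow> x = 0"
proof -
  assume x: "x \<in> hcarrier H" "sn x = 0"
  have "\<forall>x\<in>hcarrier H. hinner H x x = 0 \<longrightarrow> x = 0"
    using hilbert unfolding hilbert_space_def by (elim conjE)
  then show ?thesis using ip_self [of x] x by simp
qed

lemma complete:
  assumes "\<And>n. X n \<in> hcarrier H" "\<And>e. e > 0 \<Longrightarrow> \<exists>M. \<forall>m\<ge>M. \<forall>n\<ge>M. sn (X m - X n) < e"
  obtains x where "x \<in> hcarrier H" "(\<lambda>n. sn (X n - x)) \<longlonglongrightarrow> 0"
proof -
  have "\<forall>X. range X \<subseteq> hcarrier H \<and> (\<forall>e>0. \<exists>M. \<forall>m\<ge>M. \<forall>n\<ge>M. sn (X m - X n) < e) \<longrightarrow>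
      (\<exists>x\<in>hcarrier H. (\<lambda>n. sn (X n - x)) \<longlonglongrightarrow> 0)"
    using hilbert unfolding hilbert_space_def hnorm_sn by (elim conjE)
  moreover have "range X \<subseteq> hcarrier H" using assms(1) by blast
  ultimately obtain x where "x \<in> hcarrier H" "(\<lambda>n. sn (X n - x)) \<longlonglongrightarrow> 0" using assms(2) by meson
  then show thesis by (rule that)
qed

lemma eq_of_ip: "x \<in> hcarrier H \<Longrightarrow> y \<in> hcarrier H \<Longrightarrow> (\<And>z. z \<in> hcarrier H \<Longrightarrow> hinner H z x = hinner H z y) \<Longrightarrow> x = y"
  using definite [of "x - y"] by (simp add: sn_def diff_right diff_mem)

lemma limit_unique:
  assumes "\<And>n. X n \<in> hcarrier H" "x \<in> hcarrier H" "y \<in> hcarrier H"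
    "(\<lambda>n. sn (X n - x)) \<longlonglongrightarrow> 0" "(\<lambda>n. sn (X n - y)) \<longlonglongrightarrow> 0"
  shows "x = y"
proof (rule eq_of_ip [OF assms(2,3)])
  fix z assume z: "z \<in> hcarrier H"
  have "(\<lambda>n. sn (z - z)) \<longlonglongrightarrow> 0" by simp
  from ip_tendsto [OF z assms(1) z assms(2) this assms(4)] ip_tendsto [OF z assms(1) z assms(3) this assms(5)]
  show "hinner H z x = hinner H z y" by (rule LIMSEQ_unique)
qed

lemma opD:
  assumes "T \<in> bounded_operators H" "x \<in> hcarrier H"
  shows "T x \<in> hcarrier H" "y \<in> hcarrier H \<Longrightarrow> T (x + y) = T x + T y" "T (c *\<^sub>C x) = c *\<^sub>C T x"
    "y \<in> hcarrier H \<Longrightarrow> T (x - y) = T x - T y" "T 0 = 0"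
proof -
  show *: "T x \<in> hcarrier H" "T (c *\<^sub>C x) = c *\<^sub>C T x" for c
    using assms by (auto simp: bounded_operators_def)
  show a: "T (x + y) = T x + T y" if "y \<in> hcarrier H" for y
    using assms that by (auto simp: bounded_operators_def)
  show "T 0 = 0" using *(2) [of 0] by (simp add: scaleC_simps)
  show "T (x - y) = T x - T y" if "y \<in> hcarrier H"
  proof -
    have "T (- y) = - T y"
    proof -
      have "T ((- 1) *\<^sub>C y) = (- 1) *\<^sub>C T y" using assms that by (auto simp: bounded_operators_def)
      then show ?thesis by (simp add: scaleC_simps scaleC_one)
    qed
    then show ?thesis using a [of "- y"] minus_mem [OF that] by simp
  qed
qed

lemma op_bound:
  assumes "T \<in> bounded_operators H"
  obtains C where "C \<ge> 0" "\<And>x. x \<in> hcarrier H \<Longrightarrow> sn (T x) \<le> C * sn x"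
proof -
  obtain C where C: "\<forall>x\<in>hcarrier H. sn (T x) \<le> C * sn x"
    using assms unfolding bounded_operators_def hnorm_sn by auto
  have "sn (T x) \<le> \<bar>C\<bar> * sn x" if "x \<in> hcarrier H" for x
    
    using bspec [OF C that] mult_right_mono [OF abs_ge_self [of C] sn_nonneg [OF that]] by linarith
  then show thesis using that [of "\<bar>C\<bar>"] by simp
qed

lemma op_tendsto:
  assumes T: "T \<in> bounded_operators H" and X: "\<And>n. X n \<in> hcarrier H" "x \<in> hcarrier H" "(\<lambda>n. sn (X n - x)) \<longlonglongrightarrow> 0"
  shows "(\<lambda>n. sn (T (X n) - T x)) \<longlonglongrightarrow> 0"
proof -
  obtain C where C: "C \<ge> 0" "\<And>x. x \<in> hcarrier H \<Longrightarrow> sn (T x) \<le> C * sn x" using op_bound [OF T] by blast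
  show ?thesis
  proof (rule Lim_null_comparison)
    show "\<forall>\<^sub>F n in sequentially. norm (sn (T (X n) - T x)) \<le> C * sn (X n - x)"
    proof (intro always_eventually allI)
      fix n
      have "T (X n) - T x = T (X n - x)" using opD(4) [OF T X(1) X(2)] by simp
      then show "norm (sn (T (X n) - T x)) \<le> C * sn (X n - x)"
        using C(2) [OF diff_mem [OF X(1) X(2)]] sn_nonneg [OF opD(1) [OF T diff_mem [OF X(1) X(2)]]] by simp
    qed
    show "(\<lambda>n. C * sn (X n - x)) \<longlonglongrightarrow> 0" using tendsto_mult_left [OF X(3), of C] by simp
  qed
qed

lemma op_eqI:
  assumes "T \<in> bounded_operators H" "T' \<in> bounded_operators H" "\<And>x. x \<in> hcarrier H \<Longrightarrow> T x = T' x"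
  shows "T = T'"
  by (rule PiE_ext [of _ "hcarrier H" "\<lambda>_. hcarrier H"]) (use assms in \<open>simp_all add: bounded_operators_def\<close>)

lemma projD:
  assumes "p \<in> projections H" "x \<in> hcarrier H"
  shows "p x \<in> hcarrier H" "p (p x) = p x" "y \<in> hcarrier H \<Longrightarrow> hinner H (p x) y = hinner H x (p y)"
    "hinner H x (p x) = complex_of_real ((sn (p x))\<^sup>2)" "sn (p x) \<le> sn x"
proof -
  have b: "p \<in> bounded_operators H" using assms by (simp add: projections_def)
  show 1: "p x \<in> hcarrier H" using opD [OF b assms(2)] by simp
  show 2: "p (p x) = p x" and 3: "\<And>y. y \<in> hcarrier H \<Longrightarrow> hinner H (p x) y = hinner H x (p y)"
    using assms by (auto simp: projections_def)
  show 4: "hinner H x (p x) = complex_of_real ((sn (p x))\<^sup>2)"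
    using 3 [OF 1] 2 ip_self [OF 1] by simp
  have "(sn (p x))\<^sup>2 \<le> sn x * sn (p x)"
    using Re_ip_le [OF assms(2) 1] unfolding 4 by simp
  then show "sn (p x) \<le> sn x"
    using sn_nonneg [OF 1] sn_nonneg [OF assms(2)]
    by (cases "sn (p x) = 0") (auto simp: power2_eq_square)
qed

text \<open>restricting\<close>
lemma op_subtract:
  assumes "p \<in> bounded_operators H" "q \<in> bounded_operators H"
  shows "(\<lambda>x\<in>hcarrier H. p x - q x) \<in> bounded_operators H"
proof -
  obtain C where C: "C \<ge> 0" "\<And>x. x \<in> hcarrier H \<Longrightarrow> sn (p x) \<le> C * sn x" using op_bound [OF assms(1)] by blast
  obtain D where D: "D \<ge> 0" "\<And>x. x \<in> hcarrier H \<Longrightarrow> sn (q x) \<le> D * sn x" using op_bound [OF assms(2)] by blast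
  have "sn (p x - q x) \<le> (C + D) * sn x" if "x \<in> hcarrier H" for x
    using sn_triangle_diff [OF opD(1) [OF assms(1) that] opD(1) [OF assms(2) that]] C(2) [OF that] D(2) [OF that]
    by (simp add: distrib_right)
  then show ?thesis
    unfolding bounded_operators_def hnorm_sn
    using opD [OF assms(1)] opD [OF assms(2)]
    by (auto simp: add_mem scale_mem diff_mem scaleC_simps intro!: exI [of _ "C + D"])
qed

end

locale vn_projections = hilb H for H :: "'h::complex_vector hspace" +
  fixes S :: "('h \<Rightarrow> 'h) set" and \<xi> :: 'h
  assumes S: "S \<subseteq> bounded_operators H" and xi: "\<xi> \<in> hcarrier H"
    and separating: "\<And>T. T \<in> commutant H S \<Longrightarrow> T \<xi> = 0 \<Longrightarrow> T = zero_operator H"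
    and diffuse: "diffuse H (commutant H S)"
begin

definition P where "P = commutant H S \<inter> projections H"

definition weight :: "('h \<Rightarrow> 'h) \<Rightarrow> real" where "weight p = (sn (p \<xi>))\<^sup>2"

definition below :: "('h \<Rightarrow> 'h) \<Rightarrow> ('h \<Rightarrow> 'h) \<Rightarrow> bool"
  where "below q p \<longleftrightarrow> (\<forall>x\<in>hcarrier H. p (q x) = q x)"

definition psub :: "('h \<Rightarrow> 'h) \<Rightarrow> ('h \<Rightarrow> 'h) \<Rightarrow> 'h \<Rightarrow> 'h"
  where "psub p q = (\<lambda>x\<in>hcarrier H. p x - q x)"

lemma PD: "p \<in> P \<Longrightarrow> p \<in> projections H" "p \<in> P \<Longrightarrow> p \<in> bounded_operators H" "p \<in> P \<Longrightarrow> p \<in> commutant H S"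
  by (auto simp: P_def projections_def)

lemma below_sym:
  assumes "p \<in> P" "q \<in> P" "below q p" "x \<in> hcarrier H"
  shows "q (p x) = q x"
proof (rule eq_of_ip)
  note p = projD [OF PD(1) [OF assms(1)]] and q = projD [OF PD(1) [OF assms(2)]]
  show "q (p x) \<in> hcarrier H" "q x \<in> hcarrier H" using p q assms by auto
  fix z assume z: "z \<in> hcarrier H"
  have "hinner H z (q (p x)) = hinner H (p (q z)) x"
    using q(3) [OF z p(1) [OF assms(4)]] p(3) [OF q(1) [OF z] assms(4)] by simp
  also have "\<dots> = hinner H (q z) x" using assms(3) z by (simp add: below_def)
  also have "\<dots> = hinner H z (q x)" using q(3) [OF z assms(4)] .
  finally show "hinner H z (q (p x)) = hinner H z (q x)" .
qed

lemma psub_P: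
  assumes "p \<in> P" "q \<in> P" "below q p"
  shows "psub p q \<in> P" "below (psub p q) p" "weight (psub p q) = weight p - weight q"
proof -
  note p = projD [OF PD(1) [OF assms(1)]] and q = projD [OF PD(1) [OF assms(2)]]
  note bp = opD [OF PD(2) [OF assms(1)]] and bq = opD [OF PD(2) [OF assms(2)]]
  have b: "psub p q \<in> bounded_operators H" unfolding psub_def by (rule op_subtract) (use assms PD in auto)
  have r: "psub p q x = p x - q x" if "x \<in> hcarrier H" for x using that by (simp add: psub_def)
  have pq: "p (q x) = q x" if "x \<in> hcarrier H" for x using assms(3) that by (simp add: below_def)
  have qp: "q (p x) = q x" if "x \<in> hcarrier H" for x using below_sym [OF assms that] .
  have "psub p q \<in> projections H"
    using b p q bp bq pq qp by (simp add: projections_def r diff_mem diff_left diff_right)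
  moreover have "psub p q \<in> commutant H S"
    unfolding commutant_def
  proof (clarify, intro conjI ballI b)
    fix A x assume A: "A \<in> S" and x: "x \<in> hcarrier H"
    have bA: "A \<in> bounded_operators H" using A S by auto
    show "psub p q (A x) = A (psub p q x)"
      using PD(3) [OF assms(1)] PD(3) [OF assms(2)] A x opD [OF bA] p q by (simp add: r commutant_def)
  qed
  ultimately show 1: "psub p q \<in> P" by (simp add: P_def)
  show "below (psub p q) p"
    using p q bp pq by (simp add: below_def r)
  have "complex_of_real (weight (psub p q)) = complex_of_real (weight p - weight q)"
    using projD(4) [OF PD(1) [OF 1] xi] p(4) [OF xi] q(4) [OF xi] p(1) q(1) xi
    by (simp add: weight_def r diff_right del: of_real_power)
  then show "weight (psub p q) = weight p - weight q" by (simp only: of_real_eq_iff)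
qed

lemma weight_nonneg: "0 \<le> weight p" by (simp add: weight_def)

lemma weight_zero: "p \<in> P \<Longrightarrow> weight p = 0 \<Longrightarrow> p = zero_operator H"
proof -
  assume p: "p \<in> P" and "weight p = 0"
  then have "p \<xi> = 0" using definite [OF projD(1) [OF PD(1) [OF p] xi]] by (simp add: weight_def)
  then show ?thesis using separating [OF PD(3) [OF p]] by simp
qed

lemma below_trans: "p \<in> P \<Longrightarrow> q \<in> P \<Longrightarrow> r \<in> P \<Longrightarrow> below r q \<Longrightarrow> below q p \<Longrightarrow> below r p"
  unfolding below_def
proof
  fix x assume "p \<in> P" "q \<in> P" "r \<in> P" and rq: "\<forall>x\<in>hcarrier H. q (r x) = r x"
    and qp: "\<forall>x\<in>hcarrier H. p (q x) = q x" and x: "x \<in> hcarrier H"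
  have "r x \<in> hcarrier H" using projD(1) [OF PD(1) [OF \<open>r \<in> P\<close>] x] .
  then have "p (q (r x)) = q (r x)" using qp by blast
  then show "p (r x) = r x" using rq x by simp
qed

lemma below_weight: "p \<in> P \<Longrightarrow> q \<in> P \<Longrightarrow> below q p \<Longrightarrow> weight q \<le> weight p"
  using psub_P(3) [of p q] weight_nonneg [of "psub p q"] by simp

definition shredded :: "real \<Rightarrow> ('h \<Rightarrow> 'h) \<Rightarrow> bool"
  where "shredded \<eta> p \<longleftrightarrow> (\<exists>ps. set ps \<subseteq> P \<and> (\<forall>q\<in>set ps. weight q \<le> \<eta>) \<and>
    (\<forall>x\<in>hcarrier H. p x = (\<Sum>q\<leftarrow>ps. q x)))"

lemma shredded_add:
  assumes "shredded \<eta> q" "shredded \<eta> r" "\<And>x. x \<in> hcarrier H \<Longrightarrow> p x = q x + r x"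
  shows "shredded \<eta> p"
proof -
  from assms obtain qs rs where
    "set qs \<subseteq> P \<and> (\<forall>q\<in>set qs. weight q \<le> \<eta>) \<and> (\<forall>x\<in>hcarrier H. q x = (\<Sum>q\<leftarrow>qs. q x))"
    "set rs \<subseteq> P \<and> (\<forall>q\<in>set rs. weight q \<le> \<eta>) \<and> (\<forall>x\<in>hcarrier H. r x = (\<Sum>q\<leftarrow>rs. q x))"
    unfolding shredded_def by blast
  then show ?thesis unfolding shredded_def using assms(3) by (intro exI [of _ "qs @ rs"]) auto
qed

lemma shredded_small: "p \<in> P \<Longrightarrow> weight p \<le> \<eta> \<Longrightarrow> shredded \<eta> p"
  unfolding shredded_def by (rule exI [of _ "[p]"]) simp

lemma shredded_psub: "p \<in> P \<Longrightarrow> q \<in> P \<Longrightarrow> shredded \<eta> q \<Longrightarrow> shredded \<eta> (psub p q) \<Longrightarrow> shredded \<eta> p"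
  by (rule shredded_add [of \<eta> q "psub p q"]) (simp_all add: psub_def)

lemma monotone_limit:
  assumes p: "\<And>n. p n \<in> P" and dec: "\<And>n. below (p (Suc n)) (p n)"
  obtains q where "q \<in> P" "\<forall>n. below q (p n)" "(\<lambda>n. weight (p n)) \<longlonglongrightarrow> weight q"
proof -
  have dec': "below (p m) (p n)" if "n \<le> m" for n m
    using that
  proof (induction m rule: dec_induct)
    case base
    then show ?case using projD(2) [OF PD(1) [OF p]] by (simp add: below_def)
  next
    case (step m)
    show ?case by (rule below_trans [OF p p p dec step.IH])
  qed
  note pp = projD [OF PD(1) [OF p]] and pb = PD(2) [OF p]
  have diff: "(sn (p n x - p m x))\<^sup>2 = (sn (p n x))\<^sup>2 - (sn (p m x))\<^sup>2" if "n \<le> m" "x \<in> hcarrier H" for n m x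
  proof -
    have "hinner H (p n x) (p m x) = hinner H x (p m x)"
      using pp(3) [OF that(2) pp(1) [OF that(2)]] dec' [OF that(1)] that(2) by (simp add: below_def)
    then show ?thesis using sn_diff_sq [OF pp(1) pp(1), OF that(2) that(2), of n m] pp(4) [OF that(2), of m]
      by simp
  qed
  have lim: "\<exists>y. y \<in> hcarrier H \<and> (\<lambda>n. sn (p n x - y)) \<longlonglongrightarrow> 0" if x: "x \<in> hcarrier H" for x
  proof -
    have "decseq (\<lambda>n. (sn (p n x))\<^sup>2)"
    proof (rule decseq_SucI)
      fix n show "(sn (p (Suc n) x))\<^sup>2 \<le> (sn (p n x))\<^sup>2"
        using diff [of n "Suc n", OF _ x] zero_le_power2 [of "sn (p n x - p (Suc n) x)"] by linarith
    qed
    then have Cau: "Cauchy (\<lambda>n. (sn (p n x))\<^sup>2)"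
    proof (rule decseq_convergent [of _ 0])
      show "\<forall>n. 0 \<le> (sn (p n x))\<^sup>2" by simp
    next
      fix L assume "(\<lambda>n. (sn (p n x))\<^sup>2) \<longlonglongrightarrow> L"
      then show ?thesis by (rule LIMSEQ_imp_Cauchy)
    qed
    have C: "\<exists>M. \<forall>m\<ge>M. \<forall>n\<ge>M. \<bar>(sn (p m x))\<^sup>2 - (sn (p n x))\<^sup>2\<bar> < e\<^sup>2" if "e > 0" for e
      using metric_CauchyD [OF Cau, of "e\<^sup>2"] that by (simp add: dist_real_def)
    have "\<exists>M. \<forall>m\<ge>M. \<forall>n\<ge>M. sn (p m x - p n x) < e" if e: "e > 0" for e
    proof -
      obtain M where M: "\<forall>m\<ge>M. \<forall>n\<ge>M. \<bar>(sn (p m x))\<^sup>2 - (sn (p n x))\<^sup>2\<bar> < e\<^sup>2" using C [OF e] by blast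
      have "sn (p m x - p n x) < e" if mn: "m \<ge> M" "n \<ge> M" for m n
      proof -
        have "(sn (p m x - p n x))\<^sup>2 = \<bar>(sn (p m x))\<^sup>2 - (sn (p n x))\<^sup>2\<bar>"
        proof (cases "m \<le> n")
          case True
          then show ?thesis using diff [OF True x] zero_le_power2 [of "sn (p m x - p n x)"] by simp
        next
          case False
          then have "n \<le> m" by simp
          then show ?thesis using diff [OF _ x, of n m] zero_le_power2 [of "sn (p n x - p m x)"]
              sn_minus_commute [OF pp(1) pp(1), OF x x, of m n] by simp
        qed
        then have "(sn (p m x - p n x))\<^sup>2 < e\<^sup>2" using M mn by simp
        then show ?thesis by (rule power2_less_imp_less) (use \<open>e > 0\<close> in simp)
      qed
      then show ?thesis by blast
    qed
    then obtain y where "y \<in> hcarrier H" "(\<lambda>n. sn (p n x - y)) \<longlonglongrightarrow> 0"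
      by (rule complete [OF pp(1) [OF x]])
    then show ?thesis by blast
  qed
  define q where "q = (\<lambda>x\<in>hcarrier H. SOME y. y \<in> hcarrier H \<and> (\<lambda>n. sn (p n x - y)) \<longlonglongrightarrow> 0)"
  have q: "q x \<in> hcarrier H" "(\<lambda>n. sn (p n x - q x)) \<longlonglongrightarrow> 0" if "x \<in> hcarrier H" for x
    using someI_ex [OF lim [OF that]] that by (auto simp: q_def)
  have q_eq: "q x = y" if "x \<in> hcarrier H" "y \<in> hcarrier H" "(\<lambda>n. sn (p n x - y)) \<longlonglongrightarrow> 0" for x y
    using limit_unique [OF pp(1) [OF that(1)] q(1) [OF that(1)] that(2) q(2) [OF that(1)] that(3)] .
  have sn_lim: "(\<lambda>n. sn (p n x)) \<longlonglongrightarrow> sn (q x)" if x: "x \<in> hcarrier H" for x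
  proof (rule Lim_null [THEN iffD2], rule Lim_null_comparison [OF _ q(2) [OF x]])
    show "\<forall>\<^sub>F n in sequentially. norm (sn (p n x) - sn (q x)) \<le> sn (p n x - q x)"
      using sn_diff_abs [OF pp(1) [OF x] q(1) [OF x]] by simp
  qed
  have bq: "q \<in> bounded_operators H"
    unfolding bounded_operators_def hnorm_sn
  proof (clarify, intro conjI ballI allI exI [of _ 1])
    show "q \<in> hcarrier H \<rightarrow>\<^sub>E hcarrier H" using q(1) by (auto simp: q_def)
    fix x assume x: "x \<in> hcarrier H"
    show "sn (q x) \<le> 1 * sn x"
      using LIMSEQ_le_const2 [OF sn_lim [OF x], of "sn x"] pp(5) [OF x] by auto
    fix c
    have "sn (p n (c *\<^sub>C x) - c *\<^sub>C q x) = cmod c * sn (p n x - q x)" for n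
      using opD(3) [OF pb x] sn_scale [OF diff_mem [OF pp(1) [OF x] q(1) [OF x]]] by (simp flip: scaleC_simps)
    then show "q (c *\<^sub>C x) = c *\<^sub>C q x"
      using tendsto_mult_left [OF q(2) [OF x], of "cmod c"] x q(1) [OF x] by (intro q_eq scale_mem) auto
  next
    fix x y assume x: "x \<in> hcarrier H" and y: "y \<in> hcarrier H"
    show "q (x + y) = q x + q y"
    proof (intro q_eq add_mem q x y)
      show "(\<lambda>n. sn (p n (x + y) - (q x + q y))) \<longlonglongrightarrow> 0"
      proof (rule Lim_null_comparison)
        show "\<forall>\<^sub>F n in sequentially. norm (sn (p n (x + y) - (q x + q y))) \<le> sn (p n x - q x) + sn (p n y - q y)"
        proof (intro always_eventually allI)
          fix n
          have "p n (x + y) - (q x + q y) = (p n x - q x) + (p n y - q y)"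
            using opD(2) [OF pb x y] by simp
          moreover have m: "p n x - q x \<in> hcarrier H" "p n y - q y \<in> hcarrier H"
            using x y pp q by (auto intro: diff_mem)
          ultimately show "norm (sn (p n (x + y) - (q x + q y))) \<le> sn (p n x - q x) + sn (p n y - q y)"
            using sn_triangle [OF m] sn_nonneg [OF add_mem [OF m]] by (simp only: real_norm_def abs_of_nonneg)
        qed
        show "(\<lambda>n. sn (p n x - q x) + sn (p n y - q y)) \<longlonglongrightarrow> 0"
          using tendsto_add [OF q(2) [OF x] q(2) [OF y]] by simp
      qed
    qed
  qed
  have comm: "q \<in> commutant H S"
    unfolding commutant_def
  proof (clarify, intro conjI ballI bq)
    fix A x assume A: "A \<in> S" and x: "x \<in> hcarrier H"
    have bA: "A \<in> bounded_operators H" using A S by auto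
    have "p n (A x) = A (p n x)" for n using PD(3) [OF p, of n] A x by (simp add: commutant_def)
    then show "q (A x) = A (q x)"
      using op_tendsto [OF bA pp(1) [OF x] q(1) [OF x] q(2) [OF x]] opD(1) [OF bA] x q(1) [OF x]
      by (intro q_eq) auto
  qed
  have pq: "p n (q x) = q x" if x: "x \<in> hcarrier H" for n x
  proof (rule limit_unique [of "\<lambda>k. p (n + k) x"])
    have sh: "(\<lambda>k. sn (p (n + k) x - q x)) \<longlonglongrightarrow> 0"
      using LIMSEQ_ignore_initial_segment [OF q(2) [OF x], of n] by (simp add: add.commute)
    then show "(\<lambda>k. sn (p (n + k) x - q x)) \<longlonglongrightarrow> 0" .
    have "p n (p (n + k) x) = p (n + k) x" for k using dec' [of n "n + k"] x by (simp add: below_def)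
    then show "(\<lambda>k. sn (p (n + k) x - p n (q x))) \<longlonglongrightarrow> 0"
      using op_tendsto [OF pb pp(1) [OF x] q(1) [OF x] sh, of n] by simp
  qed (use pp q x in auto)
  have "q \<in> projections H"
    unfolding projections_def
  proof (clarify, intro conjI ballI bq)
    fix x assume x: "x \<in> hcarrier H"
    show "q (q x) = q x" using pq [OF x] q(1) [OF x] by (intro q_eq) auto
    fix y assume y: "y \<in> hcarrier H"
    have z: "(\<lambda>n. sn (x - x)) \<longlonglongrightarrow> 0" "(\<lambda>n. sn (y - y)) \<longlonglongrightarrow> 0" by simp_all
    have "(\<lambda>n. hinner H (p n x) y) \<longlonglongrightarrow> hinner H (q x) y"
      by (rule ip_tendsto [OF pp(1) [OF x] y q(1) [OF x] y q(2) [OF x] z(2)])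
    moreover have "(\<lambda>n. hinner H x (p n y)) \<longlonglongrightarrow> hinner H x (q y)"
      by (rule ip_tendsto [OF x pp(1) [OF y] x q(1) [OF y] z(1) q(2) [OF y]])
    ultimately show "hinner H (q x) y = hinner H x (q y)"
      unfolding pp(3) [OF x y] by (rule LIMSEQ_unique)
  qed
  then have "q \<in> P" using comm by (simp add: P_def)
  moreover have "\<forall>n. below q (p n)" using pq by (simp add: below_def)
  moreover have "(\<lambda>n. weight (p n)) \<longlonglongrightarrow> weight q"
    unfolding weight_def by (intro tendsto_power sn_lim xi)
  ultimately show thesis by (rule that)
qed

theorem shredded_identity:
  assumes eta: "\<eta> > 0"
  shows "shredded \<eta> (\<lambda>x\<in>hcarrier H. x)"
proof (rule ccontr)
  let ?I = "\<lambda>x\<in>hcarrier H. x"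
  assume bad1: "\<not> shredded \<eta> ?I"
  have I: "?I \<in> P"
  proof -
    have b: "?I \<in> bounded_operators H"
      unfolding bounded_operators_def by (auto simp: add_mem scale_mem intro!: exI [of _ 1])
    then show ?thesis using S opD(1) by (auto simp: P_def projections_def commutant_def)
  qed
  define bads where "bads p = {q \<in> P. below q p \<and> \<not> shredded \<eta> q}" for p
  have "\<exists>p. \<forall>n. (p n \<in> P \<and> \<not> shredded \<eta> (p n)) \<and> (p (Suc n) \<in> bads (p n) \<and> (\<forall>q\<in>bads (p n). weight (p (Suc n)) \<le> weight q + 1 / Suc n))"
  proof (rule dependent_nat_choice)
    show "\<exists>p. p \<in> P \<and> \<not> shredded \<eta> p" using I bad1 by blast
    fix p and n :: nat assume p: "p \<in> P \<and> \<not> shredded \<eta> p"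
    then have "p \<in> bads p" using projD(2) [OF PD(1)] by (auto simp: bads_def below_def)
    then have ne: "weight ` bads p \<noteq> {}" by auto
    have bdd: "bdd_below (weight ` bads p)" using weight_nonneg by (auto intro!: bdd_belowI [of _ 0])
    have "Inf (weight ` bads p) < Inf (weight ` bads p) + 1 / Suc n" by simp
    then obtain w where w: "w \<in> weight ` bads p" "w < Inf (weight ` bads p) + 1 / Suc n"
      using cInf_lessD [OF ne] by blast
    then obtain q where q: "q \<in> bads p" "weight q = w" by auto
    have "weight q \<le> weight r + 1 / Suc n" if "r \<in> bads p" for r
      using cInf_lower [OF imageI [OF that, of weight] bdd] w q by linarith
    then show "\<exists>q. (q \<in> P \<and> \<not> shredded \<eta> q) \<and> (q \<in> bads p \<and> (\<forall>r\<in>bads p. weight q \<le> weight r + 1 / Suc n))"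
      using q by (intro exI [of _ q]) (simp add: bads_def)
  qed
  then obtain p where p: "\<And>n. p n \<in> P" "\<And>n. \<not> shredded \<eta> (p n)" "\<And>n. below (p (Suc n)) (p n)"
    and opt: "\<And>n q. q \<in> bads (p n) \<Longrightarrow> weight (p (Suc n)) \<le> weight q + 1 / Suc n"
    unfolding bads_def by auto
  obtain q where q: "q \<in> P" "\<forall>n. below q (p n)" "(\<lambda>n. weight (p n)) \<longlonglongrightarrow> weight q"
    by (rule monotone_limit [of p, OF p(1) p(3)])
  have big: "weight (p n) > \<eta>" for n using shredded_small [OF p(1), of n \<eta>] p(2) [of n] by linarith
  then have "weight q \<ge> \<eta>" using LIMSEQ_le_const [OF q(3), of \<eta>] by (meson less_imp_le)
  then have "q \<noteq> zero_operator H" using eta xi by (auto simp: weight_def zero_operator_def)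
  then obtain r where r: "r \<in> P" "below r q" "r \<noteq> zero_operator H" "r \<noteq> q"
    using diffuse q(1) unfolding diffuse_def minimal_projection_def P_def below_def by blast
  define s where "s = psub q r"
  have s: "s \<in> P" "below s q" "weight s = weight q - weight r"
    unfolding s_def by (rule psub_P [OF q(1) r(1,2)])+
  have minimal: "weight q \<le> weight t" if "t \<in> P" "below t q" "\<not> shredded \<eta> t" for t
  proof -
    have "t \<in> bads (p n)" for n
      using that below_trans [OF p(1) q(1) that(1) that(2) spec [OF q(2)]] by (simp add: bads_def)
    then have le: "weight (p (Suc n)) \<le> weight t + 1 / Suc n" for n using opt by blast
    have "(\<lambda>n. weight t + 1 / Suc n) \<longlonglongrightarrow> weight t + 0"
      using LIMSEQ_inverse_real_of_nat by (intro tendsto_add tendsto_const) (simp add: inverse_eq_divide)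
    from LIMSEQ_le [OF LIMSEQ_Suc [OF q(3)] this] le show ?thesis by simp
  qed
  have "shredded \<eta> q"
  proof -
    have "shredded \<eta> r"
    proof (rule ccontr)
      assume "\<not> shredded \<eta> r"
      then have "weight s \<le> 0" using minimal [OF r(1,2)] s(3) by simp
      then have s0: "weight s = 0" using weight_nonneg [of s] by simp
      have sz: "s = zero_operator H" by (rule weight_zero [OF s(1) s0])
      then have "q x = r x" if "x \<in> hcarrier H" for x
      proof -
        have "s x = 0" using that by (simp add: sz zero_operator_def)
        moreover have "s x = q x - r x" using that by (simp add: s_def psub_def)
        ultimately show ?thesis by simp
      qed
      then have "q = r" by (rule op_eqI [OF PD(2) [OF q(1)] PD(2) [OF r(1)]])
      then show False using r(4) by simp
    qed
    moreover have "shredded \<eta> s"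
    proof (rule ccontr)
      assume "\<not> shredded \<eta> s"
      then have "weight r \<le> 0" using minimal [OF s(1,2)] s(3) by simp
      then have "weight r = 0" using weight_nonneg [of r] by simp
      then show False using weight_zero [OF r(1)] r(3) by simp
    qed
    ultimately show ?thesis using shredded_psub [OF q(1) r(1)] by (simp add: s_def)
  qed
  have "\<forall>\<^sub>F n in sequentially. weight (p n) < weight q + \<eta>"
    using order_tendstoD(2) [OF q(3)] eta by simp
  then obtain n where n: "weight (p n) < weight q + \<eta>" by (auto simp: eventually_sequentially)
  have "shredded \<eta> (psub (p n) q)"
    using psub_P [OF p(1) q(1) spec [OF q(2)], of n] n by (intro shredded_small) auto
  then have "shredded \<eta> (p n)" by (rule shredded_psub [OF p(1) q(1) \<open>shredded \<eta> q\<close>])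
  then show False using p(2) by simp
qed

end


lemma norm_star: "norm (x\<^sup>\<star>) = norm (x :: 'a::cstar_algebra)"
proof -
  have le: "norm y \<le> norm (y\<^sup>\<star>)" for y :: 'a
  proof (cases "y = 0")
    case False
    have "norm y * norm y \<le> norm (y\<^sup>\<star>) * norm y"
      using norm_mult_ineq [of "y\<^sup>\<star>" y] by (simp add: cstar_identity power2_eq_square)
    then show ?thesis using False by simp
  qed simp
  show ?thesis using le [of x] le [of "x\<^sup>\<star>"] by (simp add: star_star)
qed

lemma star_diff: "(x - y)\<^sup>\<star> = x\<^sup>\<star> - (y :: 'a::cstar_algebra)\<^sup>\<star>"
  using star_add [of "x - y" y] by (simp add: algebra_simps)

lemma star_zero [simp]: "(0 :: 'a::cstar_algebra)\<^sup>\<star> = 0"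
  using star_diff [of 0 0] by simp

lemma star_scaleR: "(r *\<^sub>R x)\<^sup>\<star> = r *\<^sub>R (x :: 'a::cstar_algebra)\<^sup>\<star>"
  by (simp add: scaleR_scaleC star_scaleC)

lemma self_adjoint_root:
  fixes h :: "'a::cstar_algebra"
  assumes "h\<^sup>\<star> = h" "norm h < 1"
  obtains s where "s\<^sup>\<star> = s" "s * s = 1 - h"
proof -
  define r where "r = (1 + norm h) / 2"
  have r: "0 \<le> r" "r < 1" "norm h + r\<^sup>2 \<le> 2 * r"
  proof -
    show "0 \<le> r" "r < 1" using assms by (auto simp: r_def add_nonneg_nonneg)
    have "(1 - norm h)\<^sup>2 \<le> 4 * (1 - norm h)"
      using assms mult_right_mono [of "1 - norm h" 4 "1 - norm h"] norm_ge_zero [of h]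
      by (simp add: power2_eq_square del: norm_ge_zero)
    then show "norm h + r\<^sup>2 \<le> 2 * r" by (simp add: r_def power2_eq_square field_simps)
  qed
  define B where "B = {y :: 'a. norm y \<le> r \<and> y\<^sup>\<star> = y}"
  define f where "f y = (1/2) *\<^sub>R (h + y * y)" for y
  have star_lim: "closed {y :: 'a. y\<^sup>\<star> = y}"
  proof -
    have "continuous_on UNIV (\<lambda>y :: 'a. y\<^sup>\<star> - y)"
    proof (rule continuous_on_diff)
      show "continuous_on UNIV (\<lambda>y :: 'a. y\<^sup>\<star>)"
      proof (rule continuous_onI)
        fix x :: 'a and e :: real assume "e > 0"
        then show "\<exists>d>0. \<forall>x'\<in>UNIV. dist x' x < d \<longrightarrow> dist (x'\<^sup>\<star>) (x\<^sup>\<star>) \<le> e"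
          by (intro exI [of _ e]) (auto simp: dist_norm norm_star simp flip: star_diff)
      qed
    qed (rule continuous_on_id)
    then have "closed ((\<lambda>y :: 'a. y\<^sup>\<star> - y) -` {0})" by (intro closed_vimage closed_singleton)
    moreover have "(\<lambda>y :: 'a. y\<^sup>\<star> - y) -` {0} = {y. y\<^sup>\<star> = y}" by auto
    ultimately show ?thesis by simp
  qed
  have "\<exists>!y\<in>B. f y = y"
  proof (rule Banach_fix [of B r])
    have "closed B" unfolding B_def
      using closed_Int [OF closed_cball [of 0 r] star_lim] by (simp add: Int_def cball_def dist_norm)
    then show "complete B" by (simp add: complete_eq_closed)
    show "B \<noteq> {}" using r by (auto simp: B_def intro!: exI [of _ 0])
    show "0 \<le> r" "r < 1" by fact+
    show "f ` B \<subseteq> B"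
    proof safe
      fix y assume y: "y \<in> B"
      have "norm (h + y * y) \<le> norm h + norm y * norm y"
        using norm_triangle_ineq [of h "y * y"] norm_mult_ineq [of y y] by linarith
      also have "\<dots> \<le> norm h + r\<^sup>2" using y r by (auto simp: B_def power2_eq_square intro: mult_mono)
      finally have "norm (f y) \<le> r" using r by (simp add: f_def)
      then show "f y \<in> B" using y assms by (simp add: B_def f_def star_scaleR star_add star_mult)
    qed
    fix y z assume yz: "y \<in> B" "z \<in> B"
    have "f y - f z = (1/2) *\<^sub>R (y * (y - z) + (y - z) * z)" by (simp add: f_def algebra_simps flip: scaleR_diff_right)
    also have "norm \<dots> \<le> (1/2) * (norm y * norm (y - z) + norm (y - z) * norm z)"
      using norm_triangle_ineq [of "y * (y - z)" "(y - z) * z"] norm_mult_ineq [of y "y - z"] norm_mult_ineq [of "y - z" z]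
      by simp
    also have "\<dots> \<le> (1/2) * (r * norm (y - z) + norm (y - z) * r)"
      using yz by (intro mult_left_mono add_mono mult_right_mono mult_left_mono) (auto simp: B_def)
    finally show "dist (f y) (f z) \<le> r * dist y z" by (simp add: dist_norm)
  qed
  then obtain y where y: "y \<in> B" "f y = y" by auto
  have "2 *\<^sub>R f y = h + y * y" by (simp add: f_def)
  then have "h + y * y = 2 *\<^sub>R y" using y(2) by simp
  then have "h = y + y - y * y" by (simp add: scaleR_2 algebra_simps)
  show thesis
  proof (rule that)
    show "(1 - y)\<^sup>\<star> = 1 - y" using y by (simp add: B_def star_diff)
    show "(1 - y) * (1 - y) = 1 - h" by (subst \<open>h = _\<close>) (simp add: algebra_simps)
  qed
qed

locale gns =
  fixes \<tau> :: "'a::cstar_algebra \<Rightarrow> complex"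
  assumes trace: "\<tau> \<in> traces"
begin

lemma t_add: "\<tau> (x + y) = \<tau> x + \<tau> y" and t_scale: "\<tau> (c *\<^sub>C x) = c * \<tau> x" and t_pos: "\<tau> (x\<^sup>\<star> * x) \<in> \<real>\<^sub>\<ge>\<^sub>0"
  and t_one: "\<tau> 1 = 1" and t_comm: "\<tau> (x * y) = \<tau> (y * x)"
  using trace by (auto simp: traces_def states_def clinear_def scaleC_complex_def)

lemma t_minus: "\<tau> (- x) = - \<tau> x"
  using t_scale [of "- 1" x] by (simp add: scaleC_simps scaleC_one)

lemma t_diff: "\<tau> (x - y) = \<tau> x - \<tau> y"
  using t_add [of x "- y"] by (simp add: t_minus)

lemma t_herm: "\<tau> (y\<^sup>\<star> * x) = cnj (\<tau> (x\<^sup>\<star> * y))"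
proof -
  have real: "Im (\<tau> (z\<^sup>\<star> * z)) = 0" for z using t_pos [of z] by (simp add: complex_nonneg_Reals_iff)
  have "Im (\<tau> (x\<^sup>\<star> * y)) + Im (\<tau> (y\<^sup>\<star> * x)) = 0"
    using real [of "x + y"] real [of x] real [of y] by (simp add: star_add algebra_simps t_add)
  moreover have "Re (\<tau> (x\<^sup>\<star> * y)) - Re (\<tau> (y\<^sup>\<star> * x)) = 0"
    using real [of "x + \<i> *\<^sub>C y"] real [of x] real [of y]
    by (simp add: star_add star_scaleC distrib_left distrib_right left_diff_distrib t_add t_diff mult_scaleC_left mult_scaleC_right t_scale scaleC_simps t_minus)
  ultimately show ?thesis by (simp add: complex_eq_iff)
qed

end

sublocale gns \<subseteq> A: semi_inner UNIV "\<lambda>a b. \<tau> (a\<^sup>\<star> * b)"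
  by unfold_locales (rule UNIV_I t_herm t_pos | simp add: distrib_left t_add mult_scaleC_right t_scale)+

context gns
begin

abbreviation "sn \<equiv> A.sn"

lemma seminorm_sn: "gns_seminorm \<tau> = sn"
  by (simp add: gns_seminorm_def A.sn_def fun_eq_iff)

lemma sn_one: "sn 1 = 1"
  by (simp add: A.sn_def t_one)

lemma sn_star: "sn (x\<^sup>\<star>) = sn x"
  using t_comm [of x "x\<^sup>\<star>"] by (simp add: A.sn_def star_star)

lemma sn_mult_left: "sn (x * v) \<le> norm x * sn v"
proof (rule power2_le_imp_le)
  have "Re (\<tau> ((x * v)\<^sup>\<star> * (x * v))) \<le> c * Re (\<tau> (v\<^sup>\<star> * v))" if c: "(norm x)\<^sup>2 < c" for c
  proof -
    have c0: "c > 0" using c by (meson le_less_trans zero_le_power2)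
    define h where "h = (1 / c) *\<^sub>R (x\<^sup>\<star> * x)"
    have h: "h\<^sup>\<star> = h" "norm h < 1"
      using c c0 by (simp_all add: h_def star_scaleR star_mult star_star cstar_identity)
    obtain s where s: "s\<^sup>\<star> = s" "s * s = 1 - h" using self_adjoint_root [OF h] .
    have "(s * v)\<^sup>\<star> * (s * v) = v\<^sup>\<star> * (s * s) * v" by (simp add: star_mult s(1) mult.assoc)
    also have "\<dots> = v\<^sup>\<star> * v - (1 / c) *\<^sub>R ((x * v)\<^sup>\<star> * (x * v))"
      by (simp add: s(2) h_def algebra_simps star_mult)
    finally have "0 \<le> Re (\<tau> (v\<^sup>\<star> * v - (1 / c) *\<^sub>R ((x * v)\<^sup>\<star> * (x * v))))"
      using t_pos [of "s * v"] by (simp add: complex_nonneg_Reals_iff)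
    then show ?thesis using c0 by (simp add: t_diff scaleR_scaleC t_scale field_simps)
  qed
  then have "(sn (x * v))\<^sup>2 \<le> c * (sn v)\<^sup>2" if "(norm x)\<^sup>2 < c" for c
    using that by (simp add: A.sn_sq)
  then have "(sn (x * v))\<^sup>2 \<le> (norm x)\<^sup>2 * (sn v)\<^sup>2 + e" if "e > 0" for e
  proof -
    have "(sn (x * v))\<^sup>2 \<le> ((norm x)\<^sup>2 + e / ((sn v)\<^sup>2 + 1)) * (sn v)\<^sup>2"
      using that \<open>\<And>c. (norm x)\<^sup>2 < c \<Longrightarrow> (sn (x * v))\<^sup>2 \<le> c * (sn v)\<^sup>2\<close> by (simp add: add_nonneg_pos)
    also have "\<dots> = (norm x)\<^sup>2 * (sn v)\<^sup>2 + e * ((sn v)\<^sup>2 / ((sn v)\<^sup>2 + 1))" by (simp add: algebra_simps)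
    also have "e * ((sn v)\<^sup>2 / ((sn v)\<^sup>2 + 1)) \<le> e * 1"
      using that by (intro mult_left_mono) (auto simp: divide_le_eq_1 add_nonneg_pos)
    finally show ?thesis by simp
  qed
  then show "(sn (x * v))\<^sup>2 \<le> (norm x * sn v)\<^sup>2"
    by (simp add: power_mult_distrib field_le_epsilon)
  show "0 \<le> norm x * sn v" by (simp add: A.sn_nonneg)
qed

lemma sn_mult_right: "sn (v * x) \<le> norm x * sn v"
  using sn_mult_left [of "x\<^sup>\<star>" "v\<^sup>\<star>"] sn_star [of "v * x"] by (simp add: star_mult norm_star sn_star)

lemma sn_le_norm: "sn x \<le> norm x"
  using sn_mult_left [of x 1] by (simp add: sn_one)

lemma trace_le_norm: "cmod (\<tau> x) \<le> norm x"
  using A.cauchy_schwarz [of 1 x] sn_le_norm [of x] by (simp add: sn_one)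

text \<open>GNS space\<close>

abbreviation cau :: "(nat \<Rightarrow> 'a) \<Rightarrow> bool"
  where "cau x \<equiv> \<forall>e>0. \<exists>M. \<forall>m\<ge>M. \<forall>n\<ge>M. sn (x m - x n) < e"
abbreviation "gl \<equiv> gns_limit \<tau>"
abbreviation "H \<equiv> gns_space \<tau>"
definition iota :: "'a \<Rightarrow> 'a \<Rightarrow> complex" where "iota b = (\<lambda>a. \<tau> (a\<^sup>\<star> * b))"

lemma gl_iff: "gl x \<eta> \<longleftrightarrow> cau x \<and> (\<forall>a. (\<lambda>n. \<tau> (a\<^sup>\<star> * x n)) \<longlonglongrightarrow> \<eta> a)"
  by (simp add: gns_limit_def seminorm_sn)

lemma carrier_iff: "\<eta> \<in> hcarrier H \<longleftrightarrow> (\<exists>x. gl x \<eta>)"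
  by (simp add: gns_space_def)

lemma cau_bounded:
  assumes "cau x"
  obtains B M where "\<forall>n\<ge>M. sn (x n) \<le> B" "B \<ge> 0"
proof -
  have "\<exists>M. \<forall>m\<ge>M. \<forall>n\<ge>M. sn (x m - x n) < 1"
    by (rule assms [rule_format]) simp
  then obtain M where M: "\<forall>m\<ge>M. \<forall>n\<ge>M. sn (x m - x n) < 1" ..
  have "sn (x n) \<le> sn (x M) + 1" if "n \<ge> M" for n
  proof -
    have "sn (x n - x M) < 1" using M [rule_format, of n M] that by simp
    then show ?thesis using A.sn_diff_abs [of "x n" "x M"] by simp
  qed
  then have "\<forall>n\<ge>M. sn (x n) \<le> sn (x M) + 1" by (intro allI impI)
  moreover have "0 \<le> sn (x M) + 1" using A.sn_nonneg [of "x M"] by simp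
  ultimately show thesis by (rule that)
qed

lemma ip_perturb:
  assumes "(\<lambda>n. sn (x n - x' n)) \<longlonglongrightarrow> 0" "(\<lambda>n. sn (y n - y' n)) \<longlonglongrightarrow> 0" "cau y" "cau x'"
  shows "(\<lambda>n. \<tau> ((x n)\<^sup>\<star> * y n) - \<tau> ((x' n)\<^sup>\<star> * y' n)) \<longlonglongrightarrow> 0"
proof -
  obtain B M where B: "\<forall>n\<ge>M. sn (y n) \<le> B" "B \<ge> 0" by (rule cau_bounded [OF assms(3)])
  obtain C M' where C: "\<forall>n\<ge>M'. sn (x' n) \<le> C" "C \<ge> 0" by (rule cau_bounded [OF assms(4)])
  show ?thesis
  proof (rule Lim_null_comparison)
    show "(\<lambda>n. sn (x n - x' n) * B + C * sn (y n - y' n)) \<longlonglongrightarrow> 0"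
      using tendsto_add [OF tendsto_mult_right [OF assms(1), of B] tendsto_mult_left [OF assms(2), of C]] by simp
    show "\<forall>\<^sub>F n in sequentially. norm (\<tau> ((x n)\<^sup>\<star> * y n) - \<tau> ((x' n)\<^sup>\<star> * y' n)) \<le> sn (x n - x' n) * B + C * sn (y n - y' n)"
      unfolding eventually_sequentially
    proof (intro exI [of _ "max M M'"] allI impI)
      fix n assume n: "max M M' \<le> n"
      have "\<tau> ((x n)\<^sup>\<star> * y n) - \<tau> ((x' n)\<^sup>\<star> * y' n) = \<tau> ((x n - x' n)\<^sup>\<star> * y n) + \<tau> ((x' n)\<^sup>\<star> * (y n - y' n))"
        by (simp add: A.diff_left A.diff_right)
      also have "cmod \<dots> \<le> sn (x n - x' n) * sn (y n) + sn (x' n) * sn (y n - y' n)"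
        by (intro norm_triangle_mono A.cauchy_schwarz) auto
      also have "\<dots> \<le> sn (x n - x' n) * B + C * sn (y n - y' n)"
        using n B(1) [rule_format, of n] C(1) [rule_format, of n]
        by (intro add_mono mult_left_mono mult_right_mono) (simp_all add: A.sn_nonneg)
      finally show "norm (\<tau> ((x n)\<^sup>\<star> * y n) - \<tau> ((x' n)\<^sup>\<star> * y' n)) \<le> sn (x n - x' n) * B + C * sn (y n - y' n)" .
    qed
  qed
qed

lemma weak_null:
  assumes "cau z" "\<And>a. (\<lambda>n. \<tau> (a\<^sup>\<star> * z n)) \<longlonglongrightarrow> 0"
  shows "(\<lambda>n. sn (z n)) \<longlonglongrightarrow> 0"
proof -
  obtain B M0 where B: "\<forall>n\<ge>M0. sn (z n) \<le> B" "B \<ge> 0" by (rule cau_bounded [OF assms(1)])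
  have "(\<lambda>n. (sn (z n))\<^sup>2) \<longlonglongrightarrow> 0"
  proof (rule LIMSEQ_I)
    fix r :: real assume r: "r > 0"
    define e where "e = r / (2 * (B + 1))"
    have e: "e > 0" "e * B < r / 2" using r B(2) by (auto simp: e_def field_simps)
    obtain M1 where M1: "\<forall>m\<ge>M1. \<forall>n\<ge>M1. sn (z m - z n) < e" using assms(1) e(1) by blast
    define M where "M = max M0 M1"
    obtain M2 where M2: "\<forall>n\<ge>M2. cmod (\<tau> ((z M)\<^sup>\<star> * z n)) < r / 2"
      using LIMSEQ_D [OF assms(2) [of "z M"], of "r / 2"] r by auto
    have "norm ((sn (z n))\<^sup>2 - 0) < r" if n: "n \<ge> max M M2" for n
    proof -
      have "(sn (z n))\<^sup>2 = Re (\<tau> ((z M)\<^sup>\<star> * z n)) + Re (\<tau> ((z n - z M)\<^sup>\<star> * z n))"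
        by (simp add: A.sn_sq A.diff_left)
      also have "Re (\<tau> ((z M)\<^sup>\<star> * z n)) < r / 2"
        using M2 [rule_format, of n] n complex_Re_le_cmod [of "\<tau> ((z M)\<^sup>\<star> * z n)"] by simp
      also have "Re (\<tau> ((z n - z M)\<^sup>\<star> * z n)) \<le> sn (z n - z M) * sn (z n)" by (rule A.Re_ip_le) auto
      also have "\<dots> \<le> e * B"
        using M1 [rule_format, of n M] B n e by (intro mult_mono) (auto simp: M_def A.sn_nonneg less_imp_le)
      also note e(2)
      finally show ?thesis by simp
    qed
    then show "\<exists>no. \<forall>n\<ge>no. norm ((sn (z n))\<^sup>2 - 0) < r" by blast
  qed
  then have "(\<lambda>n. sqrt ((sn (z n))\<^sup>2)) \<longlonglongrightarrow> sqrt 0" by (rule tendsto_real_sqrt)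
  then show ?thesis by (simp add: A.sn_nonneg)
qed

lemma cau_diff: "cau x \<Longrightarrow> cau y \<Longrightarrow> cau (\<lambda>n. x n - y n)"
proof (intro allI impI)
  fix e :: real assume "cau x" "cau y" and e: "e > 0"
  obtain M where M: "\<forall>m\<ge>M. \<forall>n\<ge>M. sn (x m - x n) < e / 2" using \<open>cau x\<close> e half_gt_zero by blast
  obtain M' where M': "\<forall>m\<ge>M'. \<forall>n\<ge>M'. sn (y m - y n) < e / 2" using \<open>cau y\<close> e half_gt_zero by blast
  have "sn (x m - y m - (x n - y n)) < e" if "m \<ge> max M M'" "n \<ge> max M M'" for m n
  proof -
    have "sn (x m - y m - (x n - y n)) \<le> sn (x m - x n) + sn (y m - y n)"
      using A.sn_triangle_diff [of "x m - x n" "y m - y n"] by (simp add: algebra_simps)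
    also have "\<dots> < e / 2 + e / 2" using M [rule_format, of m n] M' [rule_format, of m n] that by (intro add_strict_mono) auto
    finally show ?thesis by simp
  qed
  then show "\<exists>M. \<forall>m\<ge>M. \<forall>n\<ge>M. sn (x m - y m - (x n - y n)) < e" by blast
qed

lemma gl_scale: "gl x \<eta> \<Longrightarrow> gl (\<lambda>n. c *\<^sub>C x n) (c *\<^sub>C \<eta>)"
proof -
  assume x: "gl x \<eta>"
  have "\<exists>M. \<forall>m\<ge>M. \<forall>n\<ge>M. sn (c *\<^sub>C x m - c *\<^sub>C x n) < e" if e: "e > 0" for e
  proof -
    have "e / (cmod c + 1) > 0" using e by (simp add: add_nonneg_pos)
    then obtain M where M: "\<forall>m\<ge>M. \<forall>n\<ge>M. sn (x m - x n) < e / (cmod c + 1)"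
      using x unfolding gl_iff by blast
    have "sn (c *\<^sub>C x m - c *\<^sub>C x n) < e" if mn: "m \<ge> M" "n \<ge> M" for m n
    proof -
      have "sn (c *\<^sub>C x m - c *\<^sub>C x n) = cmod c * sn (x m - x n)"
        by (simp add: A.sn_scale flip: scaleC_simps)
      also have "\<dots> \<le> (cmod c + 1) * sn (x m - x n)"
        by (intro mult_right_mono) (auto simp: A.sn_nonneg)
      also have "\<dots> < (cmod c + 1) * (e / (cmod c + 1))"
        using M [rule_format, of m n] mn by (intro mult_strict_left_mono) (auto simp: add_nonneg_pos)
      also have "\<dots> = e" by (smt (verit) norm_ge_zero nonzero_mult_div_cancel_left times_divide_eq_right)
      finally show ?thesis .
    qed
    then show ?thesis by blast
  qed
  then show ?thesis
    using x by (auto simp: gl_iff mult_scaleC_right t_scale scaleC_fun_def scaleC_complex_def intro!: tendsto_mult_left)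
qed

lemma gl_diff: "gl x \<eta> \<Longrightarrow> gl y \<zeta> \<Longrightarrow> gl (\<lambda>n. x n - y n) (\<eta> - \<zeta>)"
proof -
  assume x: "gl x \<eta>" and y: "gl y \<zeta>"
  have "cau (\<lambda>n. x n - y n)" by (rule cau_diff) (use x y in \<open>simp_all add: gl_iff\<close>)
  moreover have "(\<lambda>n. \<tau> (a\<^sup>\<star> * (x n - y n))) \<longlonglongrightarrow> (\<eta> - \<zeta>) a" for a
    using x y by (auto simp: gl_iff right_diff_distrib t_diff intro!: tendsto_diff)
  ultimately show ?thesis by (simp add: gl_iff)
qed

lemma gl_iota: "gl (\<lambda>n. b) (iota b)"
  by (simp add: gl_iff iota_def)

lemma gl_zero: "gl (\<lambda>n. 0) 0"
  using gl_iota [of 0] t_scale [of 0 0] by (simp add: iota_def zero_fun_def scaleC_simps)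

lemma gl_add: "gl x \<eta> \<Longrightarrow> gl y \<zeta> \<Longrightarrow> gl (\<lambda>n. x n + y n) (\<eta> + \<zeta>)"
  using gl_diff [of x \<eta> "\<lambda>n. 0 - y n" "0 - \<zeta>"] gl_diff [OF gl_zero] by simp

lemma gl_unique_rep: "gl x \<eta> \<Longrightarrow> gl x' \<eta> \<Longrightarrow> (\<lambda>n. sn (x n - x' n)) \<longlonglongrightarrow> 0"
  using gl_diff [of x \<eta> x' \<eta>] by (intro weak_null) (auto simp: gl_iff)

lemma ip_convergent:
  assumes "cau x" "cau y"
  shows "convergent (\<lambda>n. \<tau> ((x n)\<^sup>\<star> * y n))"
proof -
  obtain B M0 where B: "\<forall>n\<ge>M0. sn (x n) \<le> B" "B \<ge> 0" by (rule cau_bounded [OF assms(1)])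
  obtain C M1 where C: "\<forall>n\<ge>M1. sn (y n) \<le> C" "C \<ge> 0" by (rule cau_bounded [OF assms(2)])
  have "Cauchy (\<lambda>n. \<tau> ((x n)\<^sup>\<star> * y n))"
  proof (rule metric_CauchyI)
    fix r :: real assume r: "r > 0"
    define e where "e = r / (B + C + 1)"
    have e: "e > 0" "e * C + B * e < r"
    proof -
      show "e > 0" using r B C by (simp add: e_def)
      then have "e * C + B * e < e * (B + C + 1)" by (simp add: algebra_simps)
      also have "\<dots> = r" using B C by (simp add: e_def)
      finally show "e * C + B * e < r" .
    qed
    obtain M2 where M2: "\<forall>m\<ge>M2. \<forall>n\<ge>M2. sn (x m - x n) < e" using assms(1) e by blast
    obtain M3 where M3: "\<forall>m\<ge>M3. \<forall>n\<ge>M3. sn (y m - y n) < e" using assms(2) e by blast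
    define M where "M = max (max M0 M1) (max M2 M3)"
    have "dist (\<tau> ((x m)\<^sup>\<star> * y m)) (\<tau> ((x n)\<^sup>\<star> * y n)) < r" if mn: "m \<ge> M" "n \<ge> M" for m n
    proof -
      have "\<tau> ((x m)\<^sup>\<star> * y m) - \<tau> ((x n)\<^sup>\<star> * y n) = \<tau> ((x m - x n)\<^sup>\<star> * y m) + \<tau> ((x n)\<^sup>\<star> * (y m - y n))"
        by (simp add: A.diff_left A.diff_right)
      also have "cmod \<dots> \<le> sn (x m - x n) * sn (y m) + sn (x n) * sn (y m - y n)"
        by (intro norm_triangle_mono A.cauchy_schwarz) auto
      also have "\<dots> \<le> e * C + B * e"
        using mn M2 [rule_format, of m n] M3 [rule_format, of m n] B C e
        by (intro add_mono mult_mono) (auto simp: M_def A.sn_nonneg less_imp_le)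
      also note e(2)
      finally show ?thesis by (simp add: dist_norm)
    qed
    then show "\<exists>M. \<forall>m\<ge>M. \<forall>n\<ge>M. dist (\<tau> ((x m)\<^sup>\<star> * y m)) (\<tau> ((x n)\<^sup>\<star> * y n)) < r" by blast
  qed
  then show ?thesis by (rule Cauchy_convergent)
qed

lemma hinner_lim:
  assumes x: "gl x \<eta>" and y: "gl y \<zeta>"
  shows "(\<lambda>n. \<tau> ((x n)\<^sup>\<star> * y n)) \<longlonglongrightarrow> hinner H \<eta> \<zeta>"
proof -
  have c: "cau x" "cau y" using x y by (simp_all add: gl_iff)
  obtain c where c: "(\<lambda>n. \<tau> ((x n)\<^sup>\<star> * y n)) \<longlonglongrightarrow> c"
    using ip_convergent [OF c] by (auto simp: convergent_def)
  have "hinner H \<eta> \<zeta> = c"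
    unfolding gns_space_def hspace.select_convs
  proof (rule the_equality)
    show "\<exists>x y. gl x \<eta> \<and> gl y \<zeta> \<and> (\<lambda>n. \<tau> ((x n)\<^sup>\<star> * y n)) \<longlonglongrightarrow> c" using x y c by blast
    fix d assume "\<exists>x y. gl x \<eta> \<and> gl y \<zeta> \<and> (\<lambda>n. \<tau> ((x n)\<^sup>\<star> * y n)) \<longlonglongrightarrow> d"
    then obtain x' y' where x': "gl x' \<eta>" and y': "gl y' \<zeta>" and d: "(\<lambda>n. \<tau> ((x' n)\<^sup>\<star> * y' n)) \<longlonglongrightarrow> d" by blast
    have "(\<lambda>n. \<tau> ((x n)\<^sup>\<star> * y n) - \<tau> ((x' n)\<^sup>\<star> * y' n)) \<longlonglongrightarrow> 0"
      by (rule ip_perturb [OF gl_unique_rep [OF x x'] gl_unique_rep [OF y y']]) (use x' y in \<open>simp_all add: gl_iff\<close>)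
    moreover have "(\<lambda>n. \<tau> ((x n)\<^sup>\<star> * y n) - \<tau> ((x' n)\<^sup>\<star> * y' n)) \<longlonglongrightarrow> c - d" by (rule tendsto_diff [OF c d])
    ultimately have "0 = c - d" by (rule LIMSEQ_unique)
    then show "d = c" by simp
  qed
  then show ?thesis using c by simp
qed

end


context gns
begin

lemma hinner_mem:
  assumes "\<eta> \<in> hcarrier H"
  obtains x where "gl x \<eta>"
  using assms by (auto simp: carrier_iff)

lemma semi_inner_H: "semi_inner (hcarrier H) (hinner H)"
proof
  show "0 \<in> hcarrier H" using gl_zero by (auto simp: carrier_iff)
next
  fix \<eta> \<zeta> assume "\<eta> \<in> hcarrier H" "\<zeta> \<in> hcarrier H"
  then obtain x y where x: "gl x \<eta>" and y: "gl y \<zeta>" by (auto simp: carrier_iff)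
  show "\<eta> + \<zeta> \<in> hcarrier H" using gl_add [OF x y] by (auto simp: carrier_iff)
  have "(\<lambda>n. \<tau> ((y n)\<^sup>\<star> * x n)) \<longlonglongrightarrow> cnj (hinner H \<eta> \<zeta>)"
    unfolding t_herm [of "y _" "x _"] by (intro tendsto_cnj hinner_lim x y)
  then show "hinner H \<zeta> \<eta> = cnj (hinner H \<eta> \<zeta>)"
    using hinner_lim [OF y x] by (metis LIMSEQ_unique)
  show "hinner H \<eta> (c *\<^sub>C \<zeta>) = c * hinner H \<eta> \<zeta>" for c
    using tendsto_mult_left [OF hinner_lim [OF x y], of c] hinner_lim [OF x gl_scale [OF y, of c]]
    by (simp add: A.scale_right LIMSEQ_unique)
  fix \<theta> assume "\<theta> \<in> hcarrier H"
  then obtain z where z: "gl z \<theta>" by (auto simp: carrier_iff)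
  show "hinner H \<eta> (\<zeta> + \<theta>) = hinner H \<eta> \<zeta> + hinner H \<eta> \<theta>"
    using tendsto_add [OF hinner_lim [OF x y] hinner_lim [OF x z]] hinner_lim [OF x gl_add [OF y z]]
    by (simp add: A.add_right LIMSEQ_unique)
next
  fix \<eta> c assume "\<eta> \<in> hcarrier H"
  then obtain x where x: "gl x \<eta>" by (auto simp: carrier_iff)
  show "c *\<^sub>C \<eta> \<in> hcarrier H" using gl_scale [OF x] by (auto simp: carrier_iff)
  have "(\<lambda>n. Re (\<tau> ((x n)\<^sup>\<star> * x n))) \<longlonglongrightarrow> Re (hinner H \<eta> \<eta>)" by (intro tendsto_Re hinner_lim x)
  then have "0 \<le> Re (hinner H \<eta> \<eta>)"
    by (rule LIMSEQ_le_const) (use t_pos in \<open>simp add: complex_nonneg_Reals_iff\<close>)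
  moreover have "(\<lambda>n. Im (\<tau> ((x n)\<^sup>\<star> * x n))) \<longlonglongrightarrow> Im (hinner H \<eta> \<eta>)" by (intro tendsto_Im hinner_lim x)
  then have "0 = Im (hinner H \<eta> \<eta>)"
    using t_pos by (simp add: complex_nonneg_Reals_iff LIMSEQ_const_iff)
  ultimately show "hinner H \<eta> \<eta> \<in> \<real>\<^sub>\<ge>\<^sub>0" by (simp add: complex_nonneg_Reals_iff)
qed

lemma hnorm_lim: "gl x \<eta> \<Longrightarrow> (\<lambda>n. sn (x n)) \<longlonglongrightarrow> hnorm H \<eta>"
  unfolding A.sn_def hnorm_def by (intro tendsto_real_sqrt tendsto_Re hinner_lim)

lemma hnorm_iota: "hnorm H (iota b) = sn b"
  using hnorm_lim [OF gl_iota, of b] by (simp add: LIMSEQ_const_iff)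

lemma iota_mem: "iota b \<in> hcarrier H"
  using gl_iota by (auto simp: carrier_iff)

lemma iota_diff: "iota (a - b) = iota a - iota b"
  by (simp add: iota_def fun_eq_iff right_diff_distrib t_diff)

lemma iota_add: "iota (a + b) = iota a + iota b"
  by (simp add: iota_def fun_eq_iff distrib_left t_add)

lemma iota_scale: "iota (c *\<^sub>C a) = c *\<^sub>C iota a"
  by (simp add: iota_def fun_eq_iff mult_scaleC_right t_scale scaleC_fun_def scaleC_complex_def)

lemma hinner_iota: "hinner H (iota a) (iota b) = \<tau> (a\<^sup>\<star> * b)"
  using hinner_lim [OF gl_iota gl_iota, of a b] by (simp add: LIMSEQ_const_iff)

lemma gl_approx: "gl x \<eta> \<Longrightarrow> (\<lambda>k. hnorm H (\<eta> - iota (x k))) \<longlonglongrightarrow> 0"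
proof (rule LIMSEQ_I)
  fix r :: real assume x: "gl x \<eta>" and r: "r > 0"
  then obtain M where M: "\<forall>m\<ge>M. \<forall>n\<ge>M. sn (x m - x n) < r / 2" unfolding gl_iff using half_gt_zero [OF r] by blast
  have "norm (hnorm H (\<eta> - iota (x k)) - 0) < r" if k: "k \<ge> M" for k
  proof -
    have "(\<lambda>n. sn (x n - x k)) \<longlonglongrightarrow> hnorm H (\<eta> - iota (x k))" by (rule hnorm_lim [OF gl_diff [OF x gl_iota]])
    then have "hnorm H (\<eta> - iota (x k)) \<le> r / 2"
      by (rule LIMSEQ_le_const2) (use M k in \<open>auto intro!: exI [of _ M] less_imp_le\<close>)
    moreover have "0 \<le> hnorm H (\<eta> - iota (x k))"
      using hnorm_lim [OF gl_diff [OF x gl_iota], of "x k"] by (rule LIMSEQ_le_const) (simp add: A.sn_nonneg)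
    ultimately show ?thesis using r by simp
  qed
  then show "\<exists>no. \<forall>k\<ge>no. norm (hnorm H (\<eta> - iota (x k)) - 0) < r" by blast
qed

lemma iota_dense:
  assumes "\<eta> \<in> hcarrier H" "e > 0"
  obtains b where "hnorm H (\<eta> - iota b) < e"
proof -
  obtain x where x: "gl x \<eta>" using assms by (auto simp: carrier_iff)
  have "\<forall>\<^sub>F k in sequentially. hnorm H (\<eta> - iota (x k)) < e"
    using order_tendstoD(2) [OF gl_approx [OF x] assms(2)] .
  then obtain k where "hnorm H (\<eta> - iota (x k)) < e" by (auto simp: eventually_sequentially)
  then show thesis by (rule that)
qed

lemma complete_H:
  assumes X: "range X \<subseteq> hcarrier H" and cauchy: "\<forall>e>0. \<exists>M. \<forall>m\<ge>M. \<forall>n\<ge>M. hnorm H (X m - X n) < e"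
  shows "\<exists>\<eta>\<in>hcarrier H. (\<lambda>n. hnorm H (X n - \<eta>)) \<longlonglongrightarrow> 0"
proof -
  interpret G: semi_inner "hcarrier H" "hinner H" by (rule semi_inner_H)
  have hn: "hnorm H = G.sn" by (simp add: hnorm_def G.sn_def fun_eq_iff)
  have X': "X n \<in> hcarrier H" for n using X by blast
  have "\<exists>b. hnorm H (X n - iota b) < 1 / Suc n" for n
    by (rule iota_dense [OF X', of "1 / Suc n" n]) auto
  then obtain x where x: "\<And>n. hnorm H (X n - iota (x n)) < 1 / Suc n" by metis
  have x0: "(\<lambda>n. hnorm H (X n - iota (x n))) \<longlonglongrightarrow> 0"
  proof (rule Lim_null_comparison)
    show "\<forall>\<^sub>F n in sequentially. norm (hnorm H (X n - iota (x n))) \<le> 1 / Suc n"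
      using x by (simp add: hn G.sn_nonneg G.diff_mem X' iota_mem less_imp_le)
    show "(\<lambda>n. 1 / real (Suc n)) \<longlonglongrightarrow> 0" using LIMSEQ_inverse_real_of_nat by (simp add: inverse_eq_divide)
  qed
  have cx: "cau x"
  proof (intro allI impI)
    fix e :: real assume e: "e > 0"
    have e3: "e / 3 > 0" using e by simp
    obtain M where M: "\<forall>m\<ge>M. \<forall>n\<ge>M. hnorm H (X m - X n) < e / 3" using cauchy e3 by blast
    obtain M' where M': "\<forall>n\<ge>M'. norm (hnorm H (X n - iota (x n)) - 0) < e / 3"
      using LIMSEQ_D [OF x0 e3] by blast
    have "sn (x m - x n) < e" if mn: "m \<ge> max M M'" "n \<ge> max M M'" for m n
    proof -
      have "sn (x m - x n) = G.sn (iota (x m) - iota (x n))"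
        by (simp add: hnorm_iota flip: hn iota_diff)
      moreover have "G.sn (iota (x m) - iota (x n)) \<le> G.sn (iota (x m) - X m) + G.sn (X m - iota (x n))"
        by (rule G.sn_triangle3) (auto simp: iota_mem X')
      moreover have "G.sn (X m - iota (x n)) \<le> G.sn (X m - X n) + G.sn (X n - iota (x n))"
        by (rule G.sn_triangle3) (auto simp: iota_mem X')
      moreover have "G.sn (iota (x m) - X m) = G.sn (X m - iota (x m))"
        by (rule G.sn_minus_commute) (auto simp: iota_mem X')
      moreover have "G.sn (X m - X n) < e / 3" using M [rule_format, of m n] mn by (simp add: hn)
      moreover have "G.sn (X m - iota (x m)) < e / 3" "G.sn (X n - iota (x n)) < e / 3"
        using M' [rule_format, of m] M' [rule_format, of n] mn by (simp_all add: hn)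
      ultimately show ?thesis by linarith
    qed
    then show "\<exists>M. \<forall>m\<ge>M. \<forall>n\<ge>M. sn (x m - x n) < e" by blast
  qed
  have "\<exists>l. (\<lambda>n. \<tau> (a\<^sup>\<star> * x n)) \<longlonglongrightarrow> l" for a
  proof -
    have "cau (\<lambda>n. a)" by simp
    from ip_convergent [OF this cx] show ?thesis by (simp add: convergent_def)
  qed
  then obtain \<eta> where \<eta>: "\<And>a. (\<lambda>n. \<tau> (a\<^sup>\<star> * x n)) \<longlonglongrightarrow> \<eta> a" by metis
  have gl: "gl x \<eta>" using cx \<eta> by (simp add: gl_iff)
  then have mem: "\<eta> \<in> hcarrier H" by (auto simp: carrier_iff)
  have "(\<lambda>n. hnorm H (X n - \<eta>)) \<longlonglongrightarrow> 0"
  proof (rule Lim_null_comparison)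
    show "(\<lambda>n. hnorm H (X n - iota (x n)) + hnorm H (\<eta> - iota (x n))) \<longlonglongrightarrow> 0"
      using tendsto_add [OF x0 gl_approx [OF gl]] by simp
    have "G.sn (X n - \<eta>) \<le> G.sn (X n - iota (x n)) + G.sn (\<eta> - iota (x n))" for n
      using G.sn_triangle3 [of "X n" "iota (x n)" \<eta>] G.sn_minus_commute [of "iota (x n)" \<eta>]
      by (simp add: iota_mem X' mem)
    then show "\<forall>\<^sub>F n in sequentially. norm (hnorm H (X n - \<eta>)) \<le> hnorm H (X n - iota (x n)) + hnorm H (\<eta> - iota (x n))"
      by (simp add: hn G.sn_nonneg G.diff_mem X' mem)
  qed
  then show ?thesis using mem by blast
qed

lemma hilbert_H: "hilbert_space H"
proof -
  interpret G: semi_inner "hcarrier H" "hinner H" by (rule semi_inner_H)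
  have def0: "\<eta> = 0" if mem: "\<eta> \<in> hcarrier H" and null: "hinner H \<eta> \<eta> = 0" for \<eta>
  proof -
    obtain x where x: "gl x \<eta>" using mem unfolding carrier_iff by blast
    have n0: "(\<lambda>n. sn (x n)) \<longlonglongrightarrow> 0" using hnorm_lim [OF x] null by (simp add: hnorm_def)
    have "\<eta> a = 0" for a
    proof -
      have "(\<lambda>n. \<tau> (a\<^sup>\<star> * x n)) \<longlonglongrightarrow> 0"
      proof (rule Lim_null_comparison)
        show "\<forall>\<^sub>F n in sequentially. norm (\<tau> (a\<^sup>\<star> * x n)) \<le> sn a * sn (x n)"
          using A.cauchy_schwarz by simp
        show "(\<lambda>n. sn a * sn (x n)) \<longlonglongrightarrow> 0" using tendsto_mult_left [OF n0, of "sn a"] by simp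
      qed
      moreover have "(\<lambda>n. \<tau> (a\<^sup>\<star> * x n)) \<longlonglongrightarrow> \<eta> a" using x by (simp add: gl_iff)
      ultimately show ?thesis using LIMSEQ_unique by blast
    qed
    then show ?thesis by (simp add: fun_eq_iff)
  qed
  show ?thesis
    unfolding hilbert_space_def
    by (intro conjI ballI allI impI)
      (assumption | rule G.zero_mem G.add_mem G.scale_mem G.add_right G.scale_right G.pos G.herm def0 complete_H
        | erule conjunct1 | erule conjunct2)+
qed

end

sublocale gns \<subseteq> L: hilb "gns_space \<tau>"
  by unfold_locales (rule hilbert_H)

context gns
begin

lemma gl_map:
  assumes f: "\<And>x y. f (x - y) = f x - f y" "\<And>x. sn (f x) \<le> C * sn x" "\<And>b x. \<tau> (b\<^sup>\<star> * f x) = \<tau> ((g b)\<^sup>\<star> * x)"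
    and x: "gl x \<eta>" and C: "C \<ge> 0"
  shows "gl (\<lambda>n. f (x n)) (\<lambda>b. \<eta> (g b))" "L.sn (\<lambda>b. \<eta> (g b)) \<le> C * L.sn \<eta>"
proof -
  show 1: "gl (\<lambda>n. f (x n)) (\<lambda>b. \<eta> (g b))"
    unfolding gl_iff
  proof (intro conjI allI impI)
    fix e :: real assume e: "e > 0"
    have "e / (C + 1) > 0" using e C by simp
    then obtain M where M: "\<forall>m\<ge>M. \<forall>n\<ge>M. sn (x m - x n) < e / (C + 1)" using x unfolding gl_iff by blast
    have "sn (f (x m) - f (x n)) < e" if mn: "m \<ge> M" "n \<ge> M" for m n
    proof -
      have "sn (f (x m) - f (x n)) \<le> C * sn (x m - x n)" using f(2) [of "x m - x n"] by (simp add: f(1))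
      also have "\<dots> \<le> (C + 1) * sn (x m - x n)" by (intro mult_right_mono) (auto simp: A.sn_nonneg)
      also have "\<dots> < e" using M [rule_format, of m n] mn C by (simp add: field_simps)
      finally show ?thesis .
    qed
    then show "\<exists>M. \<forall>m\<ge>M. \<forall>n\<ge>M. sn (f (x m) - f (x n)) < e" by blast
  next
    fix a show "(\<lambda>n. \<tau> (a\<^sup>\<star> * f (x n))) \<longlonglongrightarrow> \<eta> (g a)" using x by (simp add: f(3) gl_iff)
  qed
  show "L.sn (\<lambda>b. \<eta> (g b)) \<le> C * L.sn \<eta>"
    using LIMSEQ_le [OF hnorm_lim [OF 1] tendsto_mult_left [OF hnorm_lim [OF x], of C]] f(2)
    by (simp add: L.hnorm_sn)
qed

lemma gl_left: "gl x \<eta> \<Longrightarrow> gl (\<lambda>n. a * x n) (\<lambda>b. \<eta> (a\<^sup>\<star> * b))" "gl x \<eta> \<Longrightarrow> L.sn (\<lambda>b. \<eta> (a\<^sup>\<star> * b)) \<le> norm a * L.sn \<eta>"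
  using gl_map [of "\<lambda>x. a * x" "norm a" "\<lambda>b. a\<^sup>\<star> * b" x \<eta>] sn_mult_left [of a]
  by (simp_all add: right_diff_distrib star_mult star_star mult.assoc)

lemma gl_right: "gl x \<eta> \<Longrightarrow> gl (\<lambda>n. x n * a) (\<lambda>b. \<eta> (b * a\<^sup>\<star>))"
  and gl_right_bound: "gl x \<eta> \<Longrightarrow> (\<And>x. sn (x * a) \<le> C * sn x) \<Longrightarrow> C \<ge> 0 \<Longrightarrow> L.sn (\<lambda>b. \<eta> (b * a\<^sup>\<star>)) \<le> C * L.sn \<eta>"
proof -
  have c: "\<tau> (b\<^sup>\<star> * (x * a)) = \<tau> ((b * a\<^sup>\<star>)\<^sup>\<star> * x)" for b x
    using t_comm [of "b\<^sup>\<star> * x" a] by (simp add: star_mult star_star mult.assoc)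
  show "gl x \<eta> \<Longrightarrow> gl (\<lambda>n. x n * a) (\<lambda>b. \<eta> (b * a\<^sup>\<star>))"
    using gl_map(1) [of "\<lambda>x. x * a" "norm a" "\<lambda>b. b * a\<^sup>\<star>" x \<eta>] sn_mult_right c by (simp add: left_diff_distrib)
  show "gl x \<eta> \<Longrightarrow> (\<And>x. sn (x * a) \<le> C * sn x) \<Longrightarrow> C \<ge> 0 \<Longrightarrow> L.sn (\<lambda>b. \<eta> (b * a\<^sup>\<star>)) \<le> C * L.sn \<eta>"
    using gl_map(2) [of "\<lambda>x. x * a" C "\<lambda>b. b * a\<^sup>\<star>" x \<eta>] c by (simp add: left_diff_distrib)
qed

definition rop :: "'a \<Rightarrow> ('a \<Rightarrow> complex) \<Rightarrow> ('a \<Rightarrow> complex)"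
  where "rop d = (\<lambda>\<eta>\<in>hcarrier H. \<lambda>b. \<eta> (b * d\<^sup>\<star>))"

lemma map_bounded_operator:
  assumes "\<And>\<eta>. \<eta> \<in> hcarrier H \<Longrightarrow> (\<lambda>b. \<eta> (g b)) \<in> hcarrier H" "\<And>\<eta>. \<eta> \<in> hcarrier H \<Longrightarrow> L.sn (\<lambda>b. \<eta> (g b)) \<le> C * L.sn \<eta>"
  shows "(\<lambda>\<eta>\<in>hcarrier H. \<lambda>b. \<eta> (g b)) \<in> bounded_operators H"
  unfolding bounded_operators_def L.hnorm_sn
  using assms L.add_mem [unfolded plus_fun_def] L.scale_mem [unfolded scaleC_fun_def]
  by (auto simp: plus_fun_def scaleC_fun_def intro!: exI [of _ C])

lemma rep_bounded: "gns_rep \<tau> a \<in> bounded_operators H"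
  unfolding gns_rep_def using gl_left by (intro map_bounded_operator [of _ "norm a"]) (auto simp: carrier_iff)

lemma rop_mem: "\<eta> \<in> hcarrier H \<Longrightarrow> (\<lambda>b. \<eta> (b * d\<^sup>\<star>)) \<in> hcarrier H"
  using gl_right by (auto simp: carrier_iff)

lemma rop_bound: "\<eta> \<in> hcarrier H \<Longrightarrow> (\<And>x. sn (x * d) \<le> C * sn x) \<Longrightarrow> C \<ge> 0 \<Longrightarrow> L.sn (rop d \<eta>) \<le> C * L.sn \<eta>"
  using gl_right_bound by (auto simp: carrier_iff rop_def)

lemma rop_bounded: "rop d \<in> bounded_operators H"
  unfolding rop_def
  by (rule map_bounded_operator [of _ "norm d"]) (auto simp: carrier_iff intro: gl_right gl_right_bound sn_mult_right)

lemma rop_commutant: "rop d \<in> commutant H (range (gns_rep \<tau>))"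
  unfolding commutant_def
  using rop_bounded L.opD(1) [OF rep_bounded] L.opD(1) [OF rop_bounded]
  by (auto simp: rop_def gns_rep_def rop_mem mult.assoc)

lemma rop_iota: "rop d (iota b) = iota (b * d)"
proof (rule ext)
  fix x
  show "rop d (iota b) x = iota (b * d) x"
    using t_comm [of d "x\<^sup>\<star> * b"] by (simp add: rop_def iota_mem) (simp add: iota_def star_mult star_star mult.assoc)
qed

lemma rop_adjoint:
  assumes "\<eta> \<in> hcarrier H" "\<zeta> \<in> hcarrier H"
  shows "hinner H (rop d \<eta>) \<zeta> = hinner H \<eta> (rop (d\<^sup>\<star>) \<zeta>)"
proof -
  obtain x y where x: "gl x \<eta>" and y: "gl y \<zeta>" using assms by (auto simp: carrier_iff)
  have "(\<lambda>n. \<tau> ((x n * d)\<^sup>\<star> * y n)) \<longlonglongrightarrow> hinner H (rop d \<eta>) \<zeta>"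
    using hinner_lim [OF gl_right [OF x, of d] y] assms by (simp add: rop_def)
  moreover have "\<tau> ((x n * d)\<^sup>\<star> * y n) = \<tau> ((x n)\<^sup>\<star> * (y n * d\<^sup>\<star>))" for n
    using t_comm [of "d\<^sup>\<star>" "(x n)\<^sup>\<star> * y n"] by (simp add: star_mult mult.assoc)
  moreover have "(\<lambda>n. \<tau> ((x n)\<^sup>\<star> * (y n * d\<^sup>\<star>))) \<longlonglongrightarrow> hinner H \<eta> (rop (d\<^sup>\<star>) \<zeta>)"
    using hinner_lim [OF x gl_right [OF y, of "d\<^sup>\<star>"]] assms by (simp add: rop_def)
  ultimately show ?thesis using LIMSEQ_unique by auto
qed

lemma vn_rop:
  assumes "T \<in> gns_von_neumann \<tau>" "\<eta> \<in> hcarrier H"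
  shows "T (rop d \<eta>) = rop d (T \<eta>)"
  using assms rop_commutant [of d] by (simp add: gns_von_neumann_def commutant_def)

lemma vn_separating:
  assumes T: "T \<in> gns_von_neumann \<tau>" and "T (iota 1) = 0"
  shows "T = zero_operator H"
proof (rule L.op_eqI)
  show b: "T \<in> bounded_operators H" using T by (simp add: gns_von_neumann_def commutant_def)
  have "(\<lambda>\<eta>\<in>hcarrier H. \<lambda>b. 0) = zero_operator H" by (simp add: zero_operator_def zero_fun_def)
  then show z: "zero_operator H \<in> bounded_operators H"
    by (auto simp: bounded_operators_def zero_operator_def L.zero_mem L.add_mem L.scale_mem L.hnorm_sn intro!: exI [of _ 0])
  have i: "T (iota d) = 0" for d
    using vn_rop [OF T iota_mem, of d 1] assms(2) L.opD(5) [OF rop_bounded iota_mem] by (simp add: rop_iota)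
  fix \<eta> assume \<eta>: "\<eta> \<in> hcarrier H"
  then obtain x where x: "gl x \<eta>" by (auto simp: carrier_iff)
  have "(\<lambda>n. L.sn (iota (x n) - \<eta>)) \<longlonglongrightarrow> 0"
    using gl_approx [OF x] by (simp add: L.hnorm_sn L.sn_minus_commute iota_mem \<eta>)
  then have "(\<lambda>n. L.sn (T (iota (x n)) - T \<eta>)) \<longlonglongrightarrow> 0"
    by (intro L.op_tendsto [OF b] iota_mem \<eta>)
  then have "L.sn (T \<eta>) = 0"
    using L.opD(1) [OF b \<eta>] by (simp add: i L.sn_minus LIMSEQ_const_iff)
  then show "T \<eta> = zero_operator H \<eta>"
    using L.definite [OF L.opD(1) [OF b \<eta>]] \<eta> by (simp add: zero_operator_def)
qed

end


lemma star_power: "(x ^ n)\<^sup>\<star> = (x\<^sup>\<star>) ^ n" for x :: "'a::cstar_algebra"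
  by (induction n) (simp_all add: star_mult power_commutes)

lemma scaleC_sum: "c *\<^sub>C sum f I = (\<Sum>i\<in>I. c *\<^sub>C f i)" for f :: "'i \<Rightarrow> 'a::complex_vector"
  by (induction I rule: infinite_finite_induct) (simp_all add: scaleC_add_right)

lemma scaleC_diff_sum:
  "(\<Sum>i\<in>I. (f i - t) *\<^sub>C v i) = (\<Sum>i\<in>I. f i *\<^sub>C v i) - t *\<^sub>C (\<Sum>i\<in>I. v i)"
  for v :: "'i \<Rightarrow> 'a::complex_vector"
  by (simp add: scaleC_simps(6) sum_subtractf scaleC_sum)

lemma diff_midpoint: "v - (1/2 :: complex) *\<^sub>C (a + b) = (1/2 :: complex) *\<^sub>C ((v - a) + (v - b))"
  for v :: "'a::complex_vector"
proof -
  have "(1/2 :: complex) *\<^sub>C (v + v) = v"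
    unfolding scaleC_add_right by (simp add: scaleC_one flip: scaleC_add_left)
  moreover have "(v - a) + (v - b) = (v + v) - (a + b)" by simp
  ultimately show ?thesis by (simp only: scaleC_simps(5))
qed

lemma (in hilb) op_sum:
  assumes "T \<in> bounded_operators H" "\<And>i. i \<in> I \<Longrightarrow> f i \<in> hcarrier H"
  shows "T (sum f I) = (\<Sum>i\<in>I. T (f i))"
  using assms(2)
  by (induction I rule: infinite_finite_induct)
    (simp_all add: opD(5) [OF assms(1) zero_mem] opD(2) [OF assms(1)] sum_mem)

context gns
begin

lemma sn_contract:
  assumes y: "y\<^sup>\<star> = y" "norm y \<le> 1"
  shows "sn ((1 - y * y) * w) \<le> sn w" "sn (w * (1 - y * y)) \<le> sn w"
proof -
  have l: "sn ((1 - y * y) * w) \<le> sn w" for w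
  proof (rule power2_le_imp_le)
    have "(1 - y * y) * w = w - y * (y * w)" by (simp add: algebra_simps)
    then have "(sn ((1 - y * y) * w))\<^sup>2 = (sn w)\<^sup>2 - 2 * Re (\<tau> (w\<^sup>\<star> * (y * (y * w)))) + (sn (y * (y * w)))\<^sup>2"
      by (simp add: A.sn_diff_sq)
    also have "Re (\<tau> (w\<^sup>\<star> * (y * (y * w)))) = (sn (y * w))\<^sup>2"
      by (simp add: A.sn_sq star_mult y(1) mult.assoc)
    also have "(sn (y * (y * w)))\<^sup>2 \<le> (sn (y * w))\<^sup>2"
    proof (rule power_mono)
      have "sn (y * (y * w)) \<le> norm y * sn (y * w)" by (rule sn_mult_left)
      also have "\<dots> \<le> 1 * sn (y * w)" using y by (intro mult_right_mono) (simp_all add: A.sn_nonneg)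
      finally show "sn (y * (y * w)) \<le> sn (y * w)" by simp
    qed (simp add: A.sn_nonneg)
    finally show "(sn ((1 - y * y) * w))\<^sup>2 \<le> (sn w)\<^sup>2" using zero_le_power2 [of "sn (y * w)"] by linarith
  qed (simp add: A.sn_nonneg)
  then show "sn ((1 - y * y) * w) \<le> sn w" .
  have "sn (w * (1 - y * y)) = sn ((1 - y * y) * w\<^sup>\<star>)"
    using sn_star [of "w * (1 - y * y)"] by (simp add: star_mult star_diff y(1))
  also have "\<dots> \<le> sn w" using l [of "w\<^sup>\<star>"] by (simp add: sn_star)
  finally show "sn (w * (1 - y * y)) \<le> sn w" .
qed

lemma sn_contract_power:
  assumes y: "y\<^sup>\<star> = y" "norm y \<le> 1"
  shows "sn ((1 - y * y) ^ m) \<le> 1" "sn (w * (1 - y * y) ^ m) \<le> sn w"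
proof -
  show r: "sn (w * (1 - y * y) ^ m) \<le> sn w" for w
  proof (induction m)
    case (Suc m)
    have "sn (w * (1 - y * y) ^ Suc m) = sn ((w * (1 - y * y) ^ m) * (1 - y * y))"
      by (simp add: power_commutes mult.assoc)
    also have "\<dots> \<le> sn (w * (1 - y * y) ^ m)" by (rule sn_contract(2) [OF y])
    finally show ?case using Suc by simp
  qed simp
  show "sn ((1 - y * y) ^ m) \<le> 1" using r [of 1] by (simp add: sn_one)
qed

lemma sn_bump_decay:
  assumes y: "y\<^sup>\<star> = y" "norm y \<le> 1"
  shows "real (2 * m + 1) * (sn (y * (1 - y * y) ^ m))\<^sup>2 \<le> 1"
proof -
  define B where "B = 1 - y * y"
  have By: "B ^ k * y = y * B ^ k" for k
    by (rule power_commuting_commutes) (simp add: B_def algebra_simps)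
  have Bs: "(B ^ k)\<^sup>\<star> = B ^ k" for k by (simp add: star_power) (simp add: B_def star_diff star_mult y(1))
  define f where "f k = Re (\<tau> (y * y * B ^ k))" for k
  have sq: "(sn (w * B ^ l))\<^sup>2 = Re (\<tau> (w\<^sup>\<star> * w * B ^ (2 * l)))" for w l
  proof -
    have "\<tau> ((w * B ^ l)\<^sup>\<star> * (w * B ^ l)) = \<tau> (B ^ l * (w\<^sup>\<star> * w * B ^ l))"
      by (simp add: star_mult Bs mult.assoc)
    also have "\<dots> = \<tau> (w\<^sup>\<star> * w * B ^ (2 * l))"
      by (subst t_comm) (simp add: mult.assoc power_add [symmetric] mult_2)
    finally show ?thesis by (simp add: A.sn_sq)
  qed
  have odd: "0 \<le> Re (\<tau> (w\<^sup>\<star> * w * B ^ (2 * l + 1)))" if wy: "w * y = y * w" for w l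
  proof -
    have "w\<^sup>\<star> * w * B ^ (2 * l + 1) = w\<^sup>\<star> * w * B ^ (2 * l) - w\<^sup>\<star> * w * B ^ (2 * l) * y * y"
      unfolding power_add by (simp add: B_def algebra_simps)
    also have "w\<^sup>\<star> * w * B ^ (2 * l) * y * y = w\<^sup>\<star> * (w * y * y) * B ^ (2 * l)"
      using By [of "2 * l"] by (simp add: mult.assoc)
    also have "w * y * y = y * w * y" by (simp add: wy)
    finally have "\<tau> (w\<^sup>\<star> * w * B ^ (2 * l + 1)) = \<tau> (w\<^sup>\<star> * w * B ^ (2 * l)) - \<tau> ((y * w)\<^sup>\<star> * (y * w) * B ^ (2 * l))"
      by (simp add: t_diff star_mult y(1) mult.assoc) (simp add: wy flip: mult.assoc)
    then have "Re (\<tau> (w\<^sup>\<star> * w * B ^ (2 * l + 1))) = (sn (w * B ^ l))\<^sup>2 - (sn (y * w * B ^ l))\<^sup>2"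
      by (simp add: sq)
    moreover have "sn (y * w * B ^ l) \<le> sn (w * B ^ l)"
    proof -
      have "sn (y * (w * B ^ l)) \<le> norm y * sn (w * B ^ l)" by (rule sn_mult_left)
      also have "\<dots> \<le> 1 * sn (w * B ^ l)" using y by (intro mult_right_mono) (simp_all add: A.sn_nonneg)
      finally show ?thesis by (simp add: mult.assoc)
    qed
    ultimately show ?thesis by (simp add: A.sn_nonneg power_mono)
  qed
  have even: "0 \<le> Re (\<tau> (w\<^sup>\<star> * w * B ^ (2 * l)))" for w l
    unfolding sq [symmetric] by simp
  have pos: "0 \<le> Re (\<tau> (w\<^sup>\<star> * w * B ^ k))" if "w * y = y * w" for w k
  proof (cases "even k")
    case True
    then show ?thesis using even [of w "k div 2"] by simp
  next
    case False
    then show ?thesis using odd [OF that, of "k div 2"] by simp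
  qed
  have step: "f (Suc k) \<le> f k" for k
  proof -
    have "y * y * B ^ k - y * y * B ^ Suc k = (y * y)\<^sup>\<star> * (y * y) * B ^ k"
      by (simp add: B_def star_mult y(1) algebra_simps)
    then have "f k - f (Suc k) = Re (\<tau> ((y * y)\<^sup>\<star> * (y * y) * B ^ k))"
      unfolding f_def by (metis minus_complex.sel(1) t_diff)
    then show ?thesis using pos [of "y * y" k] by (simp add: mult.assoc)
  qed
  have anti: "f (2 * m) \<le> f k" if "k \<le> 2 * m" for k
    using that lift_Suc_antimono_le [of f, OF step] by blast
  have "(\<Sum>k<2 * m + 1. f k) = Re (\<tau> (1 - B ^ (2 * m + 1)))"
  proof -
    have "(\<Sum>k<n. f k) = Re (\<tau> (1 - B ^ n))" for n
    proof (induction n)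
      case 0
      then show ?case using t_diff [of 1 1] by simp
    next
      case (Suc n)
      have "f n = Re (\<tau> (B ^ n - B ^ Suc n))" by (simp add: f_def B_def algebra_simps)
      then show ?case using Suc by (simp add: t_diff)
    qed
    then show ?thesis .
  qed
  also have "\<dots> \<le> 1" using pos [of 1 "2 * m + 1"] by (simp add: t_diff t_one)
  finally have "(\<Sum>k<2 * m + 1. f k) \<le> 1" .
  moreover have "real (2 * m + 1) * f (2 * m) \<le> (\<Sum>k<2 * m + 1. f k)"
    using sum_bounded_below [of "{..<2 * m + 1}" "f (2 * m)" f] anti by simp
  moreover have "f (2 * m) = (sn (y * B ^ m))\<^sup>2" using sq [of y m] by (simp add: f_def y(1))
  ultimately show ?thesis by (simp add: B_def)
qed

text \<open>the conditional expectation free argument\<close>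

lemma star_real_coeff:
  assumes p: "p \<in> gns_von_neumann \<tau>" "p \<in> projections H"
  shows "Re (hinner H (iota (a\<^sup>\<star>)) (p (iota 1))) = Re (hinner H (iota a) (p (iota 1)))"
proof -
  note pr = L.projD [OF p(2)]
  have "hinner H (iota (a\<^sup>\<star>)) (p (iota 1)) = hinner H (rop (a\<^sup>\<star>) (iota 1)) (p (iota 1))"
    by (simp add: rop_iota)
  also have "\<dots> = hinner H (iota 1) (p (rop a (iota 1)))"
    using rop_adjoint [OF iota_mem pr(1) [OF iota_mem], of "a\<^sup>\<star>" 1 1] vn_rop [OF p(1) iota_mem, of a 1]
    by (simp add: star_star)
  also have "\<dots> = hinner H (p (iota 1)) (iota a)"
    using pr(3) [OF iota_mem iota_mem, of 1 a] by (simp add: rop_iota)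
  also have "\<dots> = cnj (hinner H (iota a) (p (iota 1)))"
    by (rule L.herm) (simp_all add: iota_mem pr)
  finally show ?thesis by simp
qed

lemma bump_self_adjoint:
  assumes "x\<^sup>\<star> = x" "c > 0" "(norm x + \<bar>t\<bar>)\<^sup>2 \<le> c"
  defines "y \<equiv> (1 / sqrt c) *\<^sub>R (x - complex_of_real t *\<^sub>C 1)"
  shows "y\<^sup>\<star> = y" "norm y \<le> 1" "bump c t m x = (1 - y * y) ^ m" "sqrt c *\<^sub>R y = x - complex_of_real t *\<^sub>C 1"
proof -
  show "y\<^sup>\<star> = y" using assms by (simp add: y_def star_scaleR star_diff star_scaleC)
  have "norm (x - complex_of_real t *\<^sub>C 1) \<le> norm x + \<bar>t\<bar>"
    using norm_triangle_ineq4 [of x "complex_of_real t *\<^sub>C 1"] by (simp add: norm_scaleC)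
  also have "\<dots> \<le> sqrt c" using assms(3) by (simp add: real_le_rsqrt)
  finally show "norm y \<le> 1" using assms(2) by (simp add: y_def)
  have "y * y = complex_of_real (1 / c) *\<^sub>C ((x - complex_of_real t *\<^sub>C 1) * (x - complex_of_real t *\<^sub>C 1))"
  proof -
    have "y * y = (1 / sqrt c * (1 / sqrt c)) *\<^sub>R ((x - complex_of_real t *\<^sub>C 1) * (x - complex_of_real t *\<^sub>C 1))"
      by (simp add: y_def)
    also have "1 / sqrt c * (1 / sqrt c) = 1 / c" using assms(2) by (simp flip: real_sqrt_mult)
    finally show ?thesis by (simp only: scaleR_scaleC)
  qed
  then show "bump c t m x = (1 - y * y) ^ m" by (simp add: bump_def)
  show "sqrt c *\<^sub>R y = x - complex_of_real t *\<^sub>C 1" using assms(2) by (simp add: y_def)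
qed


lemma projections_orthogonal:
  fixes M :: nat
  assumes p: "\<And>j. j < M \<Longrightarrow> p j \<in> projections H" and sum: "\<And>w. w \<in> hcarrier H \<Longrightarrow> (\<Sum>j<M. p j w) = w"
    and jk: "j < M" "k < M" "j \<noteq> k" and w: "w \<in> hcarrier H"
  shows "hinner H (p j w) (p k w) = 0"
proof -
  note pr = L.projD [OF p]
  define u where "u = p k w"
  have u: "u \<in> hcarrier H" using pr(1) [OF jk(2) w] by (simp add: u_def)
  have "complex_of_real ((L.sn u)\<^sup>2) = hinner H u (\<Sum>i<M. p i u)"
    using L.ip_self [OF u] sum [OF u] by simp
  also have "\<dots> = (\<Sum>i<M. hinner H u (p i u))"
    by (rule L.ip_sum_right [OF u]) (use pr(1) u in simp)
  also have "\<dots> = (\<Sum>i<M. complex_of_real ((L.sn (p i u))\<^sup>2))"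
    by (intro sum.cong refl) (use pr(4) u in simp)
  finally have "(L.sn u)\<^sup>2 = (\<Sum>i<M. (L.sn (p i u))\<^sup>2)" by (simp only: of_real_sum [symmetric] of_real_eq_iff)
  also have "\<dots> = (L.sn (p k u))\<^sup>2 + (\<Sum>i\<in>{..<M}-{k}. (L.sn (p i u))\<^sup>2)"
    by (rule sum.remove) (use jk in simp_all)
  also have "p k u = u" using pr(2) [OF jk(2) w] by (simp add: u_def)
  finally have "(\<Sum>i\<in>{..<M}-{k}. (L.sn (p i u))\<^sup>2) = 0" by simp
  then have "(L.sn (p j u))\<^sup>2 = 0"
    using jk by (subst (asm) sum_nonneg_eq_0_iff) auto
  then have "p j u = 0" using L.definite [OF pr(1) [OF jk(1) u]] by simp
  then have "hinner H w (p j u) = 0" by (simp add: L.zero_right w)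
  then show ?thesis using pr(3) [OF jk(1) w u] by (simp add: u_def)
qed

theorem small_atoms:
  assumes diff: "diffuse H (gns_von_neumann \<tau>)" and eta: "\<eta> > 0"
  obtains x :: 'a and c m where "x\<^sup>\<star> = x" "c > 0" "even m"
    "\<forall>t. \<bar>t\<bar> \<le> 2 * (norm x + 1) \<longrightarrow> Re (\<tau> (bump c t m x)) < \<eta>"
proof -
  define S where "S = commutant H (range (gns_rep \<tau>))"
  have vn: "gns_von_neumann \<tau> = commutant H S" by (simp add: gns_von_neumann_def S_def)
  interpret V: vn_projections H S "iota 1"
  proof
    show "S \<subseteq> bounded_operators H" by (auto simp: S_def commutant_def)
    show "iota 1 \<in> hcarrier H" by (rule iota_mem)
    show "T = zero_operator H" if "T \<in> commutant H S" "T (iota 1) = 0" for T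
      using vn_separating that by (simp add: vn)
    show "diffuse H (commutant H S)" using diff by (simp add: vn)
  qed
  have "V.shredded ((\<eta> / 4)\<^sup>2) (\<lambda>x\<in>hcarrier H. x)" by (rule V.shredded_identity) (use eta in simp)
  then obtain ps where ps: "set ps \<subseteq> V.P" "\<forall>q\<in>set ps. V.weight q \<le> (\<eta> / 4)\<^sup>2"
    "\<forall>w\<in>hcarrier H. (\<lambda>x\<in>hcarrier H. x) w = (\<Sum>q\<leftarrow>ps. q w)"
    unfolding V.shredded_def by (elim exE conjE) (rule that)
  define M where "M = length ps"
  define p where "p j = ps ! j" for j
  define \<xi> where "\<xi> = iota 1"
  define \<gamma> where "\<gamma> = \<eta> / 16"
  have gam: "\<gamma> > 0" using eta by (simp add: \<gamma>_def)
  have xi: "\<xi> \<in> hcarrier H" by (simp add: \<xi>_def iota_mem)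
  have pP: "p j \<in> V.P" if "j < M" for j using ps(1) that by (auto simp: p_def M_def)
  have pp: "p j \<in> projections H" and pvn: "p j \<in> gns_von_neumann \<tau>" if "j < M" for j
    using V.PD [OF pP [OF that]] by (simp_all add: vn)
  note pr = L.projD [OF pp]
  have psum: "(\<Sum>j<M. p j w) = w" if "w \<in> hcarrier H" for w
    using ps(3) that by (simp add: p_def M_def sum_list_sum_nth atLeast0LessThan)
  have small: "L.sn (p j \<xi>) \<le> \<eta> / 4" if "j < M" for j
  proof (rule power2_le_imp_le)
    show "(L.sn (p j \<xi>))\<^sup>2 \<le> (\<eta> / 4)\<^sup>2"
      using ps(2) that by (auto simp: V.weight_def p_def M_def \<xi>_def)
  qed (use eta in simp)
  have sni: "L.sn (iota b) = sn b" for b by (simp add: hnorm_iota flip: L.hnorm_sn)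
  text \<open>approximate the operator\<close>
  define v where "v = (\<Sum>j<M. of_nat j *\<^sub>C p j \<xi>)"
  have pxi: "of_nat j *\<^sub>C p j \<xi> \<in> hcarrier H" if "j < M" for j
    using pr(1) [OF that xi] by (rule L.scale_mem)
  have v: "v \<in> hcarrier H" unfolding v_def by (rule L.sum_mem) (use pxi in auto)
  obtain a where a: "hnorm H (v - iota a) < \<gamma>" using iota_dense [OF v gam] .
  define x where "x = (1/2 :: complex) *\<^sub>C (a + a\<^sup>\<star>)"
  have xs: "x\<^sup>\<star> = x" by (simp add: x_def star_scaleC star_add star_star add.commute)
  have ga: "L.sn (iota a - v) \<le> \<gamma>"
    using a L.sn_minus_commute [OF v iota_mem, of a] by (simp add: L.hnorm_sn)
  have "Re (hinner H (iota (a\<^sup>\<star>)) v) = Re (hinner H (iota a) v)"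
  proof -
    have "Re (hinner H (iota b) v) = (\<Sum>j<M. real j * Re (hinner H (iota b) (p j \<xi>)))" for b
      unfolding v_def using pxi pr(1) xi
      by (subst L.ip_sum_right [OF iota_mem]) (auto simp: L.scale_right iota_mem intro!: sum.cong)
    then show ?thesis using star_real_coeff [OF pvn pp] by (simp add: \<xi>_def)
  qed
  then have "(L.sn (iota (a\<^sup>\<star>) - v))\<^sup>2 = (L.sn (iota a - v))\<^sup>2"
    by (simp add: L.sn_diff_sq iota_mem v sni sn_star)
  then have ga': "L.sn (iota (a\<^sup>\<star>) - v) \<le> \<gamma>"
    using ga L.sn_nonneg [OF L.diff_mem [OF iota_mem v]] by simp
  have gx: "L.sn (v - iota x) \<le> \<gamma>"
  proof -
    have "v - iota x = (1/2 :: complex) *\<^sub>C ((v - iota a) + (v - iota (a\<^sup>\<star>)))"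
      unfolding x_def iota_scale iota_add by (rule diff_midpoint)
    moreover have m: "v - iota a \<in> hcarrier H" "v - iota (a\<^sup>\<star>) \<in> hcarrier H" by (simp_all add: L.diff_mem v iota_mem)
    ultimately have "L.sn (v - iota x) = (1/2) * L.sn ((v - iota a) + (v - iota (a\<^sup>\<star>)))"
      by (simp only: L.sn_scale [OF L.add_mem [OF m]]) simp
    also have "\<dots> \<le> (1/2) * (L.sn (v - iota a) + L.sn (v - iota (a\<^sup>\<star>)))" using L.sn_triangle [OF m] by simp
    also have "\<dots> \<le> (1/2) * (\<gamma> + \<gamma>)"
      using ga ga' L.sn_minus_commute [OF v iota_mem, of a] L.sn_minus_commute [OF v iota_mem, of "a\<^sup>\<star>"] by simp
    finally show ?thesis by simp
  qed
  text \<open>parameters\<close>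
  define c where "c = (3 * (norm x + 1))\<^sup>2"
  have c: "c > 0" proof -
    have "0 < norm x + 1" by (rule add_nonneg_pos) simp_all
    then show ?thesis by (simp add: c_def)
  qed
  obtain k :: nat where k: "c / \<gamma>\<^sup>2 \<le> real k" using real_arch_simple by blast
  define m where "m = 2 * k"
  have cm: "c \<le> \<gamma>\<^sup>2 * real (2 * m + 1)"
  proof -
    have "c \<le> \<gamma>\<^sup>2 * real k" using k gam by (simp add: field_simps)
    also have "\<dots> \<le> \<gamma>\<^sup>2 * real (2 * m + 1)" by (intro mult_left_mono) (simp_all add: m_def)
    finally show ?thesis .
  qed
  have main: "Re (\<tau> (bump c t m x)) < \<eta>" if t: "\<bar>t\<bar> \<le> 2 * (norm x + 1)" for t
  proof -
    have ct: "(norm x + \<bar>t\<bar>)\<^sup>2 \<le> c" unfolding c_def using t by (intro power_mono) auto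
    define y where "y = (1 / sqrt c) *\<^sub>R (x - complex_of_real t *\<^sub>C 1)"
    note y = bump_self_adjoint [OF xs c ct, folded y_def]
    define b where "b = bump c t m x"
    have b: "b = (1 - y * y) ^ m" using y(3) by (simp add: b_def)
    define w where "w = iota b"
    have w: "w \<in> hcarrier H" by (simp add: w_def iota_mem)
    have w_rop: "w = rop b \<xi>" by (simp add: w_def \<xi>_def rop_iota)
    have snw: "L.sn w \<le> 1" using sn_contract_power(1) [OF y(1,2)] by (simp add: w_def sni b)
    have rb: "L.sn (rop b u) \<le> L.sn u" if "u \<in> hcarrier H" for u
      using rop_bound [OF that, of b 1] sn_contract_power(2) [OF y(1,2)] by (simp add: b)
    define D where "D = (\<Sum>j<M. complex_of_real (real j - t) *\<^sub>C p j w)"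
    have pw: "p j w = rop b (p j \<xi>)" if "j < M" for j
      using vn_rop [OF pvn [OF that] xi] by (simp add: w_rop)
    have pwm: "p j w \<in> hcarrier H" if "j < M" for j using pr(1) [OF that w] .
    have "D = rop b v - complex_of_real t *\<^sub>C w"
    proof -
      have "rop b v = (\<Sum>j<M. of_nat j *\<^sub>C p j w)"
        unfolding v_def using pxi pr(1) xi
        by (subst L.op_sum [OF rop_bounded]) (auto simp: L.opD(3) [OF rop_bounded] pw intro!: sum.cong)
      moreover have "w = (\<Sum>j<M. p j w)" using psum [OF w] by simp
      ultimately show ?thesis
        using scaleC_diff_sum [of of_nat "complex_of_real t" "\<lambda>j. p j w" "{..<M}"] unfolding D_def of_real_diff of_real_of_nat_eq
        by (simp only:)
    qed
    also have "\<dots> = rop b (v - iota x) + iota ((x - complex_of_real t *\<^sub>C 1) * b)"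
    proof -
      have "rop b (v - iota x) = rop b v - rop b (iota x)" by (rule L.opD(4) [OF rop_bounded v iota_mem])
      moreover have "iota ((x - complex_of_real t *\<^sub>C 1) * b) = rop b (iota x) - complex_of_real t *\<^sub>C w"
        by (simp add: left_diff_distrib mult_scaleC_left iota_diff iota_scale rop_iota w_def)
      ultimately show ?thesis by simp
    qed
    finally have D: "D = rop b (v - iota x) + iota ((x - complex_of_real t *\<^sub>C 1) * b)" .
    have "sn ((x - complex_of_real t *\<^sub>C 1) * b) \<le> \<gamma>"
    proof (rule power2_le_imp_le)
      have "(x - complex_of_real t *\<^sub>C 1) * b = complex_of_real (sqrt c) *\<^sub>C (y * b)"
        unfolding y(4) [symmetric] by (simp add: scaleR_scaleC mult_scaleC_left)
      then have "(sn ((x - complex_of_real t *\<^sub>C 1) * b))\<^sup>2 = c * (sn (y * b))\<^sup>2"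
        using c by (simp add: A.sn_scale power_mult_distrib)
      also have "\<dots> \<le> \<gamma>\<^sup>2 * real (2 * m + 1) * (sn (y * b))\<^sup>2" using cm by (intro mult_right_mono) auto
      also have "\<dots> = \<gamma>\<^sup>2 * (real (2 * m + 1) * (sn (y * b))\<^sup>2)" by simp
      also have "\<dots> \<le> \<gamma>\<^sup>2 * 1" unfolding b by (intro mult_left_mono sn_bump_decay y) auto
      finally show "(sn ((x - complex_of_real t *\<^sub>C 1) * b))\<^sup>2 \<le> \<gamma>\<^sup>2" by simp
    qed (use gam in simp)
    moreover have "L.sn (rop b (v - iota x)) \<le> \<gamma>"
      using rb [OF L.diff_mem [OF v iota_mem]] gx by (rule order_trans)
    moreover have "rop b (v - iota x) \<in> hcarrier H" by (rule L.opD(1) [OF rop_bounded L.diff_mem [OF v iota_mem]])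
    moreover have "L.sn D \<le> L.sn (rop b (v - iota x)) + L.sn (iota ((x - complex_of_real t *\<^sub>C 1) * b))"
      unfolding D by (rule L.sn_triangle [OF calculation(3) iota_mem])
    ultimately have sD: "L.sn D \<le> 2 * \<gamma>" unfolding sni by linarith
    have Dm: "complex_of_real (real j - t) *\<^sub>C p j w \<in> hcarrier H" if "j < M" for j
      using pwm [OF that] by (rule L.scale_mem)
    have orth: "hinner H (p i w) (p j w) = 0" if "i < M" "j < M" "i \<noteq> j" for i j
      by (rule projections_orthogonal [OF pp psum that w])
    have "(L.sn D)\<^sup>2 = (\<Sum>j<M. (L.sn (complex_of_real (real j - t) *\<^sub>C p j w))\<^sup>2)"
      unfolding D_def
      by (rule L.pythagoras_sum) (use Dm pwm orth in \<open>simp_all add: L.scale_left L.scale_right L.scale_mem del: of_real_diff\<close>)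
    also have "\<dots> = (\<Sum>j<M. (real j - t)\<^sup>2 * (L.sn (p j w))\<^sup>2)"
      by (intro sum.cong refl) (use pwm in \<open>simp add: L.sn_scale power_mult_distrib del: of_real_diff\<close>)
    finally have "(\<Sum>j<M. (real j - t)\<^sup>2 * (L.sn (p j w))\<^sup>2) = (L.sn D)\<^sup>2" by (rule sym)
    also have "\<dots> \<le> (2 * \<gamma>)\<^sup>2"
    proof (rule power_mono [OF sD L.sn_nonneg])
      show "D \<in> hcarrier H" unfolding D_def by (rule L.sum_mem) (use Dm in simp)
    qed
    finally have pyth: "(\<Sum>j<M. (real j - t)\<^sup>2 * (L.sn (p j w))\<^sup>2) \<le> (2 * \<gamma>)\<^sup>2" .
    define j0 where "j0 = nat (round t)"
    have far: "1 / 2 \<le> \<bar>real j - t\<bar>" if "j \<noteq> j0" for j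
    proof (cases "t < 0")
      case True
      then have "round t \<le> 0" unfolding round_def by linarith
      then have "j \<noteq> 0" using that by (simp add: j0_def)
      then show ?thesis using True by linarith
    next
      case False
      then have "round t \<ge> 0" unfolding round_def by linarith
      then have "int j \<noteq> round t" using that by (auto simp: j0_def)
      moreover have "\<bar>real_of_int (round t) - t\<bar> \<le> 1 / 2" by (rule of_int_round_abs_le)
      ultimately show ?thesis by linarith
    qed
    define rest where "rest = (\<Sum>j\<in>{..<M}-{j0}. p j w)"
    have restm: "rest \<in> hcarrier H" unfolding rest_def by (rule L.sum_mem) (use pwm in auto)
    have "(L.sn rest)\<^sup>2 = (\<Sum>j\<in>{..<M}-{j0}. (L.sn (p j w))\<^sup>2)"
      unfolding rest_def by (rule L.pythagoras_sum) (use pwm orth in auto)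
    also have "\<dots> \<le> (\<Sum>j\<in>{..<M}-{j0}. 4 * ((real j - t)\<^sup>2 * (L.sn (p j w))\<^sup>2))"
    proof (rule sum_mono)
      fix j assume "j \<in> {..<M}-{j0}"
      then have "(1/2)\<^sup>2 \<le> \<bar>real j - t\<bar>\<^sup>2" using far [of j] by (intro power_mono) auto
      then have "1 \<le> 4 * (real j - t)\<^sup>2" by (simp add: power2_eq_square)
      then have "1 * (L.sn (p j w))\<^sup>2 \<le> 4 * (real j - t)\<^sup>2 * (L.sn (p j w))\<^sup>2" by (rule mult_right_mono) simp
      then show "(L.sn (p j w))\<^sup>2 \<le> 4 * ((real j - t)\<^sup>2 * (L.sn (p j w))\<^sup>2)" by simp
    qed
    also have "\<dots> \<le> (\<Sum>j<M. 4 * ((real j - t)\<^sup>2 * (L.sn (p j w))\<^sup>2))"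
      by (intro sum_mono2) auto
    also have "\<dots> \<le> 4 * (2 * \<gamma>)\<^sup>2" using pyth by (simp flip: sum_distrib_left)
    also have "\<dots> = (4 * \<gamma>)\<^sup>2" by (simp add: power2_eq_square)
    finally have rest: "L.sn rest \<le> 4 * \<gamma>" by (rule power2_le_imp_le) (use gam in simp)
    have snxi: "L.sn \<xi> = 1" by (simp add: \<xi>_def sni sn_one)
    have r1: "Re (hinner H \<xi> rest) \<le> 4 * \<gamma>" using L.Re_ip_le [OF xi restm] rest by (simp add: snxi)
    have tb: "\<tau> b = hinner H \<xi> w" by (simp add: \<xi>_def w_def hinner_iota)
    have "Re (\<tau> b) \<le> \<eta> / 4 + 4 * \<gamma>"
    proof (cases "j0 < M")
      case True
      have "w = p j0 w + rest" using psum [OF w] True unfolding rest_def by (subst (asm) sum.remove [of _ j0]) auto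
      then have "\<tau> b = hinner H \<xi> (p j0 w) + hinner H \<xi> rest"
        unfolding tb using L.add_right [OF xi pwm [OF True] restm] by simp
      moreover have "hinner H \<xi> (p j0 w) = hinner H (p j0 \<xi>) w" using pr(3) [OF True xi w] by simp
      moreover have "Re (hinner H (p j0 \<xi>) w) \<le> \<eta> / 4 * 1"
        using L.Re_ip_le [OF pr(1) [OF True xi] w] mult_mono [OF small [OF True] snw] eta L.sn_nonneg [OF w] by simp
      ultimately show ?thesis using r1 by simp
    next
      case False
      then have "{..<M} - {j0} = {..<M}" by auto
      then have "w = rest" using psum [OF w] by (simp add: rest_def)
      then show ?thesis using r1 eta by (simp add: tb)
    qed
    also have "\<dots> < \<eta>" using eta by (simp add: \<gamma>_def)
    finally show ?thesis by (simp add: b_def)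
  qed
  show thesis
  proof (rule that [OF xs c])
    show "even m" by (simp add: m_def)
    show "\<forall>t. \<bar>t\<bar> \<le> 2 * (norm x + 1) \<longrightarrow> Re (\<tau> (bump c t m x)) < \<eta>" using main by blast
  qed
qed

end


lemma in_tracesD:
  assumes "\<tau> \<in> traces"
  shows "\<tau> (x + y) = \<tau> x + \<tau> y" "\<tau> (c *\<^sub>C x) = c * \<tau> x" "\<tau> (x\<^sup>\<star> * x) \<in> \<real>\<^sub>\<ge>\<^sub>0" "\<tau> 1 = 1" "\<tau> (x * y) = \<tau> (y * x)"
    "\<tau> (x - y) = \<tau> x - \<tau> y" "cmod (\<tau> x) \<le> norm x"
proof -
  interpret gns \<tau> by unfold_locales fact
  show "\<tau> (x + y) = \<tau> x + \<tau> y" "\<tau> (c *\<^sub>C x) = c * \<tau> x" "\<tau> (x\<^sup>\<star> * x) \<in> \<real>\<^sub>\<ge>\<^sub>0" "\<tau> 1 = 1" "\<tau> (x * y) = \<tau> (y * x)"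
    "\<tau> (x - y) = \<tau> x - \<tau> y" "cmod (\<tau> x) \<le> norm x"
    by (rule t_add t_scale t_pos t_one t_comm t_diff trace_le_norm)+
qed

lemma continuous_trace: "\<tau> \<in> traces \<Longrightarrow> continuous_on UNIV \<tau>"
proof (rule continuous_onI)
  fix x and e :: real assume t: "\<tau> \<in> traces" and e: "e > 0"
  have le: "dist (\<tau> x') (\<tau> x) \<le> dist x' x" for x'
    using in_tracesD(7) [OF t, of "x' - x"] by (simp add: dist_norm in_tracesD(6) [OF t])
  have "\<forall>x'\<in>UNIV. dist x' x < e \<longrightarrow> dist (\<tau> x') (\<tau> x) \<le> e"
  proof (intro ballI impI)
    fix x' assume "dist x' x < e"
    then show "dist (\<tau> x') (\<tau> x) \<le> e" using le [of x'] by linarith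
  qed
  then show "\<exists>d>0. \<forall>x'\<in>UNIV. dist x' x < d \<longrightarrow> dist (\<tau> x') (\<tau> x) \<le> e" using e by blast
qed

lemma continuous_scaleC: "continuous_on UNIV (\<lambda>x :: 'a::cstar_algebra. c *\<^sub>C x)"
proof -
  have "continuous_on UNIV (\<lambda>x :: 'a. (c *\<^sub>C 1) * x)" by (intro continuous_intros)
  then show ?thesis by (simp add: mult_scaleC_left)
qed

lemma continuous_bump: "continuous_on UNIV (bump c t m :: 'a::cstar_algebra \<Rightarrow> 'a)"
  unfolding bump_def
  by (intro continuous_on_power continuous_on_diff continuous_on_const continuous_on_id
      continuous_on_compose2 [OF continuous_scaleC] continuous_on_mult) auto

locale unital_star_hom =
  fixes j :: "'a::cstar_algebra \<Rightarrow> 'c::cstar_algebra"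
  assumes j_add: "j (x + y) = j x + j y" and j_scale: "j (c *\<^sub>C x) = c *\<^sub>C j x"
    and j_mult: "j (x * y) = j x * j y" and j_one: "j 1 = 1" and j_star: "j (x\<^sup>\<star>) = (j x)\<^sup>\<star>"
begin

lemma j_diff: "j (x - y) = j x - j y"
  using j_add [of "x - y" y] by (simp add: algebra_simps)

lemma j_power: "j (x ^ n) = j x ^ n"
  by (induction n) (simp_all add: j_one j_mult)

lemma j_bump: "j (bump c t m x) = bump c t m (j x)"
  by (simp add: bump_def j_power j_diff j_scale j_mult j_one)

lemma trace_restrict: "\<tau> \<in> traces \<Longrightarrow> (\<lambda>x. \<tau> (j x)) \<in> traces"
  unfolding traces_def states_def clinear_def
  by (auto simp: j_add j_scale j_mult j_one j_star)

end

definition spread_data :: "real \<Rightarrow> real \<Rightarrow> nat \<Rightarrow> real \<Rightarrow> real set \<Rightarrow> bool"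
  where "spread_data \<theta> c m R T \<longleftrightarrow> \<theta> > 0 \<and> 8 * real m * \<theta>\<^sup>2 \<le> c \<and> 4 * \<theta>\<^sup>2 \<le> c \<and> c > 0 \<and> even m \<and> R \<ge> 1 \<and> finite T \<and>
    (\<forall>s. \<bar>s\<bar> \<le> R \<longrightarrow> (\<exists>t\<in>T. \<bar>s - t\<bar> \<le> \<theta>))"

lemma (in unital_star_hom) diffuse_spread:
  assumes t: "\<tau> \<in> traces" and d: "diffuse (gns_space (\<lambda>x. \<tau> (j x))) (gns_von_neumann (\<lambda>x. \<tau> (j x)))" and eta: "\<eta> > 0"
  obtains x \<theta> c m R T p where "x\<^sup>\<star> = x" "spread_data \<theta> c m R T"
    "\<forall>t\<in>T. Re (\<tau> (bump c t m (j x))) < \<eta>" "Re (\<tau> (j x ^ (2 * p))) < \<eta> * R ^ (2 * p)"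
proof -
  interpret gns "\<lambda>x. \<tau> (j x)" by unfold_locales (rule trace_restrict [OF t])
  obtain x c m where x: "x\<^sup>\<star> = x" and c: "c > 0" and m: "even m"
    and bump: "\<forall>t. \<bar>t\<bar> \<le> 2 * (norm x + 1) \<longrightarrow> Re (\<tau> (j (bump c t m x))) < \<eta>"
    using small_atoms [OF d eta] .
  define R where "R = 2 * (norm x + 1)"
  have R: "R \<ge> 1" using norm_ge_zero [of x] unfolding R_def by simp
  define \<theta> where "\<theta> = sqrt (c / (8 * (real m + 1)))"
  have th: "\<theta> > 0" "\<theta>\<^sup>2 = c / (8 * (real m + 1))" using c by (simp_all add: \<theta>_def)
  have "\<exists>T. finite T \<and> T \<subseteq> {-R..R} \<and> {-R..R} \<subseteq> (\<Union>t\<in>T. ball t \<theta>)"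
    using seq_compact_imp_totally_bounded [OF compact_imp_seq_compact [OF compact_Icc], of "-R" R] th(1) by simp
  then obtain T where T: "finite T" "T \<subseteq> {-R..R}" "{-R..R} \<subseteq> (\<Union>t\<in>T. ball t \<theta>)"
    by (elim exE conjE)
  obtain p :: nat where p: "1 / \<eta> < real p" using reals_Archimedean2 by blast
  have "real p \<le> 4 ^ p" using of_nat_less_two_power [of p, where ?'a = real] power_mono [of "2::real" 4 p] by simp
  then have "\<eta> * real p \<le> \<eta> * 4 ^ p" using eta by simp
  moreover have "1 < \<eta> * real p" using p eta by (simp add: divide_less_eq mult.commute)
  ultimately have p4: "1 < \<eta> * 4 ^ p" by linarith
  have "Re (\<tau> (j x ^ (2 * p))) \<le> norm (x ^ (2 * p))"
    using trace_le_norm [of "x ^ (2 * p)"] complex_Re_le_cmod [of "\<tau> (j x ^ (2 * p))"] by (simp add: j_power)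
  also have "\<dots> \<le> norm x ^ (2 * p)" by (rule norm_power_ineq)
  also have "\<dots> \<le> (norm x + 1) ^ (2 * p)" by (intro power_mono) auto
  also have "\<dots> = 1 * (norm x + 1) ^ (2 * p)" by simp
  also have "\<dots> < \<eta> * 4 ^ p * (norm x + 1) ^ (2 * p)"
    using p4 by (intro mult_strict_right_mono zero_less_power add_nonneg_pos) simp_all
  also have "\<dots> = \<eta> * R ^ (2 * p)" by (simp only: R_def power_mult_distrib) (simp add: power_mult)
  finally have tail: "Re (\<tau> (j x ^ (2 * p))) < \<eta> * R ^ (2 * p)" .
  have th_c: "8 * (real m + 1) * \<theta>\<^sup>2 = c" unfolding th(2) by (simp add: add_nonneg_eq_0_iff)
  have "8 * (real m * \<theta>\<^sup>2) + 8 * \<theta>\<^sup>2 = c" using th_c by (simp add: distrib_left distrib_right)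
  moreover have "0 \<le> real m * \<theta>\<^sup>2" "0 \<le> \<theta>\<^sup>2" by simp_all
  ultimately have "8 * (real m * \<theta>\<^sup>2) \<le> c" "4 * \<theta>\<^sup>2 \<le> c" by linarith+
  then have th_le: "8 * real m * \<theta>\<^sup>2 \<le> c" "4 * \<theta>\<^sup>2 \<le> c" by simp_all
  have "spread_data \<theta> c m R T"
    unfolding spread_data_def
  proof (intro conjI allI impI th_le)
    fix s assume "\<bar>s\<bar> \<le> R"
    then have "s \<in> {-R..R}" by auto
    then obtain t where "t \<in> T" "s \<in> ball t \<theta>" using T(3) by blast
    then show "\<exists>t\<in>T. \<bar>s - t\<bar> \<le> \<theta>" by (intro bexI [of _ t]) (auto simp: dist_real_def)
  qed (use th c m R T in simp_all)
  then show thesis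
  proof (rule that [OF x _ _ tail])
    show "\<forall>t\<in>T. Re (\<tau> (bump c t m (j x))) < \<eta>"
    proof
      fix t assume "t \<in> T"
      then have "t \<in> {-R..R}" using T(2) by blast
      then have "\<bar>t\<bar> \<le> R" by (simp add: abs_le_iff)
      then show "Re (\<tau> (bump c t m (j x))) < \<eta>" using bump by (simp add: R_def j_bump)
    qed
  qed
qed

lemma spread_of_data:
  assumes D: "spread_data \<theta> c m R T" and N: "N > 0"
    and bump: "\<And>t. t \<in> T \<Longrightarrow> Re (tr (mat_ev N A (bump c t m P))) / N \<le> \<eta>"
    and tail: "Re (tr (mat_ev N A (P ^ (2 * p)))) / N \<le> \<eta> * R ^ (2 * p)"
  shows "spread N (3 * \<eta>) \<theta> (mat_ev N A P)"
  unfolding spread_def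
proof (intro allI impI)
  fix U l assume U: "unitary N U" and d: "cj U (mat_ev N A P) = diag_fm N l"
  have "tr (mat_ev N A (bump c t m P)) = complex_of_real (\<Sum>i<N. (1 - (l i - t)\<^sup>2 / c) ^ m)" for t
    using tr_cj [OF U corner_mat_ev, of A "bump c t m P"] cj_mat_ev(2) [OF U d, of c t m] by (simp add: tr_diag_fm)
  then have b: "(\<Sum>i<N. (1 - (l i - t)\<^sup>2 / c) ^ m) \<le> \<eta> * N" if "t \<in> T" for t
    using bump [OF that] N by (simp add: divide_le_eq)
  have "tr (mat_ev N A (P ^ (2 * p))) = complex_of_real (\<Sum>i<N. l i ^ (2 * p))"
    using tr_cj [OF U corner_mat_ev, of A "P ^ (2 * p)"] cj_mat_ev(1) [OF U d, of "2 * p"] by (simp add: tr_diag_fm)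
  then have t: "(\<Sum>i<N. l i ^ (2 * p)) \<le> \<eta> * R ^ (2 * p) * N"
    using tail N by (simp add: divide_le_eq)
  show "few_close_pairs N (3 * \<eta>) \<theta> l"
    using D unfolding spread_data_def
    by (intro few_close_pairs_of_moments [where c = c and m = m and R = R and T = T and p = p]) (use b t in auto)
qed

lemma hermitian_approx:
  fixes a :: "'i \<Rightarrow> 'a::cstar_algebra"
  assumes gen: "generates a" and z: "z\<^sup>\<star> = z" and O: "open \<O>" "z \<in> \<O>"
  obtains P where "nceval a P \<in> \<O>" "\<forall>N A. (\<forall>i. A i \<in> carrier_mat N N) \<longrightarrow> adj (mat_ev N A P) = mat_ev N A P"
proof -
  obtain e where e: "e > 0" "ball z e \<subseteq> \<O>" using O by (auto simp: open_contains_ball)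
  have "z \<in> closure (range (nceval a))" using gen by (simp add: generates_def)
  then obtain Q where Q: "dist (nceval a Q) z < e" using e(1) by (auto simp: closure_approachable)
  define P where "P = (1/2 :: complex) *\<^sub>C (Q + ncstar Q)"
  have P: "nceval a P = (1/2 :: complex) *\<^sub>C (nceval a Q + (nceval a Q)\<^sup>\<star>)"
    by (simp add: P_def cstar_eval.ev_scaleC cstar_eval.ev_add nceval_star)
  have "z - nceval a P = (1/2 :: complex) *\<^sub>C ((z - nceval a Q) + (z - nceval a Q)\<^sup>\<star>)"
    unfolding P star_diff z by (rule diff_midpoint)
  then have "norm (z - nceval a P) = 1/2 * norm ((z - nceval a Q) + (z - nceval a Q)\<^sup>\<star>)"
    by (simp add: norm_scaleC)
  also have "\<dots> \<le> 1/2 * (norm (z - nceval a Q) + norm (z - nceval a Q))"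
    using norm_triangle_ineq [of "z - nceval a Q" "(z - nceval a Q)\<^sup>\<star>"] by (simp only: norm_star) simp
  also have "\<dots> < e" using Q by (simp add: dist_norm norm_minus_commute)
  finally have "nceval a P \<in> \<O>" using e(2) by (auto simp: dist_norm)
  moreover have "\<forall>N A. (\<forall>i. A i \<in> carrier_mat N N) \<longrightarrow> adj (mat_ev N A P) = mat_ev N A P"
    by (simp add: P_def mat_eval.ev_scaleC mat_eval.ev_add mat_ev_star adj_scaleC adj_add add.commute)
  ultimately show thesis by (rule that)
qed

lemma law_neighbourhood:
  fixes a :: "'i \<Rightarrow> 'c::cstar_algebra"
  assumes t: "\<tau> \<in> traces" and fin: "finite \<W>" "finite \<V>" and r: "r > 0"
  obtains U :: "('i ncpoly \<Rightarrow> complex) set" where "open U" "(\<lambda>P. \<tau> (nceval a P)) \<in> U"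
    "\<forall>N>0. \<forall>A. (\<forall>i. A i \<in> carrier_mat N N) \<longrightarrow> mat_law N A \<in> U \<longrightarrow>
      (\<forall>W\<in>\<W>. norm (mat_ev N A W) \<le> (norm (nceval a W) + r) * sqrt N) \<and>
      (\<forall>V\<in>\<V>. Re (tr (mat_ev N A V)) / N \<le> Re (\<tau> (nceval a V)) + r)"
proof -
  interpret gns \<tau> by unfold_locales fact
  define e where "e = min r (r\<^sup>2)"
  have e: "e > 0" "e \<le> r" "e \<le> r\<^sup>2" using r by (auto simp: e_def)
  define Z where "Z = \<V> \<union> (\<lambda>W. ncstar W * W) ` \<W>"
  define U where "U = (\<Inter>V\<in>Z. (\<lambda>l. l V) -` ball (\<tau> (nceval a V)) e)"
  have finZ: "finite Z" using fin by (simp add: Z_def)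
  have oU: "open U"
    unfolding U_def
  proof (intro open_INT finZ ballI)
    fix V :: "'i ncpoly"
    have "continuous_on UNIV (\<lambda>l :: 'i ncpoly \<Rightarrow> complex. l V)" by (rule continuous_on_product_coordinates)
    then show "open ((\<lambda>l. l V) -` ball (\<tau> (nceval a V)) e)" by (intro open_vimage) auto
  qed
  have tU: "(\<lambda>P. \<tau> (nceval a P)) \<in> U" using e by (simp add: U_def)
  have close: "\<bar>Re (tr (mat_ev N A V)) / N - Re (\<tau> (nceval a V))\<bar> \<le> e"
    if V: "V \<in> Z" and "mat_law N A \<in> U" "\<And>i. A i \<in> carrier_mat N N" for V N A
  proof -
    have "cmod (tr (mat_ev N A V) / of_nat N - \<tau> (nceval a V)) < e"
      using that by (simp add: U_def mat_law_ev dist_norm norm_minus_commute)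
    moreover have "Re (tr (mat_ev N A V)) / N - Re (\<tau> (nceval a V)) = Re (tr (mat_ev N A V) / of_nat N - \<tau> (nceval a V))"
      by (simp add: Re_divide_of_nat)
    ultimately show ?thesis using abs_Re_le_cmod [of "tr (mat_ev N A V) / of_nat N - \<tau> (nceval a V)"] by linarith
  qed
  have nW: "norm (mat_ev N A W) \<le> (norm (nceval a W) + r) * sqrt N"
    if "N > 0" "\<And>i. A i \<in> carrier_mat N N" "mat_law N A \<in> U" "W \<in> \<W>" for N A W
  proof (rule power2_le_imp_le)
    have "(norm (mat_ev N A W))\<^sup>2 = Re (tr (mat_ev N A (ncstar W * W)))"
      by (simp add: norm_sq_tr mat_eval.ev_mult mat_ev_star [OF that(2)])
    also have "\<dots> \<le> (Re (\<tau> (nceval a (ncstar W * W))) + e) * N"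
    proof -
      have "Re (tr (mat_ev N A (ncstar W * W))) / N \<le> Re (\<tau> (nceval a (ncstar W * W))) + e"
        using close [of "ncstar W * W" N A] that by (simp add: Z_def abs_le_iff)
      then show ?thesis using that(1) by (simp add: divide_le_eq)
    qed
    also have "Re (\<tau> (nceval a (ncstar W * W))) = (sn (nceval a W))\<^sup>2"
      by (simp add: A.sn_sq cstar_eval.ev_mult nceval_star)
    also have "((sn (nceval a W))\<^sup>2 + e) * N \<le> ((norm (nceval a W))\<^sup>2 + r\<^sup>2) * N"
      using e(3) sn_le_norm [of "nceval a W"] A.sn_nonneg [of "nceval a W"] by (intro mult_right_mono add_mono power_mono) auto
    also have "\<dots> \<le> (norm (nceval a W) + r)\<^sup>2 * N"
      using r by (intro mult_right_mono) (auto simp: power2_sum)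
    finally show "(norm (mat_ev N A W))\<^sup>2 \<le> ((norm (nceval a W) + r) * sqrt N)\<^sup>2" by (simp add: power_mult_distrib)
  qed (use r in simp)
  have nV: "Re (tr (mat_ev N A V)) / N \<le> Re (\<tau> (nceval a V)) + r"
    if "N > 0" "\<And>i. A i \<in> carrier_mat N N" "mat_law N A \<in> U" "V \<in> \<V>" for N A V
    using close [of V N A] that e(2) by (simp add: Z_def abs_le_iff)
  show thesis by (rule that [OF oU tU]) (simp add: nW nV)
qed


lemma product_close:
  assumes t: "tame K N X" "tame K N X'" "tame K N Y" "tame K N Y'" and V: "unitary N V" and K: "K \<ge> 0"
    and X: "norm (X - V * X' * adj V) \<le> 2 * \<zeta> * sqrt N" and Y: "norm (Y - V * Y' * adj V) \<le> 2 * \<zeta> * sqrt N"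
  shows "norm (X * Y - V * (X' * Y') * adj V) \<le> 2 * sqrt (4 * K * \<zeta>) * sqrt N"
proof -
  define X'' where "X'' = V * X' * adj V"
  define Y'' where "Y'' = V * Y' * adj V"
  have cj: "V * Z * adj V = cj (adj V) Z" for Z by (simp add: cj_def)
  have t'': "tame K N X''" "tame K N Y''"
    unfolding X''_def Y''_def cj using tame_cj [OF unitary_adj [OF V]] t by auto
  have c: "corner N Y'" using t by (simp add: tame_def)
  have "V * (X' * Y') * adj V = X'' * Y''"
    unfolding X''_def Y''_def cj by (rule cj_mult [OF unitary_adj [OF V] c])
  then have "X * Y - V * (X' * Y') * adj V = (X - X'') * Y + X'' * (Y - Y'')" by (simp add: algebra_simps)
  also have "norm \<dots> \<le> norm ((X - X'') * Y) + norm (X'' * (Y - Y''))" by (rule norm_triangle_ineq)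
  also have "\<dots> \<le> sqrt (2 * K * (2 * \<zeta>)) * sqrt N + sqrt (2 * K * (2 * \<zeta>)) * sqrt N"
    using norm_diff_mult_tame [OF t(1) t''(1) t(3) X [folded X''_def] K]
      norm_mult_diff_tame [OF t(3) t''(2) t''(1) Y [folded Y''_def] K] by (rule add_mono)
  also have "\<dots> = 2 * sqrt (4 * K * \<zeta>) * sqrt N"
  proof -
    have "2 * K * (2 * \<zeta>) = 4 * K * \<zeta>" by simp
    then show ?thesis by (simp only:)
  qed
  finally show ?thesis .
qed

lemma norm_sum_list_le: "(\<And>p. p \<in> set us \<Longrightarrow> norm (f p) \<le> c) \<Longrightarrow> norm (\<Sum>p\<leftarrow>us. f p) \<le> real (length us) * c"
  for f :: "'p \<Rightarrow> 'v::real_normed_vector"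
proof (induction us)
  case (Cons p us)
  then have "norm (\<Sum>p\<leftarrow>us. f p) \<le> real (length us) * c" "norm (f p) \<le> c" by auto
  then show ?case using norm_triangle_ineq [of "f p" "\<Sum>p\<leftarrow>us. f p"] by (simp add: distrib_right)
qed simp

lemma norm_product_diff:
  fixes u v x y :: "'a::real_normed_algebra"
  assumes "norm (u - x) \<le> k" "norm (v - y) \<le> k" "k \<le> 1" "norm x \<le> B" "norm y \<le> B"
  shows "norm (u * v - x * y) \<le> k * (2 * B + 1)"
proof -
  have k: "k \<ge> 0" using assms(1) norm_ge_zero [of "u - x"] by linarith
  have v: "norm v \<le> B + 1" using norm_triangle_ineq [of "v - y" y] assms by simp
  have "u * v - x * y = (u - x) * v + x * (v - y)" by (simp add: algebra_simps)
  also have "norm \<dots> \<le> norm (u - x) * norm v + norm x * norm (v - y)"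
    using norm_triangle_ineq [of "(u - x) * v" "x * (v - y)"] norm_mult_ineq [of "u - x" v] norm_mult_ineq [of x "v - y"] by linarith
  also have "\<dots> \<le> k * (B + 1) + B * k"
    using assms v k by (intro add_mono mult_mono) (auto intro: order_trans [OF norm_ge_zero])
  finally show ?thesis by (simp add: algebra_simps)
qed

lemma norm_commutator_diff:
  fixes u v x y :: "'a::real_normed_algebra"
  assumes "norm (u - x) \<le> k" "norm (v - y) \<le> k" "k \<le> 1" "norm x \<le> B" "norm y \<le> B" "x * y = y * x"
  shows "norm (u * v - v * u) \<le> 2 * (k * (2 * B + 1))"
proof -
  have "u * v - v * u = (u * v - x * y) - (v * u - y * x)" by (simp add: assms(6))
  also have "norm \<dots> \<le> norm (u * v - x * y) + norm (v * u - y * x)" by (rule norm_triangle_ineq4)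
  also have "\<dots> \<le> k * (2 * B + 1) + k * (2 * B + 1)"
    using assms by (intro add_mono norm_product_diff) auto
  finally show ?thesis by simp
qed

definition tame_words :: "'i ncpoly \<Rightarrow> 'i ncpoly set"
  where "tame_words P = {P, ncstar P * P, P * ncstar P, P * ncstar P * (P * ncstar P), ncstar P * P * (ncstar P * P)}"

definition kk :: "'c::real_normed_vector \<Rightarrow> real" where "kk z = (norm z + 1) ^ 4 + 1"

lemma tame_of_words:
  fixes a :: "'i \<Rightarrow> 'c::cstar_algebra"
  assumes c: "\<And>i. A i \<in> carrier_mat N N" and b: "\<And>W. W \<in> tame_words P \<Longrightarrow> norm (mat_ev N A W) \<le> (norm (nceval a W) + r) * sqrt N"
    and r: "r \<le> 1" and z: "norm (nceval a P - z) \<le> 1"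
  shows "tame (kk z) N (mat_ev N A P)"
proof -
  define b where "b = norm z + 1"
  define w where "w = nceval a P"
  have b1: "b \<ge> 1" by (simp add: b_def)
  have w: "norm w \<le> b" using norm_triangle_ineq [of "w - z" z] z by (simp add: b_def w_def)
  have ws: "norm (w\<^sup>\<star>) \<le> b" using w by (simp add: norm_star)
  have m2: "norm (u * v) \<le> b ^ (k + l)" if "norm u \<le> b ^ k" "norm v \<le> b ^ l" for u v :: 'c and k l
  proof -
    have "norm (u * v) \<le> norm u * norm v" by (rule norm_mult_ineq)
    also have "\<dots> \<le> b ^ k * b ^ l" using that b1 by (intro mult_mono) auto
    finally show ?thesis by (simp add: power_add)
  qed
  have w1: "norm w \<le> b ^ 1" "norm (w\<^sup>\<star>) \<le> b ^ 1" using w ws by simp_all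
  note w2 = m2 [OF w1(1) w1(2)] m2 [OF w1(2) w1(1)]
  note w4 = m2 [OF w2(1) w2(1)] m2 [OF w2(2) w2(2)]
  have up: "(s + r) * sqrt N \<le> kk z * sqrt N" if "s \<le> b ^ k" "k \<le> 4" for s k
  proof -
    have "b ^ k \<le> b ^ 4" using b1 that(2) by (intro power_increasing) auto
    then have "s + r \<le> kk z" using that(1) r by (simp add: kk_def b_def)
    then show ?thesis by (rule mult_right_mono) simp
  qed
  have ev: "mat_ev N A (ncstar P) = adj (mat_ev N A P)" by (rule mat_ev_star [OF c])
  show ?thesis
    unfolding tame_def
  proof (intro conjI)
    show "norm (mat_ev N A P) \<le> kk z * sqrt N"
      using b [of P] up [OF w1(1)] by (simp add: tame_words_def w_def)
    show "norm (adj (mat_ev N A P) * mat_ev N A P) \<le> kk z * sqrt N"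
      using b [of "ncstar P * P"] up [OF w2(2)] by (simp add: tame_words_def w_def mat_eval.ev_mult cstar_eval.ev_mult nceval_star ev)
    show "norm (mat_ev N A P * adj (mat_ev N A P)) \<le> kk z * sqrt N"
      using b [of "P * ncstar P"] up [OF w2(1)] by (simp add: tame_words_def w_def mat_eval.ev_mult cstar_eval.ev_mult nceval_star ev)
    show "norm (mat_ev N A P * adj (mat_ev N A P) * (mat_ev N A P * adj (mat_ev N A P))) \<le> kk z * sqrt N"
      using b [of "P * ncstar P * (P * ncstar P)"] up [OF w4(1)] by (simp add: tame_words_def w_def mat_eval.ev_mult cstar_eval.ev_mult nceval_star ev)
    show "norm (adj (mat_ev N A P) * mat_ev N A P * (adj (mat_ev N A P) * mat_ev N A P)) \<le> kk z * sqrt N"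
      using b [of "ncstar P * P * (ncstar P * P)"] up [OF w4(2)] by (simp add: tame_words_def w_def mat_eval.ev_mult cstar_eval.ev_mult nceval_star ev)
  qed simp
qed

definition orbit_close :: "nat \<Rightarrow> 'i set \<Rightarrow> real \<Rightarrow> ('i \<Rightarrow> complex mat) set \<Rightarrow> bool"
  where "orbit_close N F \<epsilon> S \<longleftrightarrow>
    (\<forall>A\<in>S. \<forall>B\<in>S. \<exists>U\<in>unitary_mats N. \<forall>i\<in>F. mat_norm2 (A i - U * B i * mat_adjoint U) < \<epsilon>)"

text \<open>matrix closeness of generators from closeness of the legs\<close>
lemma generators_close:
  fixes us :: "('x \<times> 'y) list" and px :: "'x \<Rightarrow> 'i ncpoly" and py :: "'y \<Rightarrow> 'i ncpoly"
  assumes A: "\<And>i. A i \<in> carrier_mat N N" and B: "\<And>i. B i \<in> carrier_mat N N" and V: "unitary N V" and K: "K \<ge> 0"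
    and xc: "\<And>x y. (x, y) \<in> set us \<Longrightarrow> norm (mat_ev N A (px x) - V * mat_ev N B (px x) * adj V) \<le> 2 * \<zeta> * sqrt N"
    and yc: "\<And>x y. (x, y) \<in> set us \<Longrightarrow> norm (mat_ev N A (py y) - V * mat_ev N B (py y) * adj V) \<le> 2 * \<zeta> * sqrt N"
    and xt: "\<And>x y. (x, y) \<in> set us \<Longrightarrow> tame K N (mat_ev N A (px x)) \<and> tame K N (mat_ev N B (px x))"
    and yt: "\<And>x y. (x, y) \<in> set us \<Longrightarrow> tame K N (mat_ev N A (py y)) \<and> tame K N (mat_ev N B (py y))"
    and W: "W = ncvar i - (\<Sum>(x, y)\<leftarrow>us. px x * py y)"
    and WA: "norm (mat_ev N A W) \<le> e * sqrt N" and WB: "norm (mat_ev N B W) \<le> e * sqrt N"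
  shows "norm (of_mat N (A i) - V * of_mat N (B i) * adj V) \<le> (2 * e + real (length us) * (2 * sqrt (4 * K * \<zeta>))) * sqrt N"
proof -
  define D where "D P = mat_ev N A P - V * mat_ev N B P * adj V" for P
  have D_add: "D (P + Q) = D P + D Q" for P Q by (simp add: D_def mat_eval.ev_add algebra_simps)
  have D0: "D 0 = 0" by (simp add: D_def)
  have D_sum: "D (\<Sum>p\<leftarrow>ps. f p) = (\<Sum>p\<leftarrow>ps. D (f p))" for ps :: "('x \<times> 'y) list" and f
    by (induction ps) (simp_all add: D0 D_add)
  have "D (ncvar i) = D (W + (\<Sum>(x, y)\<leftarrow>us. px x * py y))" by (simp add: W)
  also have "\<dots> = D W + (\<Sum>p\<leftarrow>us. D (px (fst p) * py (snd p)))"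
    by (simp add: D_add D_sum case_prod_beta)
  finally have "norm (D (ncvar i)) \<le> norm (D W) + norm (\<Sum>p\<leftarrow>us. D (px (fst p) * py (snd p)))"
    by (simp add: norm_triangle_ineq)
  also have "norm (D W) \<le> norm (mat_ev N A W) + norm (V * mat_ev N B W * adj V)"
    unfolding D_def by (rule norm_triangle_ineq4)
  also have "norm (V * mat_ev N B W * adj V) = norm (mat_ev N B W)"
    using norm_cj [OF unitary_adj [OF V] corner_mat_ev, of B W] by (simp add: cj_def)
  also have "norm (\<Sum>p\<leftarrow>us. D (px (fst p) * py (snd p))) \<le> real (length us) * (2 * sqrt (4 * K * \<zeta>) * sqrt N)"
  proof (rule norm_sum_list_le)
    fix p assume "p \<in> set us"
    then have p: "(fst p, snd p) \<in> set us" by simp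
    show "norm (D (px (fst p) * py (snd p))) \<le> 2 * sqrt (4 * K * \<zeta>) * sqrt N"
      unfolding D_def mat_eval.ev_mult
      by (rule product_close [OF _ _ _ _ V K xc [OF p] yc [OF p]]) (use xt [OF p] yt [OF p] in auto)
  qed
  finally have "norm (D (ncvar i)) \<le> norm (mat_ev N A W) + norm (mat_ev N B W) + real (length us) * (2 * sqrt (4 * K * \<zeta>) * sqrt N)"
    by simp
  also have "\<dots> \<le> e * sqrt N + e * sqrt N + real (length us) * (2 * sqrt (4 * K * \<zeta>) * sqrt N)"
    using WA WB by (intro add_mono) auto
  also have "\<dots> = (2 * e + real (length us) * (2 * sqrt (4 * K * \<zeta>))) * sqrt N" by (simp add: algebra_simps)
  finally show ?thesis by (simp add: D_def mat_ev_var [OF A] mat_ev_var [OF B])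
qed

lemma unitary_mats_of_unitary:
  assumes "unitary N V"
  obtains U where "U \<in> unitary_mats N" "of_mat N U = V"
proof -
  let ?U = "Matrix.mat N N (\<lambda>(i, j). entry V i j)"
  have "of_mat N ?U = V" using of_mat_surj unitaryD(1) [OF assms] by blast
  moreover have "?U \<in> unitary_mats N" by (rule unitary_of_mat) (use assms calculation in auto)
  ultimately show thesis using that by blast
qed

lemma mat_norm2_conj:
  assumes N: "N > 0" and A: "A \<in> carrier_mat N N" and B: "B \<in> carrier_mat N N" and U: "U \<in> unitary_mats N" and V: "of_mat N U = V"
    and le: "norm (of_mat N A - V * of_mat N B * adj V) \<le> c * sqrt N" and c: "c < \<epsilon>"
  shows "mat_norm2 (A - U * B * mat_adjoint U) < \<epsilon>"
proof -
  have U': "U \<in> carrier_mat N N" using U by (simp add: unitary_mats_def)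
  have UB: "U * B \<in> carrier_mat N N" by (rule mult_carrier_mat [OF U' B])
  have aU: "mat_adjoint U \<in> carrier_mat N N" using U' by simp
  have UBU: "U * B * mat_adjoint U \<in> carrier_mat N N" by (rule mult_carrier_mat [OF UB aU])
  have "of_mat N (A - U * B * mat_adjoint U) = of_mat N A - V * of_mat N B * adj V"
    by (simp add: of_mat_minus [OF A UBU] of_mat_mult [OF UB aU] of_mat_mult [OF U' B] of_mat_adjoint [OF U'] V)
  moreover have "A - U * B * mat_adjoint U \<in> carrier_mat N N" by (rule minus_carrier_mat [OF UBU])
  ultimately have "mat_norm2 (A - U * B * mat_adjoint U) = norm (of_mat N A - V * of_mat N B * adj V) / sqrt N"
    by (simp add: mat_norm2_of_mat)
  also have "\<dots> \<le> c" using le N by (simp add: divide_le_eq)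
  finally show ?thesis using c by simp
qed


definition kbound :: "'c::real_normed_vector set \<Rightarrow> real" where "kbound Z = 1 + (\<Sum>z\<in>Z. kk z)"

lemma kk_nonneg: "0 \<le> kk z" by (simp add: kk_def)

lemma kbound_pos: "finite Z \<Longrightarrow> kbound Z \<ge> 1"
  by (simp add: kbound_def sum_nonneg kk_nonneg)

lemma kbound_ge: "finite Z \<Longrightarrow> z \<in> Z \<Longrightarrow> kk z \<le> kbound Z"
  using member_le_sum [of z Z kk] by (simp add: kbound_def kk_nonneg)

lemma kbound_insert: "finite Z \<Longrightarrow> kbound Z \<le> kbound (insert z Z)"
  unfolding kbound_def by (intro add_left_mono sum_mono2) (auto simp: kk_nonneg)

lemma exp_count_le:
  assumes c: "c > 0" and \<eta>: "\<eta> = \<delta> / (8 * c * (real n + 1))" and d: "\<delta> > 0"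
  shows "exp (2 * \<eta> * (real N)\<^sup>2 * c) ^ n \<le> exp (\<delta> / 4 * (real N)\<^sup>2)"
proof -
  have e: "\<eta> * c = \<delta> / (8 * (real n + 1))" using c by (simp add: \<eta>)
  have "real n * (2 * \<eta> * (real N)\<^sup>2 * c) = real n * 2 * (\<eta> * c) * (real N)\<^sup>2" by (simp only: mult_ac)
  also have "\<dots> = real n * 2 * (\<delta> / (8 * (real n + 1))) * (real N)\<^sup>2" by (simp only: e)
  also have "\<dots> = (\<delta> / 4 * (real N)\<^sup>2) * (real n / (real n + 1))"
  proof -
    define u where "u = real n + 1"
    have "u > 0" by (simp add: u_def)
    then show ?thesis unfolding u_def [symmetric] by (simp add: field_simps)
  qed
  also have "\<dots> \<le> (\<delta> / 4 * (real N)\<^sup>2) * 1"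
    using d by (intro mult_left_mono) (auto simp: divide_le_eq)
  finally have "real n * (2 * \<eta> * (real N)\<^sup>2 * c) \<le> \<delta> / 4 * (real N)\<^sup>2" by simp
  then show ?thesis unfolding exp_of_nat_mult [symmetric] by simp
qed

lemma sqrt_scale:
  assumes "K > 0" "s > 0"
  shows "sqrt (4 * K * (s\<^sup>2 / (4 * K))) = s"
  using assms by simp

locale commuting_pair = A: unital_star_hom jA + B: unital_star_hom jB
  for jA :: "'a::cstar_algebra \<Rightarrow> 'c::cstar_algebra" and jB :: "'b::cstar_algebra \<Rightarrow> 'c" +
  assumes commute: "jA x * jB y = jB y * jA x"
    and dense: "closure (range (\<lambda>us. \<Sum>(x, y)\<leftarrow>us. jA x * jB y)) = UNIV"
begin

theorem local_splitting:
  fixes a :: "'i \<Rightarrow> 'c" and \<tau> :: "'c \<Rightarrow> complex"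
  assumes gen: "generates a" and t: "\<tau> \<in> traces"
    and dA: "diffuse (gns_space (\<lambda>x. \<tau> (jA x))) (gns_von_neumann (\<lambda>x. \<tau> (jA x)))"
    and dB: "diffuse (gns_space (\<lambda>x. \<tau> (jB x))) (gns_von_neumann (\<lambda>x. \<tau> (jB x)))"
    and F: "finite F" and eps: "\<epsilon> > 0" and del: "\<delta> > 0"
  obtains U N0 where "open U" "(\<lambda>P. \<tau> (nceval a P)) \<in> U"
    "\<forall>N\<ge>N0. splits (exp (\<delta> * (real N)\<^sup>2)) (orbit_close N F \<epsilon>) (microstates R N (tracial_laws R \<inter> U))"
proof -
  \<comment> \<open>the generators as sums of products\<close>
  have "\<exists>us. norm (a i - (\<Sum>(x, y)\<leftarrow>us. jA x * jB y)) < \<epsilon> / 8" for i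
  proof -
    have "a i \<in> closure (range (\<lambda>us. \<Sum>(x, y)\<leftarrow>us. jA x * jB y))" by (simp add: dense)
    moreover have "\<epsilon> / 8 > 0" using eps by simp
    ultimately obtain us where "dist (\<Sum>(x, y)\<leftarrow>us. jA x * jB y) (a i) < \<epsilon> / 8"
      unfolding closure_approachable by blast
    then show ?thesis by (auto simp: dist_norm norm_minus_commute)
  qed
  then obtain us where us: "\<And>i. norm (a i - (\<Sum>(x, y)\<leftarrow>us i. jA x * jB y)) < \<epsilon> / 8" by metis
  define pairs where "pairs = (\<Union>i\<in>F. set (us i))"
  define S where "S = fst ` pairs"
  define T0 where "T0 = snd ` pairs"
  have fin: "finite S" "finite T0" using F by (simp_all add: pairs_def S_def T0_def)
  have inS: "x \<in> S" and inT0: "y \<in> T0" if "i \<in> F" "(x, y) \<in> set (us i)" for i x y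
    using that by (force simp: pairs_def S_def T0_def)+
  define L where "L = 1 + (\<Sum>i\<in>F. real (length (us i)))"
  have L1: "L \<ge> 1" by (simp add: L_def sum_nonneg)
  have L: "real (length (us i)) \<le> L" if "i \<in> F" for i
    using member_le_sum [of i F "\<lambda>i. real (length (us i))"] that F by (simp add: L_def)
  define Z0 where "Z0 = jA ` S \<union> jB ` T0"
  have Z0: "finite Z0" using fin by (simp add: Z0_def)
  define K0 where "K0 = kbound Z0"
  have K0: "K0 > 0" using kbound_pos [OF Z0] by (simp add: K0_def)
  \<comment> \<open>accuracy for the legs\<close>
  define \<zeta> where "\<zeta> = (\<epsilon> / (8 * L))\<^sup>2 / (4 * K0)"
  have \<zeta>: "\<zeta> > 0" "sqrt (4 * K0 * \<zeta>) = \<epsilon> / (8 * L)"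
    using eps L1 K0 sqrt_scale [OF K0, of "\<epsilon> / (8 * L)"] by (simp_all add: \<zeta>_def)
  define q' where "q' = 4 * K0\<^sup>2 / \<zeta>\<^sup>2 + 5"
  have q': "q' > 0" by (simp add: q'_def add_nonneg_pos)
  define \<eta>' where "\<eta>' = \<delta> / (8 * q' * (real (card S) + 1))"
  have \<eta>': "\<eta>' > 0" using del q' by (simp add: \<eta>'_def add_nonneg_pos)
  have \<eta>'6: "\<eta>' / 6 > 0" using \<eta>' by simp
  obtain y0 \<theta>y cy my Ry Ty py0 where y0: "y0\<^sup>\<star> = y0" and yD: "spread_data \<theta>y cy my Ry Ty"
    and yb: "\<forall>t\<in>Ty. Re (\<tau> (bump cy t my (jB y0))) < \<eta>' / 6" and yt: "Re (\<tau> (jB y0 ^ (2 * py0))) < \<eta>' / 6 * Ry ^ (2 * py0)"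
    using B.diffuse_spread [OF t dB \<eta>'6] .
  have thy: "\<theta>y > 0" and Ry: "Ry \<ge> 1" using yD by (auto simp: spread_data_def)
  define Z2 where "Z2 = insert (jB y0) Z0"
  have Z2: "finite Z2" using Z0 by (simp add: Z2_def)
  define K2 where "K2 = kbound Z2"
  have K2: "K2 > 0" using kbound_pos [OF Z2] by (simp add: K2_def)
  define T where "T = insert y0 T0"
  have T: "finite T" using fin by (simp add: T_def)
  define s2 where "s2 = \<theta>y * \<zeta> / 8"
  define \<zeta>y where "\<zeta>y = min \<zeta> (s2\<^sup>2 / (4 * K2))"
  have s2: "s2 > 0" using thy \<zeta> by (simp add: s2_def)
  have \<zeta>y: "\<zeta>y > 0" "\<zeta>y \<le> \<zeta>" "\<zeta>y \<le> s2\<^sup>2 / (4 * K2)" using \<zeta> s2 K2 by (auto simp: \<zeta>y_def)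
  define q where "q = 4 * K2\<^sup>2 / \<zeta>y\<^sup>2 + 5"
  have q: "q > 0" by (simp add: q_def add_nonneg_pos)
  define \<eta> where "\<eta> = \<delta> / (8 * q * (real (card T) + 1))"
  have \<eta>: "\<eta> > 0" using del q by (simp add: \<eta>_def add_nonneg_pos)
  have \<eta>6: "\<eta> / 6 > 0" using \<eta> by simp
  obtain x0 \<theta>x cx mx Rx Tx px0 where x0: "x0\<^sup>\<star> = x0" and xD: "spread_data \<theta>x cx mx Rx Tx"
    and xb: "\<forall>t\<in>Tx. Re (\<tau> (bump cx t mx (jA x0))) < \<eta> / 6" and xt: "Re (\<tau> (jA x0 ^ (2 * px0))) < \<eta> / 6 * Rx ^ (2 * px0)"
    using A.diffuse_spread [OF t dA \<eta>6] .
  have thx: "\<theta>x > 0" and Rx: "Rx \<ge> 1" using xD by (auto simp: spread_data_def)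
  define Z where "Z = insert (jA x0) Z2"
  have Z: "finite Z" using Z2 by (simp add: Z_def)
  define K where "K = kbound Z"
  have K: "K > 0" "K2 \<le> K" "K0 \<le> K2"
    using kbound_pos [OF Z] kbound_insert [OF Z2] kbound_insert [OF Z0] by (auto simp: K_def K2_def K0_def Z_def Z2_def)
  define s1 where "s1 = \<theta>x * \<zeta>y / 8"
  have s1: "s1 > 0" using thx \<zeta>y by (simp add: s1_def)
  define z where "z = s1\<^sup>2 / (2 * K)"
  have z: "z > 0" "sqrt (2 * K * z) = s1" using s1 K by (simp_all add: z_def)
  define \<kappa> where "\<kappa> = min (2 * s1) (2 * s2)"
  have \<kappa>: "\<kappa> > 0" "\<kappa> \<le> 2 * s1" "\<kappa> \<le> 2 * s2" using s1 s2 by (auto simp: \<kappa>_def)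
  have kap1: "\<kappa> + 2 * sqrt (2 * K * z) \<le> \<theta>x * \<zeta>y / 2" using \<kappa> z by (simp add: s1_def)
  have kap2: "\<kappa> + 2 * sqrt (2 * K2 * (2 * \<zeta>y)) \<le> \<theta>y * \<zeta> / 2"
  proof -
    have "2 * K2 * (2 * \<zeta>y) \<le> 4 * K2 * (s2\<^sup>2 / (4 * K2))"
      using mult_left_mono [OF \<zeta>y(3), of "4 * K2"] K2 by simp
    then have "sqrt (2 * K2 * (2 * \<zeta>y)) \<le> s2"
      using real_sqrt_le_mono sqrt_scale [OF K2 s2] by metis
    then show ?thesis using \<kappa> by (simp add: s2_def)
  qed
  \<comment> \<open>accuracy of polynomials\<close>
  define M where "M = 1 + (\<Sum>w\<in>Z. norm w)"
  have M: "norm w \<le> M" if "w \<in> Z" for w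
    using member_le_sum [of w Z norm] Z that by (simp add: M_def)
  have M1: "M \<ge> 1" by (simp add: M_def sum_nonneg)
  define b where "b = 2 * M + 1"
  have b: "b > 0" using M1 by (simp add: b_def)
  define k where "k = min 1 (min (\<epsilon> / (16 * L * b)) (\<kappa> / (4 * b)))"
  have k: "k > 0" "k \<le> 1" "k \<le> \<epsilon> / (16 * L * b)" "k \<le> \<kappa> / (4 * b)"
    using eps L1 b \<kappa> by (auto simp: k_def)
  have kL: "L * (k * b) \<le> \<epsilon> / 16"
  proof -
    have "L * (k * b) \<le> L * (\<epsilon> / (16 * L * b) * b)" using k(3) b L1 by (intro mult_left_mono mult_right_mono) auto
    then show ?thesis using b L1 by simp
  qed
  have kk': "2 * (k * b) \<le> \<kappa> / 2"
  proof -
    have "2 * (k * b) \<le> 2 * (\<kappa> / (4 * b) * b)" using k(4) b by (intro mult_left_mono mult_right_mono) auto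
    then show ?thesis using b by simp
  qed
  define r where "r = min (min 1 (\<epsilon> / 16)) (min (\<kappa> / 2) (min (\<eta> / 6) (\<eta>' / 6)))"
  have r: "r > 0" "r \<le> 1" "r \<le> \<epsilon> / 16" "r \<le> \<kappa> / 2" "r \<le> \<eta> / 6" "r \<le> \<eta>' / 6"
    using eps \<kappa> \<eta> \<eta>' by (auto simp: r_def)
  have contt: "continuous_on UNIV (\<lambda>w. Re (\<tau> (f w)))" if "continuous_on UNIV f" for f :: "'c \<Rightarrow> 'c"
    by (intro continuous_intros continuous_on_compose2 [OF continuous_trace [OF t] that]) auto
  have openb: "open {w. (\<forall>t\<in>G. Re (\<tau> (bump c t m w)) < e) \<and> Re (\<tau> (w ^ p)) < e' \<and> dist w w0 < k}" if "finite G" for G c m p e e' w0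
  proof -
    have "open {w. Re (\<tau> (bump c t m w)) < e}" for t
      by (intro open_Collect_less contt continuous_bump continuous_intros)
    moreover have "open {w. Re (\<tau> (w ^ p)) < e'}"
      by (intro open_Collect_less contt continuous_intros)
    moreover have "open {w. dist w w0 < k}"
      by (intro open_Collect_less continuous_intros)
    moreover have "{w. \<forall>t\<in>G. Re (\<tau> (bump c t m w)) < e} = (\<Inter>t\<in>G. {w. Re (\<tau> (bump c t m w)) < e})" by auto
    ultimately show ?thesis
      using that by (intro open_Collect_conj) (simp_all add: open_INT)
  qed
  have xself: "(jA x0)\<^sup>\<star> = jA x0" "(jB y0)\<^sup>\<star> = jB y0" using A.j_star [of x0] B.j_star [of y0] x0 y0 by simp_all
  have finT: "finite Tx" "finite Ty" using xD yD by (auto simp: spread_data_def)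
  define OX where "OX = {w. (\<forall>t\<in>Tx. Re (\<tau> (bump cx t mx w)) < \<eta> / 6) \<and> Re (\<tau> (w ^ (2 * px0))) < \<eta> / 6 * Rx ^ (2 * px0) \<and> dist w (jA x0) < k}"
  have OX: "open OX" "jA x0 \<in> OX"
    unfolding OX_def by (rule openb [OF finT(1)]) (use xb xt k(1) in simp)
  obtain PX where PX0: "nceval a PX \<in> OX"
    and PXh: "\<forall>N A. (\<forall>i. A i \<in> carrier_mat N N) \<longrightarrow> adj (mat_ev N A PX) = mat_ev N A PX"
    by (rule hermitian_approx [OF gen xself(1) OX])
  note PX = PX0 [unfolded OX_def]
  define OY where "OY = {w. (\<forall>t\<in>Ty. Re (\<tau> (bump cy t my w)) < \<eta>' / 6) \<and> Re (\<tau> (w ^ (2 * py0))) < \<eta>' / 6 * Ry ^ (2 * py0) \<and> dist w (jB y0) < k}"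
  have OY: "open OY" "jB y0 \<in> OY"
    unfolding OY_def by (rule openb [OF finT(2)]) (use yb yt k(1) in simp)
  obtain PY where PY0: "nceval a PY \<in> OY"
    and PYh: "\<forall>N A. (\<forall>i. A i \<in> carrier_mat N N) \<longrightarrow> adj (mat_ev N A PY) = mat_ev N A PY"
    by (rule hermitian_approx [OF gen xself(2) OY])
  note PY = PY0 [unfolded OY_def]
  have approx: "\<exists>P. norm (nceval a P - w) < k" for w
  proof -
    have "w \<in> closure (range (nceval a))" using gen by (simp add: generates_def)
    then obtain v where "v \<in> range (nceval a)" "dist v w < k" unfolding closure_approachable using k(1) by blast
    then show ?thesis by (auto simp: dist_norm)
  qed
  obtain ap where ap: "\<And>w. norm (nceval a (ap w) - w) < k" using approx by metis
  define px where "px x = ap (jA x)" for x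
  define py where "py y = (if y = y0 then PY else ap (jB y))" for y
  have nx: "norm (nceval a (px x) - jA x) \<le> k" for x using ap [of "jA x"] by (simp add: px_def)
  have ny: "norm (nceval a (py y) - jB y) \<le> k" for y using ap [of "jB y"] PY by (simp add: py_def dist_norm)
  have nX: "norm (nceval a PX - jA x0) \<le> k" using PX by (simp add: dist_norm)
  have mem: "jA x0 \<in> Z" "jB y0 \<in> Z" "x \<in> S \<Longrightarrow> jA x \<in> Z" "y \<in> T \<Longrightarrow> jB y \<in> Z"
    "x \<in> S \<Longrightarrow> jA x \<in> Z0" "y \<in> T0 \<Longrightarrow> jB y \<in> Z0" "y \<in> T \<Longrightarrow> jB y \<in> Z2" for x y
    by (auto simp: Z_def Z2_def Z0_def T_def)
  \<comment> \<open>the finitely many words\<close>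
  define Wg where "Wg i = ncvar i - (\<Sum>(x, y)\<leftarrow>us i. px x * py y)" for i
  define \<W> where "\<W> = tame_words PX \<union> (\<Union>x\<in>S. tame_words (px x)) \<union> (\<Union>y\<in>T. tame_words (py y))
    \<union> (\<lambda>y. PX * py y - py y * PX) ` T \<union> (\<lambda>x. py y0 * px x - px x * py y0) ` S \<union> Wg ` F"
  define \<V> where "\<V> = (\<lambda>t. bump cx t mx PX) ` Tx \<union> (\<lambda>t. bump cy t my PY) ` Ty \<union> {PX ^ (2 * px0), PY ^ (2 * py0)}"
  have "finite \<W>" "finite \<V>" using fin T F finT by (auto simp: \<W>_def \<V>_def tame_words_def)
  then obtain U where U: "open U" "(\<lambda>P. \<tau> (nceval a P)) \<in> U"
    and UWV: "\<forall>N>0. \<forall>A. (\<forall>i. A i \<in> carrier_mat N N) \<longrightarrow> mat_law N A \<in> U \<longrightarrow>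
      (\<forall>W\<in>\<W>. norm (mat_ev N A W) \<le> (norm (nceval a W) + r) * sqrt N) \<and>
      (\<forall>V\<in>\<V>. Re (tr (mat_ev N A V)) / N \<le> Re (\<tau> (nceval a V)) + r)"
    by (rule law_neighbourhood [OF t _ _ r(1)])
  obtain N1 :: nat where N1: "4 * (4 * K\<^sup>2 / z\<^sup>2 + 5) / \<delta> \<le> real N1" using real_arch_simple by blast
  have main: "splits (exp (\<delta> * (real N)\<^sup>2)) (orbit_close N F \<epsilon>) (microstates R N (tracial_laws R \<inter> U))"
    if NN: "N \<ge> max 1 N1" for N
  proof -
    have N: "N > 0" using NN by simp
    define \<Omega> where "\<Omega> = microstates R N (tracial_laws R \<inter> U)"
    have car: "A i \<in> carrier_mat N N" and law: "mat_law N A \<in> U" if "A \<in> \<Omega>" for A i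
      using that by (auto simp: \<Omega>_def microstates_def)
    have W: "norm (mat_ev N A W) \<le> (norm (nceval a W) + r) * sqrt N" if "A \<in> \<Omega>" "W \<in> \<W>" for A W
      using UWV N car law that by blast
    have V: "Re (tr (mat_ev N A V)) / N \<le> Re (\<tau> (nceval a V)) + r" if "A \<in> \<Omega>" "V \<in> \<V>" for A V
      using UWV N car law that by blast
    have hX: "adj (mat_ev N A PX) = mat_ev N A PX" and hY: "adj (mat_ev N A PY) = mat_ev N A PY" if "A \<in> \<Omega>" for A
      using PXh PYh car [OF that] by blast+
    have tX: "tame (kk (jA x0)) N (mat_ev N A PX)" if A: "A \<in> \<Omega>" for A
      by (rule tame_of_words [OF car [OF A] W [OF A] r(2)]) (use nX k in \<open>auto simp: \<W>_def\<close>)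
    have txs: "tame (kk (jA x)) N (mat_ev N A (px x))" if A: "A \<in> \<Omega>" and x: "x \<in> S" for A x
      by (rule tame_of_words [OF car [OF A] W [OF A] r(2)]) (use nx [of x] k x in \<open>auto simp: \<W>_def\<close>)
    have tys: "tame (kk (jB y)) N (mat_ev N A (py y))" if A: "A \<in> \<Omega>" and y: "y \<in> T" for A y
      by (rule tame_of_words [OF car [OF A] W [OF A] r(2)]) (use ny [of y] k y in \<open>auto simp: \<W>_def\<close>)
    have com1: "norm (mat_ev N A PX * mat_ev N A (py y) - mat_ev N A (py y) * mat_ev N A PX) \<le> \<kappa> * sqrt N"
      if A: "A \<in> \<Omega>" and y: "y \<in> T" for A y
    proof -
      have "norm (nceval a (PX * py y - py y * PX)) \<le> 2 * (k * b)"
        unfolding cstar_eval.ev_diff cstar_eval.ev_mult b_def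
        by (rule norm_commutator_diff [OF nX ny k(2) M M commute]) (use mem y in auto)
      then have "norm (nceval a (PX * py y - py y * PX)) + r \<le> \<kappa>" using kk' r(4) by linarith
      then have "(norm (nceval a (PX * py y - py y * PX)) + r) * sqrt N \<le> \<kappa> * sqrt N" by (rule mult_right_mono) simp
      moreover have "PX * py y - py y * PX \<in> \<W>" using y by (auto simp: \<W>_def)
      ultimately have "norm (mat_ev N A (PX * py y - py y * PX)) \<le> \<kappa> * sqrt N" using W [OF A] by (meson order_trans)
      then show ?thesis by (simp add: mat_eval.ev_diff mat_eval.ev_mult)
    qed
    have com2: "norm (mat_ev N A (py y0) * mat_ev N A (px x) - mat_ev N A (px x) * mat_ev N A (py y0)) \<le> \<kappa> * sqrt N"
      if A: "A \<in> \<Omega>" and x: "x \<in> S" for A x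
    proof -
      have "norm (nceval a (py y0 * px x - px x * py y0)) \<le> 2 * (k * b)"
        unfolding cstar_eval.ev_diff cstar_eval.ev_mult b_def
        by (rule norm_commutator_diff [OF ny nx k(2) M M commute [symmetric]]) (use mem x in auto)
      then have "norm (nceval a (py y0 * px x - px x * py y0)) + r \<le> \<kappa>" using kk' r(4) by linarith
      then have "(norm (nceval a (py y0 * px x - px x * py y0)) + r) * sqrt N \<le> \<kappa> * sqrt N" by (rule mult_right_mono) simp
      moreover have "py y0 * px x - px x * py y0 \<in> \<W>" using x by (auto simp: \<W>_def)
      ultimately have "norm (mat_ev N A (py y0 * px x - px x * py y0)) \<le> \<kappa> * sqrt N" using W [OF A] by (meson order_trans)
      then show ?thesis by (simp add: mat_eval.ev_diff mat_eval.ev_mult)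
    qed
    have gens: "norm (mat_ev N A (Wg i)) \<le> \<epsilon> / 4 * sqrt N" if A: "A \<in> \<Omega>" and i: "i \<in> F" for A i
    proof -
      have evs: "nceval a (\<Sum>(x, y)\<leftarrow>ps. px x * py y) = (\<Sum>(x, y)\<leftarrow>ps. nceval a (px x) * nceval a (py y))" for ps
        by (induction ps) (auto simp: cstar_eval.ev_add cstar_eval.ev_mult)
      have "(\<Sum>(x, y)\<leftarrow>ps. jA x * jB y) - (\<Sum>(x, y)\<leftarrow>ps. nceval a (px x) * nceval a (py y))
        = (\<Sum>p\<leftarrow>ps. - (nceval a (px (fst p)) * nceval a (py (snd p)) - jA (fst p) * jB (snd p)))" for ps
        by (induction ps) auto
      then have "nceval a (Wg i) = (a i - (\<Sum>(x, y)\<leftarrow>us i. jA x * jB y))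
        + (\<Sum>p\<leftarrow>us i. - (nceval a (px (fst p)) * nceval a (py (snd p)) - jA (fst p) * jB (snd p)))"
        by (simp add: Wg_def cstar_eval.ev_diff nceval_var evs algebra_simps)
      also have "norm \<dots> \<le> norm (a i - (\<Sum>(x, y)\<leftarrow>us i. jA x * jB y))
        + norm (\<Sum>p\<leftarrow>us i. - (nceval a (px (fst p)) * nceval a (py (snd p)) - jA (fst p) * jB (snd p)))"
        by (rule norm_triangle_ineq)
      also have "\<dots> \<le> \<epsilon> / 8 + L * (k * b)"
      proof (rule add_mono)
        show "norm (a i - (\<Sum>(x, y)\<leftarrow>us i. jA x * jB y)) \<le> \<epsilon> / 8" using us [of i] by simp
        have "norm (\<Sum>p\<leftarrow>us i. - (nceval a (px (fst p)) * nceval a (py (snd p)) - jA (fst p) * jB (snd p))) \<le> real (length (us i)) * (k * b)"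
        proof (rule norm_sum_list_le)
          fix p assume "p \<in> set (us i)"
          then have p: "fst p \<in> S" "snd p \<in> T" using inS [OF i, of "fst p" "snd p"] inT0 [OF i, of "fst p" "snd p"] by (auto simp: T_def)
          show "norm (- (nceval a (px (fst p)) * nceval a (py (snd p)) - jA (fst p) * jB (snd p))) \<le> k * b"
            unfolding norm_minus_cancel b_def
            by (rule norm_product_diff [OF nx ny k(2) M M]) (use mem p in auto)
        qed
        also have "\<dots> \<le> L * (k * b)" using L [OF i] k b by (intro mult_right_mono) auto
        finally show "norm (\<Sum>p\<leftarrow>us i. - (nceval a (px (fst p)) * nceval a (py (snd p)) - jA (fst p) * jB (snd p))) \<le> L * (k * b)" .
      qed
      finally have "norm (nceval a (Wg i)) + r \<le> \<epsilon> / 4" using kL r(3) by linarith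
      then have "(norm (nceval a (Wg i)) + r) * sqrt N \<le> \<epsilon> / 4 * sqrt N" by (rule mult_right_mono) simp
      moreover have "Wg i \<in> \<W>" using i by (auto simp: \<W>_def)
      ultimately show ?thesis using W [OF A] by (meson order_trans)
    qed
    have sprx: "spread N \<eta> \<theta>x (mat_ev N A PX)" if A: "A \<in> \<Omega>" for A
    proof -
      have "spread N (3 * (\<eta> / 3)) \<theta>x (mat_ev N A PX)"
      proof (rule spread_of_data [OF xD N])
        fix t assume "t \<in> Tx"
        then have "Re (tr (mat_ev N A (bump cx t mx PX))) / N \<le> Re (\<tau> (nceval a (bump cx t mx PX))) + r"
          by (intro V [OF A]) (auto simp: \<V>_def)
        also have "Re (\<tau> (nceval a (bump cx t mx PX))) < \<eta> / 6" using PX \<open>t \<in> Tx\<close> by (simp add: nceval_bump)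
        finally show "Re (tr (mat_ev N A (bump cx t mx PX))) / N \<le> \<eta> / 3" using r(5) by simp
      next
        have "Re (tr (mat_ev N A (PX ^ (2 * px0)))) / N \<le> Re (\<tau> (nceval a (PX ^ (2 * px0)))) + r"
          by (intro V [OF A]) (auto simp: \<V>_def)
        also have "Re (\<tau> (nceval a (PX ^ (2 * px0)))) < \<eta> / 6 * Rx ^ (2 * px0)" using PX by (simp add: nceval_power)
        finally have "Re (tr (mat_ev N A (PX ^ (2 * px0)))) / N \<le> \<eta> / 6 * Rx ^ (2 * px0) + \<eta> / 6 * 1" using r(5) by simp
        also have "\<dots> \<le> \<eta> / 6 * Rx ^ (2 * px0) + \<eta> / 6 * Rx ^ (2 * px0)"
          using Rx \<eta> by (intro add_left_mono mult_left_mono one_le_power) auto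
        finally show "Re (tr (mat_ev N A (PX ^ (2 * px0)))) / N \<le> \<eta> / 3 * Rx ^ (2 * px0)" by simp
      qed
      then show ?thesis by simp
    qed
    have spry: "spread N \<eta>' \<theta>y (mat_ev N A PY)" if A: "A \<in> \<Omega>" for A
    proof -
      have "spread N (3 * (\<eta>' / 3)) \<theta>y (mat_ev N A PY)"
      proof (rule spread_of_data [OF yD N])
        fix t assume "t \<in> Ty"
        then have "Re (tr (mat_ev N A (bump cy t my PY))) / N \<le> Re (\<tau> (nceval a (bump cy t my PY))) + r"
          by (intro V [OF A]) (auto simp: \<V>_def)
        also have "Re (\<tau> (nceval a (bump cy t my PY))) < \<eta>' / 6" using PY \<open>t \<in> Ty\<close> by (simp add: nceval_bump)
        finally show "Re (tr (mat_ev N A (bump cy t my PY))) / N \<le> \<eta>' / 3" using r(6) by simp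
      next
        have "Re (tr (mat_ev N A (PY ^ (2 * py0)))) / N \<le> Re (\<tau> (nceval a (PY ^ (2 * py0)))) + r"
          by (intro V [OF A]) (auto simp: \<V>_def)
        also have "Re (\<tau> (nceval a (PY ^ (2 * py0)))) < \<eta>' / 6 * Ry ^ (2 * py0)" using PY by (simp add: nceval_power)
        finally have "Re (tr (mat_ev N A (PY ^ (2 * py0)))) / N \<le> \<eta>' / 6 * Ry ^ (2 * py0) + \<eta>' / 6 * 1" using r(6) by simp
        also have "\<dots> \<le> \<eta>' / 6 * Ry ^ (2 * py0) + \<eta>' / 6 * Ry ^ (2 * py0)"
          using Ry \<eta>' by (intro add_left_mono mult_left_mono one_le_power) auto
        finally show "Re (tr (mat_ev N A (PY ^ (2 * py0)))) / N \<le> \<eta>' / 3 * Ry ^ (2 * py0)" by simp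
      qed
      then show ?thesis by simp
    qed
    have kX: "kk (jA x0) \<le> K" using kbound_ge [OF Z mem(1)] by (simp add: K_def)
    have kS: "kk (jA x) \<le> K0" if "x \<in> S" for x using kbound_ge [OF Z0 mem(5) [OF that]] by (simp add: K0_def)
    have kT0: "kk (jB y) \<le> K0" if "y \<in> T0" for y using kbound_ge [OF Z0 mem(6) [OF that]] by (simp add: K0_def)
    have kT: "kk (jB y) \<le> K2" if "y \<in> T" for y using kbound_ge [OF Z2 mem(7) [OF that]] by (simp add: K2_def)
    have pyy: "py y0 = PY" by (simp add: py_def)
    have xs0: "tame K0 N (mat_ev N A (px x))" if "A \<in> \<Omega>" "x \<in> S" for A x by (rule tame_mono [OF txs [OF that] kS [OF that(2)]])
    have xs2: "tame K2 N (mat_ev N A (px x))" if "A \<in> \<Omega>" "x \<in> S" for A x by (rule tame_mono [OF xs0 [OF that] K(3)])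
    have xsn: "norm (mat_ev N A (px x)) \<le> K0 * sqrt N" if "A \<in> \<Omega>" "x \<in> S" for A x using xs0 [OF that] by (simp add: tame_def)
    have ys2: "tame K2 N (mat_ev N A (py y))" if "A \<in> \<Omega>" "y \<in> T" for A y by (rule tame_mono [OF tys [OF that] kT [OF that(2)]])
    have "splits (exp (real N * (4 * K\<^sup>2 / z\<^sup>2 + 5)) * (exp (2 * \<eta> * (real N)\<^sup>2 * q) ^ card T * exp (2 * \<eta>' * (real N)\<^sup>2 * q') ^ card S))
      (\<lambda>P. \<forall>A\<in>P. \<forall>B\<in>P. \<exists>V. unitary N V \<and>
        (\<forall>y\<in>T. norm (mat_ev N A (py y) - V * mat_ev N B (py y) * adj V) \<le> 2 * \<zeta>y * sqrt N) \<and>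
        (\<forall>x\<in>S. norm (mat_ev N A (px x) - V * mat_ev N B (px x) * adj V) \<le> 2 * \<zeta> * sqrt N)) \<Omega>"
      unfolding q_def q'_def
      by (rule two_stage_splits [where X = "\<lambda>A. mat_ev N A PX" and Ys = "\<lambda>y A. mat_ev N A (py y)" and Xs = "\<lambda>x A. mat_ev N A (px x)" and y = y0 and \<theta>x = \<theta>x and \<theta>y = \<theta>y and \<kappa> = \<kappa>])
        (use N fin T K K2 \<eta> \<eta>' thx thy \<zeta> \<zeta>y z kap1 kap2 tame_mono [OF tX kX] hX hY sprx spry xs2 xsn ys2 com1 com2
          in \<open>simp_all add: T_def pyy\<close>)
    then have "splits (exp (\<delta> * (real N)\<^sup>2)) (orbit_close N F \<epsilon>) \<Omega>"
    proof (rule splits_mono)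
      have "real N * (4 * K\<^sup>2 / z\<^sup>2 + 5) \<le> \<delta> / 4 * (real N)\<^sup>2"
      proof -
        have "4 * (4 * K\<^sup>2 / z\<^sup>2 + 5) / \<delta> \<le> real N" using N1 NN by linarith
        then have "4 * K\<^sup>2 / z\<^sup>2 + 5 \<le> \<delta> / 4 * real N" using del by (simp add: divide_le_eq mult.commute)
        then have "real N * (4 * K\<^sup>2 / z\<^sup>2 + 5) \<le> real N * (\<delta> / 4 * real N)" by (rule mult_left_mono) simp
        then show ?thesis by (simp add: power2_eq_square mult_ac)
      qed
      then have "exp (real N * (4 * K\<^sup>2 / z\<^sup>2 + 5)) * (exp (2 * \<eta> * (real N)\<^sup>2 * q) ^ card T * exp (2 * \<eta>' * (real N)\<^sup>2 * q') ^ card S)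
        \<le> exp (\<delta> / 4 * (real N)\<^sup>2) * (exp (\<delta> / 4 * (real N)\<^sup>2) * exp (\<delta> / 4 * (real N)\<^sup>2))"
        by (intro mult_mono exp_count_le [OF q \<eta>_def del] exp_count_le [OF q' \<eta>'_def del]) auto
      also have "\<dots> = exp (3 / 4 * (\<delta> * (real N)\<^sup>2))" by (simp flip: exp_add)
      also have "\<dots> \<le> exp (\<delta> * (real N)\<^sup>2)" using del by simp
      finally show "exp (real N * (4 * K\<^sup>2 / z\<^sup>2 + 5)) * (exp (2 * \<eta> * (real N)\<^sup>2 * q) ^ card T * exp (2 * \<eta>' * (real N)\<^sup>2 * q') ^ card S)
        \<le> exp (\<delta> * (real N)\<^sup>2)" .
    next
      fix P assume P: "P \<subseteq> \<Omega>" and cl: "\<forall>A\<in>P. \<forall>B\<in>P. \<exists>V. unitary N V \<and>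
        (\<forall>y\<in>T. norm (mat_ev N A (py y) - V * mat_ev N B (py y) * adj V) \<le> 2 * \<zeta>y * sqrt N) \<and>
        (\<forall>x\<in>S. norm (mat_ev N A (px x) - V * mat_ev N B (px x) * adj V) \<le> 2 * \<zeta> * sqrt N)"
      show "orbit_close N F \<epsilon> P"
        unfolding orbit_close_def
      proof (intro ballI)
        fix A B assume AB: "A \<in> P" "B \<in> P"
        then have A: "A \<in> \<Omega>" and B: "B \<in> \<Omega>" using P by auto
        obtain V where V: "unitary N V"
          and Vy: "\<forall>y\<in>T. norm (mat_ev N A (py y) - V * mat_ev N B (py y) * adj V) \<le> 2 * \<zeta>y * sqrt N"
          and Vx: "\<forall>x\<in>S. norm (mat_ev N A (px x) - V * mat_ev N B (px x) * adj V) \<le> 2 * \<zeta> * sqrt N"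
          using cl AB by blast
        have Vy': "norm (mat_ev N A (py y) - V * mat_ev N B (py y) * adj V) \<le> 2 * \<zeta> * sqrt N" if "y \<in> T" for y
        proof -
          have "2 * \<zeta>y * sqrt N \<le> 2 * \<zeta> * sqrt N" using \<zeta>y(2) by (intro mult_right_mono) auto
          then show ?thesis using Vy that by (meson order_trans)
        qed
        obtain U' where U': "U' \<in> unitary_mats N" "of_mat N U' = V" using unitary_mats_of_unitary [OF V] .
        have "mat_norm2 (A i - U' * B i * mat_adjoint U') < \<epsilon>" if i: "i \<in> F" for i
        proof (rule mat_norm2_conj [OF N car [OF A] car [OF B] U'])
          show "norm (of_mat N (A i) - V * of_mat N (B i) * adj V) \<le> (2 * (\<epsilon> / 4) + real (length (us i)) * (2 * sqrt (4 * K0 * \<zeta>))) * sqrt N"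
          proof (rule generators_close [where px = px and py = py, OF car [OF A] car [OF B] V _ _ _ _ _ Wg_def gens [OF A i] gens [OF B i]])
            show "K0 \<ge> 0" using K0 by simp
            fix x y assume xy: "(x, y) \<in> set (us i)"
            have x: "x \<in> S" and y: "y \<in> T0" using inS [OF i xy] inT0 [OF i xy] .
            show "norm (mat_ev N A (px x) - V * mat_ev N B (px x) * adj V) \<le> 2 * \<zeta> * sqrt N" using Vx x by blast
            show "norm (mat_ev N A (py y) - V * mat_ev N B (py y) * adj V) \<le> 2 * \<zeta> * sqrt N" using Vy' y by (simp add: T_def)
            show "tame K0 N (mat_ev N A (px x)) \<and> tame K0 N (mat_ev N B (px x))" using xs0 [OF A x] xs0 [OF B x] by simp
            have "y \<in> T" using y by (simp add: T_def)
            then show "tame K0 N (mat_ev N A (py y)) \<and> tame K0 N (mat_ev N B (py y))"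
              using tame_mono [OF tys [OF A] kT0 [OF y]] tame_mono [OF tys [OF B] kT0 [OF y]] by simp
          qed
          have "real (length (us i)) * (2 * sqrt (4 * K0 * \<zeta>)) \<le> L * (2 * (\<epsilon> / (8 * L)))"
            unfolding \<zeta>(2) using L [OF i] eps L1 by (intro mult_right_mono) auto
          also have "\<dots> = \<epsilon> / 4" using L1 by simp
          finally show "2 * (\<epsilon> / 4) + real (length (us i)) * (2 * sqrt (4 * K0 * \<zeta>)) < \<epsilon>" using eps by simp
        qed
        then show "\<exists>U\<in>unitary_mats N. \<forall>i\<in>F. mat_norm2 (A i - U * B i * mat_adjoint U) < \<epsilon>" using U'(1) by blast
      qed
    qed
    then show ?thesis by (simp add: \<Omega>_def)
  qed
  show thesis by (rule that [OF U]) (use main in blast)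
qed

end


lemma splits_UN:
  assumes J: "finite J" and s: "\<And>j. j \<in> J \<Longrightarrow> splits c P (\<Omega> j)"
  shows "splits (real (card J) * c) P (\<Union>j\<in>J. \<Omega> j)"
proof -
  have "\<forall>j\<in>J. \<exists>\<C>. finite \<C> \<and> real (card \<C>) \<le> c \<and> \<Omega> j \<subseteq> \<Union>\<C> \<and> (\<forall>S\<in>\<C>. S \<subseteq> \<Omega> j \<and> P S)"
    using s unfolding splits_def by simp
  from bchoice [OF this] obtain \<C> where C: "\<forall>j\<in>J. finite (\<C> j) \<and> real (card (\<C> j)) \<le> c \<and> \<Omega> j \<subseteq> \<Union>(\<C> j) \<and> (\<forall>S\<in>\<C> j. S \<subseteq> \<Omega> j \<and> P S)" ..
  show ?thesis
  proof (rule splitsI)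
    let ?E = "\<Union>j\<in>J. \<C> j"
    show "finite ?E" using J C by (intro finite_UN_I) simp_all
    have "real (card ?E) \<le> (\<Sum>j\<in>J. real (card (\<C> j)))"
      using card_UN_le [OF J, of \<C>] by (simp flip: of_nat_sum)
    also have "\<dots> \<le> real (card J) * c" using C by (intro sum_bounded_above) simp
    finally show "real (card ?E) \<le> real (card J) * c" .
    show "(\<Union>j\<in>J. \<Omega> j) \<subseteq> \<Union>?E"
    proof
      fix A assume "A \<in> (\<Union>j\<in>J. \<Omega> j)"
      then obtain j where j: "j \<in> J" "A \<in> \<Omega> j" by blast
      then have "A \<in> \<Union>(\<C> j)" using C by blast
      then show "A \<in> \<Union>?E" using j by blast
    qed
    fix T assume "T \<in> ?E"
    then obtain j where j: "j \<in> J" "T \<in> \<C> j" by blast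
    then have "T \<subseteq> \<Omega> j \<and> P T" using C by simp
    then show "T \<subseteq> (\<Union>j\<in>J. \<Omega> j)" "P T" using j by auto
  qed
qed

lemma log_count_splits:
  assumes "splits (exp b) (orbit_close N F \<epsilon>) \<Omega>"
  shows "log_count (orbital_covering_number N F \<epsilon> \<Omega>) \<le> ereal b"
proof -
  obtain \<C> where C: "finite \<C>" "real (card \<C>) \<le> exp b" "\<Omega> \<subseteq> \<Union>\<C>" "\<forall>S\<in>\<C>. S \<subseteq> \<Omega> \<and> orbit_close N F \<epsilon> S"
    by (rule splitsE [OF assms])
  define rep where "rep S = (SOME A. A \<in> S)" for S :: "('a \<Rightarrow> complex mat) set"
  have rep: "rep S \<in> S" if "A \<in> S" for A S unfolding rep_def by (rule someI [where P = "\<lambda>A. A \<in> S"]) (rule that)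
  define \<Omega>0 where "\<Omega>0 = rep ` {S \<in> \<C>. S \<noteq> {}}"
  have net: "orbital_net N F \<epsilon> \<Omega> \<Omega>0"
    unfolding orbital_net_def
  proof (intro conjI ballI)
    show "\<Omega>0 \<subseteq> \<Omega>"
    proof
      fix A assume "A \<in> \<Omega>0"
      then obtain S where "S \<in> \<C>" "S \<noteq> {}" "A = rep S" by (auto simp: \<Omega>0_def)
      then show "A \<in> \<Omega>" using C(4) rep by blast
    qed
    fix A assume "A \<in> \<Omega>"
    then obtain S where S: "S \<in> \<C>" "A \<in> S" using C(3) by blast
    then have "rep S \<in> \<Omega>0" by (auto simp: \<Omega>0_def)
    moreover have "\<exists>U\<in>unitary_mats N. \<forall>i\<in>F. mat_norm2 (A i - U * rep S i * mat_adjoint U) < \<epsilon>"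
      using C(4) S rep [OF S(2)] unfolding orbit_close_def by blast
    ultimately show "\<exists>B\<in>\<Omega>0. \<exists>U\<in>unitary_mats N. \<forall>i\<in>F. mat_norm2 (A i - U * B i * mat_adjoint U) < \<epsilon>" by blast
  qed
  have fin: "finite \<Omega>0" using C(1) by (simp add: \<Omega>0_def)
  have "card \<Omega>0 \<le> card {S \<in> \<C>. S \<noteq> {}}" unfolding \<Omega>0_def using C(1) by (intro card_image_le) simp
  also have "\<dots> \<le> card \<C>" using C(1) by (intro card_mono) auto
  finally have card: "real (card \<Omega>0) \<le> exp b" using C(2) by linarith
  have "orbital_covering_number N F \<epsilon> \<Omega> \<le> enat (card \<Omega>0)"
    unfolding orbital_covering_number_def by (rule INF_lower2 [of \<Omega>0]) (use net fin in simp_all)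
  then obtain m where m: "orbital_covering_number N F \<epsilon> \<Omega> = enat m" "m \<le> card \<Omega>0"
    by (cases "orbital_covering_number N F \<epsilon> \<Omega>") auto
  show ?thesis
  proof (cases "m = 0")
    case False
    then have "real m > 0" by simp
    moreover have "real m \<le> exp b" using m(2) card by linarith
    ultimately have "ln (real m) \<le> ln (exp b)" by (intro ln_mono) simp_all
    then have "ln (real m) \<le> b" by simp
    then show ?thesis using False by (simp add: m(1) log_count_def)
  qed (simp add: m(1) log_count_def)
qed

lemma compact_traces: "compact (traces :: ('c::cstar_algebra \<Rightarrow> complex) set)"
proof -
  let ?B = "PiE (UNIV :: 'c set) (\<lambda>x. cball (0 :: complex) (norm x))"
  have "compactin (product_topology (\<lambda>_. euclidean) UNIV) ?B"
    by (simp add: compactin_PiE)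
  then have cB: "compact ?B" by (simp add: euclidean_product_topology)
  note c = continuous_on_product_coordinates
  have 1: "closed {\<tau> :: 'c \<Rightarrow> complex. \<forall>x y. \<tau> (x + y) = \<tau> x + \<tau> y}"
    by (intro closed_Collect_all closed_Collect_eq continuous_intros c)
  have 2: "closed {\<tau> :: 'c \<Rightarrow> complex. \<forall>r x. \<tau> (r *\<^sub>C x) = r * \<tau> x}"
    by (intro closed_Collect_all closed_Collect_eq continuous_intros c)
  have 3: "closed {\<tau> :: 'c \<Rightarrow> complex. \<forall>x. 0 \<le> Re (\<tau> (x\<^sup>\<star> * x)) \<and> Im (\<tau> (x\<^sup>\<star> * x)) = 0}"
    by (intro closed_Collect_all closed_Collect_conj closed_Collect_eq closed_Collect_le continuous_intros c)
  have 4: "closed {\<tau> :: 'c \<Rightarrow> complex. \<tau> 1 = 1}"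
    by (intro closed_Collect_eq continuous_intros c)
  have 5: "closed {\<tau> :: 'c \<Rightarrow> complex. \<forall>x y. \<tau> (x * y) = \<tau> (y * x)}"
    by (intro closed_Collect_all closed_Collect_eq continuous_intros c)
  have eq: "(traces :: ('c \<Rightarrow> complex) set) = ?B \<inter> ({\<tau>. \<forall>x y. \<tau> (x + y) = \<tau> x + \<tau> y} \<inter> {\<tau>. \<forall>r x. \<tau> (r *\<^sub>C x) = r * \<tau> x}
    \<inter> {\<tau>. \<forall>x. 0 \<le> Re (\<tau> (x\<^sup>\<star> * x)) \<and> Im (\<tau> (x\<^sup>\<star> * x)) = 0} \<inter> {\<tau>. \<tau> 1 = 1} \<inter> {\<tau>. \<forall>x y. \<tau> (x * y) = \<tau> (y * x)})" (is "_ = ?B \<inter> ?C")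
  proof
    show "traces \<subseteq> ?B \<inter> ?C"
    proof
      fix \<tau> :: "'c \<Rightarrow> complex" assume t: "\<tau> \<in> traces"
      have "\<tau> \<in> ?B" using in_tracesD(7) [OF t] by (simp add: PiE_iff)
      moreover have "\<tau> \<in> ?C"
        using in_tracesD(1,2,4,5) [OF t] in_tracesD(3) [OF t] by (simp add: complex_nonneg_Reals_iff)
      ultimately show "\<tau> \<in> ?B \<inter> ?C" by blast
    qed
    show "?B \<inter> ?C \<subseteq> traces"
      by (auto simp: traces_def states_def clinear_def scaleC_complex_def complex_nonneg_Reals_iff)
  qed
  show ?thesis unfolding eq by (intro compact_Int_closed cB closed_Int 1 2 3 4 5)
qed

lemma compact_trace_laws: "compact (trace_laws a)"
proof -
  have "trace_laws a = (\<lambda>\<tau> P. \<tau> (nceval a P)) ` traces" by (auto simp: trace_laws_def)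
  moreover have "continuous_on traces (\<lambda>\<tau> P. \<tau> (nceval a P))"
    by (intro continuous_on_coordinatewise_then_product continuous_on_subset [OF continuous_on_product_coordinates]) auto
  ultimately show ?thesis using compact_continuous_image [OF _ compact_traces] by simp
qed

lemma trace_law_tracial:
  assumes t: "\<tau> \<in> traces" and bound: "\<forall>i. norm (a i) \<le> R" and R: "R > 0"
  shows "(\<lambda>P. \<tau> (nceval a P)) \<in> tracial_laws R"
  unfolding tracial_laws_def mem_Collect_eq
proof (intro conjI allI)
  show "clinear (\<lambda>P. \<tau> (nceval a P))"
    by (simp add: clinear_def cstar_eval.ev_add cstar_eval.ev_scaleC in_tracesD [OF t] scaleC_complex_def)
  fix P Q
  show "\<tau> (nceval a (ncstar P * P)) \<in> \<real>\<^sub>\<ge>\<^sub>0" using in_tracesD(3) [OF t] by (simp add: cstar_eval.ev_mult nceval_star)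
  show "\<tau> (nceval a 1) = 1" by (simp add: nceval_one in_tracesD(4) [OF t])
  show "\<tau> (nceval a (P * Q)) = \<tau> (nceval a (Q * P))" by (simp add: cstar_eval.ev_mult in_tracesD(5) [OF t, of "nceval a P"])
  fix k j
  have "Re (\<tau> (nceval a ((ncstar (ncvar j) * ncvar j) ^ k))) \<le> norm (((a j)\<^sup>\<star> * a j) ^ k)"
    using in_tracesD(7) [OF t, of "((a j)\<^sup>\<star> * a j) ^ k"] complex_Re_le_cmod [of "\<tau> (((a j)\<^sup>\<star> * a j) ^ k)"]
    by (simp add: nceval_power cstar_eval.ev_mult nceval_star nceval_var)
  also have "\<dots> \<le> norm ((a j)\<^sup>\<star> * a j) ^ k" by (rule norm_power_ineq)
  also have "\<dots> = norm (a j) ^ (2 * k)" by (simp add: cstar_identity power_mult)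
  also have "\<dots> \<le> R ^ (2 * k)" using bound by (intro power_mono) auto
  finally show "Re (\<tau> (nceval a ((ncstar (ncvar j) * ncvar j) ^ k))) \<le> R ^ (2 * k)" .
qed

context commuting_pair
begin

theorem entropy_le_zero:
  fixes a :: "'i \<Rightarrow> 'c"
  assumes gen: "generates a" and bound: "\<forall>i. norm (a i) \<le> R" and R: "R > 0"
    and dA: "\<And>\<tau>. \<tau> \<in> traces \<Longrightarrow> diffuse (gns_space (\<lambda>x. \<tau> (jA x))) (gns_von_neumann (\<lambda>x. \<tau> (jA x)))"
    and dB: "\<And>\<tau>. \<tau> \<in> traces \<Longrightarrow> diffuse (gns_space (\<lambda>x. \<tau> (jB x))) (gns_von_neumann (\<lambda>x. \<tau> (jB x)))"
  shows "cstar_entropy R a \<le> 0"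
proof -
  have fixed: "(INF \<O>\<in>{\<O>. openin (top_of_set (tracial_laws R)) \<O> \<and> trace_laws a \<subseteq> \<O>}.
        limsup (\<lambda>N. ereal (1 / (real N)\<^sup>2) * log_count (orbital_covering_number N F \<epsilon> (microstates R N \<O>)))) \<le> 0 + ereal \<delta>"
    if F: "finite F" and eps: "\<epsilon> > 0" and del: "\<delta> > 0" for F :: "'i set" and \<epsilon> \<delta>
  proof -
    have del2: "\<delta> / 2 > 0" using del by simp
    have "\<forall>\<tau>\<in>traces. \<exists>p. open (fst p) \<and> (\<lambda>P. \<tau> (nceval a P)) \<in> fst p \<and>
      (\<forall>N\<ge>snd p. splits (exp (\<delta> / 2 * (real N)\<^sup>2)) (orbit_close N F \<epsilon>) (microstates R N (tracial_laws R \<inter> fst p)))"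
    proof
      fix \<tau> :: "'c \<Rightarrow> complex" assume t: "\<tau> \<in> traces"
      obtain U N0 where "open U" "(\<lambda>P. \<tau> (nceval a P)) \<in> U"
        "\<forall>N\<ge>N0. splits (exp (\<delta> / 2 * (real N)\<^sup>2)) (orbit_close N F \<epsilon>) (microstates R N (tracial_laws R \<inter> U))"
        by (rule local_splitting [OF gen t dA [OF t] dB [OF t] F eps del2])
      then show "\<exists>p. open (fst p) \<and> (\<lambda>P. \<tau> (nceval a P)) \<in> fst p \<and>
        (\<forall>N\<ge>snd p. splits (exp (\<delta> / 2 * (real N)\<^sup>2)) (orbit_close N F \<epsilon>) (microstates R N (tracial_laws R \<inter> fst p)))"
        by (intro exI [of _ "(U, N0)"]) simp
    qed
    from bchoice [OF this] obtain p where p: "\<forall>\<tau>\<in>traces. open (fst (p \<tau>)) \<and> (\<lambda>P. \<tau> (nceval a P)) \<in> fst (p \<tau>) \<and>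
      (\<forall>N\<ge>snd (p \<tau>). splits (exp (\<delta> / 2 * (real N)\<^sup>2)) (orbit_close N F \<epsilon>) (microstates R N (tracial_laws R \<inter> fst (p \<tau>))))" ..
    have opens: "\<And>\<tau>. \<tau> \<in> traces \<Longrightarrow> open (fst (p \<tau>))" using p by blast
    have cover: "trace_laws a \<subseteq> (\<Union>\<tau>\<in>traces. fst (p \<tau>))" using p by (auto simp: trace_laws_def)
    obtain J where J: "J \<subseteq> traces" "finite J" "trace_laws a \<subseteq> (\<Union>\<tau>\<in>J. fst (p \<tau>))"
      by (rule compactE_image [OF compact_trace_laws opens cover])
    define \<O> where "\<O> = tracial_laws R \<inter> (\<Union>\<tau>\<in>J. fst (p \<tau>))"
    have oO: "openin (top_of_set (tracial_laws R)) \<O>"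
      unfolding \<O>_def using J(1) opens by (intro openin_open_Int open_UN) auto
    have KO: "trace_laws a \<subseteq> \<O>"
      using J(3) trace_law_tracial [OF _ bound R] by (auto simp: \<O>_def trace_laws_def)
    define N1 where "N1 = Max (insert 1 (snd ` p ` J))"
    have N1: "snd (p \<tau>) \<le> N1" if "\<tau> \<in> J" for \<tau> using that J(2) by (simp add: N1_def)
    obtain N2 :: nat where N2: "ln (real (card J) + 1) / (\<delta> / 2) \<le> real N2" using real_arch_simple by blast
    have le: "ereal (1 / (real N)\<^sup>2) * log_count (orbital_covering_number N F \<epsilon> (microstates R N \<O>)) \<le> ereal \<delta>"
      if N: "N \<ge> max (max 1 N1) N2" for N
    proof -
      have N1': "real N \<ge> 1" using N by simp
      have "microstates R N \<O> = (\<Union>\<tau>\<in>J. microstates R N (tracial_laws R \<inter> fst (p \<tau>)))"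
        by (auto simp: microstates_def \<O>_def)
      moreover have "splits (real (card J) * exp (\<delta> / 2 * (real N)\<^sup>2)) (orbit_close N F \<epsilon>)
        (\<Union>\<tau>\<in>J. microstates R N (tracial_laws R \<inter> fst (p \<tau>)))"
      proof (rule splits_UN [OF J(2)])
        fix \<tau> assume "\<tau> \<in> J"
        then show "splits (exp (\<delta> / 2 * (real N)\<^sup>2)) (orbit_close N F \<epsilon>) (microstates R N (tracial_laws R \<inter> fst (p \<tau>)))"
          using p J(1) N1 [of \<tau>] N by auto
      qed
      ultimately have "splits (real (card J) * exp (\<delta> / 2 * (real N)\<^sup>2)) (orbit_close N F \<epsilon>) (microstates R N \<O>)" by simp
      then have "splits (exp (\<delta> * (real N)\<^sup>2)) (orbit_close N F \<epsilon>) (microstates R N \<O>)"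
      proof (rule splits_mono)
        have "ln (real (card J) + 1) \<le> \<delta> / 2 * real N2" using N2 del by (simp add: divide_le_eq mult.commute)
        also have "\<dots> \<le> \<delta> / 2 * (real N)\<^sup>2"
        proof (rule mult_left_mono)
          have "real N * 1 \<le> real N * real N" using N1' by (intro mult_left_mono) auto
          moreover have "real N2 \<le> real N" using N by simp
          ultimately show "real N2 \<le> (real N)\<^sup>2" by (simp add: power2_eq_square)
        qed (use del in simp)
        finally have l: "ln (real (card J) + 1) \<le> \<delta> / 2 * (real N)\<^sup>2" .
        have "real (card J) \<le> exp (ln (real (card J) + 1))" by (simp add: add_nonneg_pos)
        also have "\<dots> \<le> exp (\<delta> / 2 * (real N)\<^sup>2)" using l by (simp only: exp_le_cancel_iff)
        finally have "real (card J) * exp (\<delta> / 2 * (real N)\<^sup>2) \<le> exp (\<delta> / 2 * (real N)\<^sup>2) * exp (\<delta> / 2 * (real N)\<^sup>2)"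
          by (rule mult_right_mono) simp
        then show "real (card J) * exp (\<delta> / 2 * (real N)\<^sup>2) \<le> exp (\<delta> * (real N)\<^sup>2)" by (simp flip: exp_add)
      qed
      then have "log_count (orbital_covering_number N F \<epsilon> (microstates R N \<O>)) \<le> ereal (\<delta> * (real N)\<^sup>2)"
        by (rule log_count_splits)
      then have "ereal (1 / (real N)\<^sup>2) * log_count (orbital_covering_number N F \<epsilon> (microstates R N \<O>))
        \<le> ereal (1 / (real N)\<^sup>2) * ereal (\<delta> * (real N)\<^sup>2)"
        by (rule ereal_mult_left_mono) simp
      also have "\<dots> = ereal \<delta>" using N1' by simp
      finally show ?thesis .
    qed
    have "limsup (\<lambda>N. ereal (1 / (real N)\<^sup>2) * log_count (orbital_covering_number N F \<epsilon> (microstates R N \<O>))) \<le> ereal \<delta>"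
      by (rule Limsup_bounded) (use le in \<open>auto simp: eventually_sequentially intro!: exI [of _ "max (max 1 N1) N2"]\<close>)
    then show ?thesis
      using oO KO by (intro INF_lower2 [of \<O>]) auto
  qed
  have "law_entropy R (trace_laws a) \<le> 0"
    unfolding law_entropy_def
  proof (rule SUP_least, clarify)
    fix F :: "'i set" and \<epsilon> :: real assume F: "finite F" and eps: "\<epsilon> > 0"
    show "(INF \<O>\<in>{\<O>. openin (top_of_set (tracial_laws R)) \<O> \<and> trace_laws a \<subseteq> \<O>}.
        limsup (\<lambda>N. ereal (1 / (real N)\<^sup>2) * log_count (orbital_covering_number N F \<epsilon> (microstates R N \<O>)))) \<le> 0"
      by (rule ereal_le_epsilon2) (rule fixed [OF F eps])
  qed
  then show ?thesis by (simp add: cstar_entropy_def)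
qed

end

lemma min_tensor_commuting_pair:
  assumes "min_tensor_product H \<pi> K \<sigma> t"
  shows "commuting_pair (\<lambda>x. t x 1) (\<lambda>y. t 1 y)"
proof -
  note T = assms [unfolded min_tensor_product_def]
  have l1: "\<forall>a. clinear (t a)" and l2: "\<forall>b. clinear (\<lambda>a. t a b)"
    and m: "\<forall>a b a' b'. t a b * t a' b' = t (a * a') (b * b')"
    and s: "\<forall>a b. (t a b)\<^sup>\<star> = t (a\<^sup>\<star>) (b\<^sup>\<star>)" and o: "t 1 1 = 1"
    and d: "closure (range (\<lambda>us. \<Sum>(a, b)\<leftarrow>us. t a b)) = UNIV"
    using T by simp_all
  have A: "unital_star_hom (\<lambda>x. t x 1)"
  proof (rule unital_star_hom.intro)
    fix x y c
    show "t (x + y) 1 = t x 1 + t y 1" "t (c *\<^sub>C x) 1 = c *\<^sub>C t x 1" using l2 by (simp_all add: clinear_def)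
    show "t (x * y) 1 = t x 1 * t y 1" "t (x\<^sup>\<star>) 1 = (t x 1)\<^sup>\<star>" by (simp_all add: m s)
  qed (rule o)
  have B: "unital_star_hom (\<lambda>y. t 1 y)"
  proof (rule unital_star_hom.intro)
    fix x y c
    show "t 1 (x + y) = t 1 x + t 1 y" "t 1 (c *\<^sub>C x) = c *\<^sub>C t 1 x" using l1 by (simp_all add: clinear_def)
    show "t 1 (x * y) = t 1 x * t 1 y" "t 1 (x\<^sup>\<star>) = (t 1 x)\<^sup>\<star>" by (simp_all add: m s)
  qed (rule o)
  have "t x 1 * t 1 y = t x y" "t 1 y * t x 1 = t x y" for x y by (simp_all add: m)
  then have "commuting_pair_axioms (\<lambda>x. t x 1) (\<lambda>y. t 1 y)"
    by (intro commuting_pair_axioms.intro) (simp_all add: d)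
  with A B show ?thesis by (rule commuting_pair.intro)
qed

theorem theorem13p1:
  fixes H :: "'h::complex_vector hspace" and \<pi> :: "'a::cstar_algebra \<Rightarrow> 'h \<Rightarrow> 'h"
    and K :: "'k::complex_vector hspace" and \<sigma> :: "'b::cstar_algebra \<Rightarrow> 'k \<Rightarrow> 'k"
    and tensor :: "'a \<Rightarrow> 'b \<Rightarrow> 'c::cstar_algebra"
    and a :: "'i \<Rightarrow> 'c" and R :: real
  assumes diffuse_A: "\<forall>\<tau>\<in>(traces :: ('a \<Rightarrow> complex) set). diffuse (gns_space \<tau>) (gns_von_neumann \<tau>)"
    and diffuse_B: "\<forall>\<tau>\<in>(traces :: ('b \<Rightarrow> complex) set). diffuse (gns_space \<tau>) (gns_von_neumann \<tau>)"
    and tensor: "min_tensor_product H \<pi> K \<sigma> tensor"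
    and traces: "(traces :: ('c \<Rightarrow> complex) set) \<noteq> {}"
    and gen: "generates a" and "R > 0" and bound: "\<forall>i. norm (a i) \<le> R"
  shows "cstar_entropy R a \<le> 0"
proof -
  have pair: "commuting_pair (\<lambda>x. tensor x 1) (\<lambda>y. tensor 1 y)"
    by (rule min_tensor_commuting_pair [OF tensor])
  then have A: "unital_star_hom (\<lambda>x. tensor x 1)" and B: "unital_star_hom (\<lambda>y. tensor 1 y)"
    by (simp_all only: commuting_pair_def)
  have dA: "diffuse (gns_space (\<lambda>x. \<tau> (tensor x 1))) (gns_von_neumann (\<lambda>x. \<tau> (tensor x 1)))"
    if t: "\<tau> \<in> traces" for \<tau> :: "'c \<Rightarrow> complex"
    by (rule bspec [OF diffuse_A unital_star_hom.trace_restrict [OF A t]])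
  have dB: "diffuse (gns_space (\<lambda>y. \<tau> (tensor 1 y))) (gns_von_neumann (\<lambda>y. \<tau> (tensor 1 y)))"
    if t: "\<tau> \<in> traces" for \<tau> :: "'c \<Rightarrow> complex"
    by (rule bspec [OF diffuse_B unital_star_hom.trace_restrict [OF B t]])
  show ?thesis
    by (rule commuting_pair.entropy_le_zero [OF pair gen bound \<open>R > 0\<close> dA dB])
qed

end
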